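(* Suppose that $\Lambda$ is a proper, source-free topological $k$-graph, and $c$ is a continuous $\mathbb{T}$-valued $2$-cocycle on $\Lambda$. For each $n\in\mathbb{N}^k$, let $Y_n$ be the $C_0(\Lambda^\infty)$-correspondence associated to the topological graph $\Lambda_{\infty,n}=(\Lambda^\infty,\Lambda^\infty,T^0,T^n)$. For $f\in Y_m$ and $g\in Y_n$, define $fg\colon\Lambda^\infty\to\mathbb{C}$ by $$(fg)(x):=c(x(0,m),x(m,m+n))\,f(x)\,g(T^m(x)).$$ Then $fg\in Y_{m+n}$, and under this multiplication, the family $Y:=\bigsqcup_{n\in\mathbb{N}^k}Y_n$ of $C_0(\Lambda^\infty)$-correspondences is a product system over $\mathbb{N}^k$.
   Context: $\mathbb{N}=\{0,1,2,\dots\}$, $k\ge1$, $e_1,\dots,e_k$ are the standard generators of $\mathbb{N}^k$, $\le$ is the coordinatewise order. A topological $k$-graph is a pair $(\Lambda,d)$ (written $\Lambda$) consisting of a small category $\Lambda=(\mathrm{Obj}(\Lambda),\mathrm{Mor}(\Lambda),r,s,\circ)$ ($r$ = codomain, $s$ = domain) and a functor $d\colon\Lambda\to\mathbb{N}^k$ such that: (i) $\mathrm{Obj}(\Lambda)$ and $\mathrm{Mor}(\Lambda)$ are second-countable, locally compact Hausdorff spaces; (ii) $r,s\colon\mathrm{Mor}(\Lambda)\to\mathrm{Obj}(\Lambda)$ are continuous and $s$ is a local homeomorphism; (iii) composition $\Lambda\times_c\Lambda:=\{(\lambda,\mu):s(\lambda)=r(\mu)\}\to\Lambda$ is continuous and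 open ($\Lambda\times_c\Lambda$ having the subspace topology of the product topology); (iv) $d$ is continuous, $\mathbb{N}^k$ being discrete; (v) whenever $d(\lambda)=m+n$ there is a unique $(\mu,\nu)\in\Lambda\times_c\Lambda$ with $\lambda=\mu\nu$, $d(\mu)=m$, $d(\nu)=n$. We write $\lambda\in\Lambda$ for morphisms, $\Lambda^n:=d^{-1}(n)$, and identify $\mathrm{Obj}(\Lambda)$ with $\Lambda^0$. $\Lambda$ is source-free if for all $v\in\Lambda^0$ and all $i$ there is $\lambda\in\Lambda^{e_i}$ with $r(\lambda)=v$; $\Lambda$ is proper if for each $m\in\mathbb{N}^k$ preimages of compact subsets of $\Lambda^0$ under $r|_{\Lambda^m}$ are compact in $\Lambda^m$. $\Omega_k$ is the category with objects $\mathbb{N}^k$, morphisms $(m,n)$ for $m\le n$ in $\mathbb{N}^k$, $r(m,n)=m$, $s(m,n)=n$, $(m,n)(n,p)=(m,p)$ and degree $d(m,n)=n-m$. $\Lambda^\infty$ is the set of degree-preserving functors $x\colon\Omega_k\to\Lambda$; $x(m,n)\in\Lambda^{n-m}$ is the image of the morphism $(m,n)$. For $U\subseteq\Lambda$, $Z(U):=\{x\in\Lambda^\infty: x(0,n)\in U\text{ for some }n\}$. $\Lambda^\infty$ carries the locally compact Hausdorff topology with basis $\{Z(U):U\text{ open in }\Lambda^n\text{ for some }n\in\mathbb{N}^k\}$. For $p\in\mathbb{N}^k$, $T^p\colon\Lambda^\infty\to\Lambda^\infty$ is the local homeomorphism $T^p(x)(m,n):=x(m+p,n+p)$; $T^0=\mathrm{id}$.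 A continuous $\mathbb{T}$-valued $2$-cocycle on $\Lambda$ is a continuous map $c\colon\Lambda\times_c\Lambda\to\mathbb{T}$ with $c(\lambda,\mu)c(\lambda\mu,\nu)=c(\lambda,\mu\nu)c(\mu,\nu)$ whenever $s(\lambda)=r(\mu)$, $s(\mu)=r(\nu)$, and $c(\lambda,s(\lambda))=c(r(\lambda),\lambda)=1$ for all $\lambda$. A $C^*$-correspondence over a $C^*$-algebra $A$ ($A$-correspondence) is a right Hilbert $A$-module $X$ with a left action of $A$ given by a homomorphism $\phi\colon A\to\mathcal{L}(X)$ into the adjointable operators. A topological graph $E=(E^0,E^1,r,s)$ consists of locally compact Hausdorff spaces $E^0,E^1$, a continuous map $r\colon E^1\to E^0$ and a local homeomorphism $s\colon E^1\to E^0$. Its associated $C_0(E^0)$-correspondence $X(E)$ consists of all $f\in C(E^1)$ with $\langle f,f\rangle\in C_0(E^0)$ (equivalently, it is the completion of $C_c(E^1)$), where $\langle f,g\rangle(v)=\sum_{e\in s^{-1}(v)}\overline{f(e)}g(e)$, $(g\cdot f)(e)=g(r(e))f(e)$, $(f\cdot g)(e)=f(e)g(s(e))$ for $g\in C_0(E^0)$. A product system over $\mathbb{N}^k$ with coefficient algebra $A$ is a semigroup $X=\bigsqcup_{n\in\mathbb{N}^k}X_n$ such that each $X_n$ is an $A$-correspondence; $X_0$ is a copy of ${}_AA_A$; for nonzero $m,n\in\mathbb{N}^k$ the multiplication map $X_m\times X_n\to X_{m+n}$, $x\otimes y\mapsto xy$, extends to an isomorphism of $A$-correspondences $X_m\otimes_AX_n\cong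 X_{m+n}$; and $ax=a\cdot x$, $xa=x\cdot a$ for all $x\in X$, $a\in X_0$. *)

theory Defs
  imports "HOL-Analysis.Analysis"
begin

section \<open>Small categories and functors\<close>

record ('o, 'm) cat =
  Obj :: "'o set"
  Mor :: "'m set"
  rng :: "'m \<Rightarrow> 'o"
  src :: "'m \<Rightarrow> 'o"
  ident :: "'o \<Rightarrow> 'm"
  cmp :: "'m \<Rightarrow> 'm \<Rightarrow> 'm"

text \<open>Composition is written in the order of the paths: \<open>cmp C l m\<close> is \<open>l m\<close>, defined when
  \<open>src C l = rng C m\<close>.\<close>

definition composable :: "('o, 'm, 'z) cat_scheme \<Rightarrow> ('m \<times> 'm) set" where
  "composable C = {(l, m). l \<in> Mor C \<and> m \<in> Mor C \<and> src C l = rng C m}"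

definition small_category :: "('o, 'm, 'z) cat_scheme \<Rightarrow> bool" where
  "small_category C \<longleftrightarrow>
     (\<forall>l\<in>Mor C. rng C l \<in> Obj C \<and> src C l \<in> Obj C) \<and>
     (\<forall>v\<in>Obj C. ident C v \<in> Mor C \<and> rng C (ident C v) = v \<and> src C (ident C v) = v) \<and>
     (\<forall>(l, m)\<in>composable C. cmp C l m \<in> Mor C \<and>
        rng C (cmp C l m) = rng C l \<and> src C (cmp C l m) = src C m) \<and>
     (\<forall>l\<in>Mor C. cmp C (ident C (rng C l)) l = l \<and> cmp C l (ident C (src C l)) = l) \<and>
     (\<forall>l m n. (l, m) \<in> composable C \<and> (m, n) \<in> composable C \<longrightarrow>
        cmp C (cmp C l m) n = cmp C l (cmp C m n))"

definition is_functor ::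
  "('o, 'm, 'y) cat_scheme \<Rightarrow> ('p, 'n, 'z) cat_scheme \<Rightarrow> ('o \<Rightarrow> 'p) \<Rightarrow> ('m \<Rightarrow> 'n) \<Rightarrow> bool" where
  "is_functor C D F0 F1 \<longleftrightarrow>
     (\<forall>v\<in>Obj C. F0 v \<in> Obj D \<and> F1 (ident C v) = ident D (F0 v)) \<and>
     (\<forall>l\<in>Mor C. F1 l \<in> Mor D \<and> rng D (F1 l) = F0 (rng C l) \<and> src D (F1 l) = F0 (src C l)) \<and>
     (\<forall>(l, m)\<in>composable C. F1 (cmp C l m) = cmp D (F1 l) (F1 m))"

definition Nk_cat :: "(unit, nat ^ 'k) cat" where
  "Nk_cat = \<lparr>Obj = UNIV, Mor = UNIV, rng = (\<lambda>_. ()), src = (\<lambda>_. ()),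
             ident = (\<lambda>_. 0), cmp = (+)\<rparr>"

definition Omega :: "(nat ^ 'k, (nat ^ 'k) \<times> (nat ^ 'k)) cat" where
  "Omega = \<lparr>Obj = UNIV, Mor = {(m, n). m \<le> n}, rng = fst, src = snd,
            ident = (\<lambda>m. (m, m)), cmp = (\<lambda>a b. (fst a, snd b))\<rparr>"


section \<open>Topological k-graphs\<close>

definition local_homeomorphism :: "'a topology \<Rightarrow> 'b topology \<Rightarrow> ('a \<Rightarrow> 'b) \<Rightarrow> bool" where
  "local_homeomorphism X Y f \<longleftrightarrow>
     (\<forall>x\<in>topspace X. \<exists>U. openin X U \<and> x \<in> U \<and> openin Y (f ` U) \<and>
        homeomorphic_map (subtopology X U) (subtopology Y (f ` U)) f)"

record ('o, 'm, 'k) top_kgraph = "('o, 'm) cat" +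
  obj_top :: "'o topology"
  mor_top :: "'m topology"
  deg :: "'m \<Rightarrow> nat ^ 'k"

definition composable_top :: "('o, 'm, 'k::finite) top_kgraph \<Rightarrow> ('m \<times> 'm) topology" where
  "composable_top L = subtopology (prod_topology (mor_top L) (mor_top L)) (composable L)"

definition topological_kgraph :: "('o, 'm, 'k::finite) top_kgraph \<Rightarrow> bool" where
  "topological_kgraph L \<longleftrightarrow>
     small_category L \<and> is_functor L Nk_cat (\<lambda>_. ()) (deg L) \<and>
     topspace (obj_top L) = Obj L \<and> topspace (mor_top L) = Mor L \<and>
     second_countable (obj_top L) \<and> locally_compact_space (obj_top L) \<and> Hausdorff_space (obj_top L) \<and>
     second_countable (mor_top L) \<and> locally_compact_space (mor_top L) \<and> Hausdorff_space (mor_top L) \<and>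
     continuous_map (mor_top L) (obj_top L) (rng L) \<and>
     continuous_map (mor_top L) (obj_top L) (src L) \<and>
     local_homeomorphism (mor_top L) (obj_top L) (src L) \<and>
     continuous_map (composable_top L) (mor_top L) (\<lambda>(l, m). cmp L l m) \<and>
     open_map (composable_top L) (mor_top L) (\<lambda>(l, m). cmp L l m) \<and>
     continuous_map (mor_top L) (discrete_topology UNIV) (deg L) \<and>
     (\<forall>l\<in>Mor L. \<forall>m n. deg L l = m + n \<longrightarrow>
        (\<exists>!p. p \<in> composable L \<and> l = cmp L (fst p) (snd p) \<and> deg L (fst p) = m \<and> deg L (snd p) = n))"

definition deg_part :: "('o, 'm, 'k::finite) top_kgraph \<Rightarrow> nat ^ 'k \<Rightarrow> 'm set" where
  "deg_part L n = {l \<in> Mor L. deg L l = n}"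

definition deg_part_top :: "('o, 'm, 'k::finite) top_kgraph \<Rightarrow> nat ^ 'k \<Rightarrow> 'm topology" where
  "deg_part_top L n = subtopology (mor_top L) (deg_part L n)"

text \<open>\<open>axis i 1\<close> is the i-th standard generator.\<close>

definition source_free :: "('o, 'm, 'k::finite) top_kgraph \<Rightarrow> bool" where
  "source_free L \<longleftrightarrow> (\<forall>v\<in>Obj L. \<forall>i. \<exists>l\<in>deg_part L (axis i 1). rng L l = v)"

definition proper_kgraph :: "('o, 'm, 'k::finite) top_kgraph \<Rightarrow> bool" where
  "proper_kgraph L \<longleftrightarrow>
     (\<forall>m K. compactin (obj_top L) K \<longrightarrow>
        compactin (deg_part_top L m) {l \<in> deg_part L m. rng L l \<in> K})"

definition continuous_cocycle :: "('o, 'm, 'k::finite) top_kgraph \<Rightarrow> ('m \<Rightarrow> 'm \<Rightarrow> complex) \<Rightarrow> bool" where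
  "continuous_cocycle L c \<longleftrightarrow>
     continuous_map (composable_top L) (top_of_set {z. cmod z = 1}) (\<lambda>(l, m). c l m) \<and>
     (\<forall>l m n. (l, m) \<in> composable L \<and> (m, n) \<in> composable L \<longrightarrow>
        c l m * c (cmp L l m) n = c l (cmp L m n) * c m n) \<and>
     (\<forall>l\<in>Mor L. c l (ident L (src L l)) = 1 \<and> c (ident L (rng L l)) l = 1)"


section \<open>The infinite-path space\<close>

text \<open>A functor is a pair of an object map and a morphism map; the morphism map is \<open>undefined\<close>
  at pairs that are not morphisms of \<open>Omega\<close>, so that equality of paths is equality of functors.\<close>

type_synonym ('o, 'm, 'k) path = "(nat ^ 'k \<Rightarrow> 'o) \<times> ((nat ^ 'k) \<times> (nat ^ 'k) \<Rightarrow> 'm)"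

definition inf_paths :: "('o, 'm, 'k::finite) top_kgraph \<Rightarrow> ('o, 'm, 'k) path set" where
  "inf_paths L = {(x0, x1). is_functor Omega L x0 x1 \<and> x1 \<in> extensional (Mor Omega) \<and>
                            (\<forall>m n. m \<le> n \<longrightarrow> deg L (x1 (m, n)) = n - m)}"

definition seg :: "('o, 'm, 'k::finite) path \<Rightarrow> nat ^ 'k \<Rightarrow> nat ^ 'k \<Rightarrow> 'm" where
  "seg x m n = snd x (m, n)"

definition cyl :: "('o, 'm, 'k::finite) top_kgraph \<Rightarrow> 'm set \<Rightarrow> ('o, 'm, 'k) path set" where
  "cyl L U = {x \<in> inf_paths L. \<exists>n. seg x 0 n \<in> U}"

definition path_top :: "('o, 'm, 'k::finite) top_kgraph \<Rightarrow> ('o, 'm, 'k) path topology" where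
  "path_top L = topology_generated_by {cyl L U | U n. openin (deg_part_top L n) U}"

definition shift :: "nat ^ 'k \<Rightarrow> ('o, 'm, 'k::finite) path \<Rightarrow> ('o, 'm, 'k) path" where
  "shift p x = ((\<lambda>m. fst x (m + p)),
                restrict (\<lambda>(m, n). seg x (m + p) (n + p)) (Mor Omega))"


section \<open>C*-algebras and C*-correspondences\<close>

record 'v cvs =
  vcarrier :: "'v set"
  vzero :: 'v
  vadd :: "'v \<Rightarrow> 'v \<Rightarrow> 'v"
  vscale :: "complex \<Rightarrow> 'v \<Rightarrow> 'v"

definition complex_vs :: "('v, 'z) cvs_scheme \<Rightarrow> bool" where
  "complex_vs V \<longleftrightarrow>
     vzero V \<in> vcarrier V \<and>
     (\<forall>x\<in>vcarrier V. \<forall>y\<in>vcarrier V. vadd V x y \<in> vcarrier V \<and> vadd V x y = vadd V y x) \<and>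
     (\<forall>x\<in>vcarrier V. \<forall>y\<in>vcarrier V. \<forall>z\<in>vcarrier V.
        vadd V (vadd V x y) z = vadd V x (vadd V y z)) \<and>
     (\<forall>x\<in>vcarrier V. vadd V (vzero V) x = x \<and> (\<exists>y\<in>vcarrier V. vadd V x y = vzero V)) \<and>
     (\<forall>x\<in>vcarrier V. \<forall>a. vscale V a x \<in> vcarrier V) \<and>
     (\<forall>x\<in>vcarrier V. \<forall>y\<in>vcarrier V. \<forall>a.
        vscale V a (vadd V x y) = vadd V (vscale V a x) (vscale V a y)) \<and>
     (\<forall>x\<in>vcarrier V. \<forall>a b. vscale V (a + b) x = vadd V (vscale V a x) (vscale V b x) \<and>
        vscale V (a * b) x = vscale V a (vscale V b x)) \<and>
     (\<forall>x\<in>vcarrier V. vscale V 1 x = x)"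

definition vdiff :: "('v, 'z) cvs_scheme \<Rightarrow> 'v \<Rightarrow> 'v \<Rightarrow> 'v" where
  "vdiff V x y = vadd V x (vscale V (- 1) y)"

definition norm_complete :: "('v, 'z) cvs_scheme \<Rightarrow> ('v \<Rightarrow> real) \<Rightarrow> bool" where
  "norm_complete V N \<longleftrightarrow>
     (\<forall>s. (\<forall>i. s i \<in> vcarrier V) \<and> (\<forall>e>0. \<exists>M. \<forall>i\<ge>M. \<forall>j\<ge>M. N (vdiff V (s i) (s j)) < e) \<longrightarrow>
        (\<exists>x\<in>vcarrier V. (\<lambda>i. N (vdiff V (s i) x)) \<longlonglongrightarrow> 0))"

record 'a cstar = "'a cvs" +
  amult :: "'a \<Rightarrow> 'a \<Rightarrow> 'a"
  astar :: "'a \<Rightarrow> 'a"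
  anorm :: "'a \<Rightarrow> real"

definition cstar_algebra :: "'a cstar \<Rightarrow> bool" where
  "cstar_algebra A \<longleftrightarrow>
     complex_vs A \<and>
     (\<forall>a\<in>vcarrier A. \<forall>b\<in>vcarrier A. amult A a b \<in> vcarrier A) \<and>
     (\<forall>a\<in>vcarrier A. \<forall>b\<in>vcarrier A. \<forall>c\<in>vcarrier A.
        amult A (amult A a b) c = amult A a (amult A b c) \<and>
        amult A a (vadd A b c) = vadd A (amult A a b) (amult A a c) \<and>
        amult A (vadd A a b) c = vadd A (amult A a c) (amult A b c)) \<and>
     (\<forall>a\<in>vcarrier A. \<forall>b\<in>vcarrier A. \<forall>z.
        amult A (vscale A z a) b = vscale A z (amult A a b) \<and>
        amult A a (vscale A z b) = vscale A z (amult A a b)) \<and>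
     (\<forall>a\<in>vcarrier A. astar A a \<in> vcarrier A \<and> astar A (astar A a) = a) \<and>
     (\<forall>a\<in>vcarrier A. \<forall>b\<in>vcarrier A.
        astar A (vadd A a b) = vadd A (astar A a) (astar A b) \<and>
        astar A (amult A a b) = amult A (astar A b) (astar A a)) \<and>
     (\<forall>a\<in>vcarrier A. \<forall>z. astar A (vscale A z a) = vscale A (cnj z) (astar A a)) \<and>
     (\<forall>a\<in>vcarrier A. 0 \<le> anorm A a \<and> (anorm A a = 0 \<longleftrightarrow> a = vzero A)) \<and>
     (\<forall>a\<in>vcarrier A. \<forall>z. anorm A (vscale A z a) = cmod z * anorm A a) \<and>
     (\<forall>a\<in>vcarrier A. \<forall>b\<in>vcarrier A.
        anorm A (vadd A a b) \<le> anorm A a + anorm A b \<and>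
        anorm A (amult A a b) \<le> anorm A a * anorm A b) \<and>
     norm_complete A (anorm A) \<and>
     (\<forall>a\<in>vcarrier A. anorm A (amult A (astar A a) a) = (anorm A a)\<^sup>2)"

definition positive_elt :: "'a cstar \<Rightarrow> 'a \<Rightarrow> bool" where
  "positive_elt A a \<longleftrightarrow> (\<exists>b\<in>vcarrier A. a = amult A (astar A b) b)"

record ('a, 'x) corr = "'x cvs" +
  ip :: "'x \<Rightarrow> 'x \<Rightarrow> 'a"
  ract :: "'x \<Rightarrow> 'a \<Rightarrow> 'x"
  lact :: "'a \<Rightarrow> 'x \<Rightarrow> 'x"

definition cnorm :: "'a cstar \<Rightarrow> ('a, 'x) corr \<Rightarrow> 'x \<Rightarrow> real" where
  "cnorm A X x = sqrt (anorm A (ip X x x))"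

definition hilbert_module :: "'a cstar \<Rightarrow> ('a, 'x) corr \<Rightarrow> bool" where
  "hilbert_module A X \<longleftrightarrow>
     complex_vs X \<and>
     (\<forall>x\<in>vcarrier X. \<forall>a\<in>vcarrier A. ract X x a \<in> vcarrier X) \<and>
     (\<forall>x\<in>vcarrier X. \<forall>y\<in>vcarrier X. \<forall>a\<in>vcarrier A.
        ract X (vadd X x y) a = vadd X (ract X x a) (ract X y a)) \<and>
     (\<forall>x\<in>vcarrier X. \<forall>a\<in>vcarrier A. \<forall>b\<in>vcarrier A.
        ract X x (vadd A a b) = vadd X (ract X x a) (ract X x b) \<and>
        ract X x (amult A a b) = ract X (ract X x a) b) \<and>
     (\<forall>x\<in>vcarrier X. \<forall>a\<in>vcarrier A. \<forall>z.
        ract X (vscale X z x) a = vscale X z (ract X x a) \<and>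
        ract X x (vscale A z a) = vscale X z (ract X x a)) \<and>
     (\<forall>x\<in>vcarrier X. \<forall>y\<in>vcarrier X. ip X x y \<in> vcarrier A \<and> astar A (ip X x y) = ip X y x) \<and>
     (\<forall>x\<in>vcarrier X. \<forall>y\<in>vcarrier X. \<forall>z\<in>vcarrier X.
        ip X x (vadd X y z) = vadd A (ip X x y) (ip X x z)) \<and>
     (\<forall>x\<in>vcarrier X. \<forall>y\<in>vcarrier X. \<forall>z. ip X x (vscale X z y) = vscale A z (ip X x y)) \<and>
     (\<forall>x\<in>vcarrier X. \<forall>y\<in>vcarrier X. \<forall>a\<in>vcarrier A.
        ip X x (ract X y a) = amult A (ip X x y) a) \<and>
     (\<forall>x\<in>vcarrier X. positive_elt A (ip X x x) \<and> (ip X x x = vzero A \<longleftrightarrow> x = vzero X)) \<and>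
     norm_complete X (cnorm A X)"

definition adjoint_maps :: "('a, 'x) corr \<Rightarrow> ('x \<Rightarrow> 'x) \<Rightarrow> ('x \<Rightarrow> 'x) \<Rightarrow> bool" where
  "adjoint_maps X T S \<longleftrightarrow>
     T \<in> vcarrier X \<rightarrow> vcarrier X \<and> S \<in> vcarrier X \<rightarrow> vcarrier X \<and>
     (\<forall>x\<in>vcarrier X. \<forall>y\<in>vcarrier X. ip X (T x) y = ip X x (S y))"

text \<open>The clauses on \<open>lact\<close> say that it is a *-homomorphism into the adjointable operators,
  the adjoint of the operator of \<open>a\<close> being that of \<open>astar A a\<close>. Additivity and A-linearity of each
  operator follow from adjointability.\<close>

definition correspondence :: "'a cstar \<Rightarrow> ('a, 'x) corr \<Rightarrow> bool" where
  "correspondence A X \<longleftrightarrow>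
     hilbert_module A X \<and>
     (\<forall>a\<in>vcarrier A. adjoint_maps X (lact X a) (lact X (astar A a))) \<and>
     (\<forall>a\<in>vcarrier A. \<forall>b\<in>vcarrier A. \<forall>x\<in>vcarrier X.
        lact X (vadd A a b) x = vadd X (lact X a x) (lact X b x) \<and>
        lact X (amult A a b) x = lact X a (lact X b x)) \<and>
     (\<forall>a\<in>vcarrier A. \<forall>x\<in>vcarrier X. \<forall>z. lact X (vscale A z a) x = vscale X z (lact X a x))"

definition corr_iso :: "'a cstar \<Rightarrow> ('a, 'x) corr \<Rightarrow> ('a, 'y) corr \<Rightarrow> ('x \<Rightarrow> 'y) \<Rightarrow> bool" where
  "corr_iso A X Y F \<longleftrightarrow>
     bij_betw F (vcarrier X) (vcarrier Y) \<and>
     (\<forall>x\<in>vcarrier X. \<forall>y\<in>vcarrier X.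
        F (vadd X x y) = vadd Y (F x) (F y) \<and> ip Y (F x) (F y) = ip X x y) \<and>
     (\<forall>x\<in>vcarrier X. \<forall>z. F (vscale X z x) = vscale Y z (F x)) \<and>
     (\<forall>x\<in>vcarrier X. \<forall>a\<in>vcarrier A.
        F (ract X x a) = ract Y (F x) a \<and> F (lact X a x) = lact Y a (F x))"

text \<open>The algebra as a correspondence over itself.\<close>

definition self_corr :: "'a cstar \<Rightarrow> ('a, 'a) corr" where
  "self_corr A = \<lparr>vcarrier = vcarrier A, vzero = vzero A, vadd = vadd A, vscale = vscale A,
     ip = (\<lambda>a b. amult A (astar A a) b), ract = amult A, lact = amult A\<rparr>"


section \<open>Internal tensor products\<close>

text \<open>A list \<open>[(x1, y1), ..., (xp, yp)]\<close> stands for the element \<open>x1 \<otimes> y1 + ... + xp \<otimes> yp\<close> of the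
  algebraic tensor product. The A-valued form
  \<open>\<langle>x \<otimes> y, x' \<otimes> y'\<rangle> = \<langle>y, \<langle>x, x'\<rangle> \<cdot> y'\<rangle>\<close> induces a seminorm on such sums, and \<open>tensor\<close> is the
  Hausdorff completion: Cauchy sequences of formal sums modulo sequences whose difference tends
  to 0. Different lists for the same algebraic tensor, and \<open>(x \<cdot> a) \<otimes> y\<close> and \<open>x \<otimes> (a \<cdot> y)\<close>, are at
  distance 0 and hence get identified.\<close>

type_synonym ('x, 'y) fsum = "('x \<times> 'y) list"

definition fsums :: "('a, 'x) corr \<Rightarrow> ('a, 'y) corr \<Rightarrow> ('x, 'y) fsum set" where
  "fsums X Y = lists (vcarrier X \<times> vcarrier Y)"

definition fs_scale :: "('a, 'x) corr \<Rightarrow> complex \<Rightarrow> ('x, 'y) fsum \<Rightarrow> ('x, 'y) fsum" where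
  "fs_scale X z t = map (\<lambda>(x, y). (vscale X z x, y)) t"

definition fs_ip ::
  "'a cstar \<Rightarrow> ('a, 'x) corr \<Rightarrow> ('a, 'y) corr \<Rightarrow> ('x, 'y) fsum \<Rightarrow> ('x, 'y) fsum \<Rightarrow> 'a" where
  "fs_ip A X Y t u =
     foldr (vadd A)
       (map (\<lambda>((x, y), (x', y')). ip Y y (lact Y (ip X x x') y')) (List.product t u)) (vzero A)"

definition fs_dist ::
  "'a cstar \<Rightarrow> ('a, 'x) corr \<Rightarrow> ('a, 'y) corr \<Rightarrow> ('x, 'y) fsum \<Rightarrow> ('x, 'y) fsum \<Rightarrow> real" where
  "fs_dist A X Y t u =
     (let w = t @ fs_scale X (- 1) u in sqrt (anorm A (fs_ip A X Y w w)))"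

definition fs_cauchy ::
  "'a cstar \<Rightarrow> ('a, 'x) corr \<Rightarrow> ('a, 'y) corr \<Rightarrow> (nat \<Rightarrow> ('x, 'y) fsum) set" where
  "fs_cauchy A X Y = {s. (\<forall>i. s i \<in> fsums X Y) \<and>
     (\<forall>e>0. \<exists>M. \<forall>i\<ge>M. \<forall>j\<ge>M. fs_dist A X Y (s i) (s j) < e)}"

definition fs_class ::
  "'a cstar \<Rightarrow> ('a, 'x) corr \<Rightarrow> ('a, 'y) corr \<Rightarrow> (nat \<Rightarrow> ('x, 'y) fsum) \<Rightarrow> (nat \<Rightarrow> ('x, 'y) fsum) set"
  where
  "fs_class A X Y s = {t \<in> fs_cauchy A X Y. (\<lambda>i. fs_dist A X Y (s i) (t i)) \<longlonglongrightarrow> 0}"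

definition tensor ::
  "'a cstar \<Rightarrow> ('a, 'x) corr \<Rightarrow> ('a, 'y) corr \<Rightarrow> ('a, (nat \<Rightarrow> ('x, 'y) fsum) set) corr" where
  "tensor A X Y = \<lparr>
     vcarrier = fs_class A X Y ` fs_cauchy A X Y,
     vzero = fs_class A X Y (\<lambda>_. []),
     vadd = (\<lambda>S T. \<Union>s\<in>S. \<Union>t\<in>T. fs_class A X Y (\<lambda>i. s i @ t i)),
     vscale = (\<lambda>z S. \<Union>s\<in>S. fs_class A X Y (\<lambda>i. fs_scale X z (s i))),
     ip = (\<lambda>S T. THE a. a \<in> vcarrier A \<and>
            (\<forall>s\<in>S. \<forall>t\<in>T. (\<lambda>i. anorm A (vdiff A (fs_ip A X Y (s i) (t i)) a)) \<longlonglongrightarrow> 0)),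
     ract = (\<lambda>S a. \<Union>s\<in>S. fs_class A X Y (\<lambda>i. map (\<lambda>(x, y). (x, ract Y y a)) (s i))),
     lact = (\<lambda>a S. \<Union>s\<in>S. fs_class A X Y (\<lambda>i. map (\<lambda>(x, y). (lact X a x, y)) (s i)))\<rparr>"

definition elem_tensor ::
  "'a cstar \<Rightarrow> ('a, 'x) corr \<Rightarrow> ('a, 'y) corr \<Rightarrow> 'x \<Rightarrow> 'y \<Rightarrow> (nat \<Rightarrow> ('x, 'y) fsum) set" where
  "elem_tensor A X Y x y = fs_class A X Y (\<lambda>_. [(x, y)])"


section \<open>Product systems\<close>

text \<open>The elements of the semigroup are the pairs \<open>(n, x)\<close> with \<open>x\<close> in the fibre \<open>X n\<close>, and
  \<open>(m, x) (n, y) = (m + n, mul m n x y)\<close>. The map \<open>j\<close> is the identification of the coefficient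
  algebra with the fibre over 0.\<close>

definition product_system ::
  "'a cstar \<Rightarrow> (nat ^ 'k \<Rightarrow> ('a, 'x) corr) \<Rightarrow> (nat ^ 'k \<Rightarrow> nat ^ 'k \<Rightarrow> 'x \<Rightarrow> 'x \<Rightarrow> 'x) \<Rightarrow> bool" where
  "product_system A X mul \<longleftrightarrow>
     cstar_algebra A \<and>
     (\<forall>n. correspondence A (X n)) \<and>
     (\<forall>m n. \<forall>x\<in>vcarrier (X m). \<forall>y\<in>vcarrier (X n). mul m n x y \<in> vcarrier (X (m + n))) \<and>
     (\<forall>m n p. \<forall>x\<in>vcarrier (X m). \<forall>y\<in>vcarrier (X n). \<forall>z\<in>vcarrier (X p).
        mul (m + n) p (mul m n x y) z = mul m (n + p) x (mul n p y z)) \<and>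
     (\<forall>m n. m \<noteq> 0 \<and> n \<noteq> 0 \<longrightarrow>
        (\<exists>F. corr_iso A (tensor A (X m) (X n)) (X (m + n)) F \<and>
           (\<forall>x\<in>vcarrier (X m). \<forall>y\<in>vcarrier (X n).
              F (elem_tensor A (X m) (X n) x y) = mul m n x y))) \<and>
     (\<exists>j. corr_iso A (self_corr A) (X 0) j \<and>
        (\<forall>n. \<forall>a\<in>vcarrier A. \<forall>x\<in>vcarrier (X n).
           mul 0 n (j a) x = lact (X n) a x \<and> mul n 0 x (j a) = ract (X n) x a))"


section \<open>The algebra of a space and the correspondence of a topological graph\<close>

text \<open>Functions on a space are total functions on the underlying type that vanish outside the
  space. With this convention the supremum norm may be taken over the whole type, which gives 0
  also for the empty space.\<close>

definition C0_set :: "'v topology \<Rightarrow> ('v \<Rightarrow> complex) set" where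
  "C0_set X = {f. (\<forall>x. x \<notin> topspace X \<longrightarrow> f x = 0) \<and> continuous_map X euclidean f \<and>
     (\<forall>e>0. compactin X {x \<in> topspace X. e \<le> cmod (f x)})}"

definition C0 :: "'v topology \<Rightarrow> ('v \<Rightarrow> complex) cstar" where
  "C0 X = \<lparr>vcarrier = C0_set X, vzero = (\<lambda>_. 0), vadd = (\<lambda>f g x. f x + g x),
     vscale = (\<lambda>z f x. z * f x), amult = (\<lambda>f g x. f x * g x), astar = (\<lambda>f x. cnj (f x)),
     anorm = (\<lambda>f. SUP x. cmod (f x))\<rparr>"

record ('v, 'e) top_graph =
  gE0 :: "'v topology"
  gE1 :: "'e topology"
  grng :: "'e \<Rightarrow> 'v"
  gsrc :: "'e \<Rightarrow> 'v"

text \<open>The record holds only the data. It is used below at \<open>path_graph\<close>, where under the hypotheses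
  the spaces are locally compact Hausdorff and \<open>gsrc\<close> is a local homeomorphism.\<close>

definition graph_fibre :: "('v, 'e) top_graph \<Rightarrow> 'v \<Rightarrow> 'e set" where
  "graph_fibre E v = {e \<in> topspace (gE1 E). gsrc E e = v}"

definition graph_ip :: "('v, 'e) top_graph \<Rightarrow> ('e \<Rightarrow> complex) \<Rightarrow> ('e \<Rightarrow> complex) \<Rightarrow> 'v \<Rightarrow> complex" where
  "graph_ip E f g v =
     (if v \<in> topspace (gE0 E) then \<Sum>\<^sub>\<infinity>e\<in>graph_fibre E v. cnj (f e) * g e else 0)"

text \<open>Summability on the fibres has to be demanded separately in the carrier, because \<open>infsum\<close>
  is 0 on families that are not summable.\<close>

definition graph_corr :: "('v, 'e) top_graph \<Rightarrow> ('v \<Rightarrow> complex, 'e \<Rightarrow> complex) corr" where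
  "graph_corr E = \<lparr>
     vcarrier = {f. (\<forall>e. e \<notin> topspace (gE1 E) \<longrightarrow> f e = 0) \<and> continuous_map (gE1 E) euclidean f \<and>
       (\<forall>v\<in>topspace (gE0 E). (\<lambda>e. cnj (f e) * f e) summable_on graph_fibre E v) \<and>
       graph_ip E f f \<in> C0_set (gE0 E)},
     vzero = (\<lambda>_. 0),
     vadd = (\<lambda>f g e. f e + g e),
     vscale = (\<lambda>z f e. z * f e),
     ip = graph_ip E,
     ract = (\<lambda>f a e. f e * a (gsrc E e)),
     lact = (\<lambda>a f e. a (grng E e) * f e)\<rparr>"


section \<open>The product system of infinite paths\<close>

definition path_graph ::
  "('o, 'm, 'k::finite) top_kgraph \<Rightarrow> nat ^ 'k \<Rightarrow> (('o, 'm, 'k) path, ('o, 'm, 'k) path) top_graph" where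
  "path_graph L n = \<lparr>gE0 = path_top L, gE1 = path_top L, grng = shift 0, gsrc = shift n\<rparr>"

definition path_corr ::
  "('o, 'm, 'k::finite) top_kgraph \<Rightarrow> nat ^ 'k \<Rightarrow>
     (('o, 'm, 'k) path \<Rightarrow> complex, ('o, 'm, 'k) path \<Rightarrow> complex) corr" where
  "path_corr L n = graph_corr (path_graph L n)"

text \<open>Outside the path space the first factor \<open>f\<close> is 0, so the product again vanishes there.\<close>

definition path_mult ::
  "('m \<Rightarrow> 'm \<Rightarrow> complex) \<Rightarrow> nat ^ 'k \<Rightarrow> nat ^ 'k \<Rightarrow> (('o, 'm, 'k::finite) path \<Rightarrow> complex) \<Rightarrow>
     (('o, 'm, 'k) path \<Rightarrow> complex) \<Rightarrow> ('o, 'm, 'k) path \<Rightarrow> complex" where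
  "path_mult c m n f g x = c (seg x 0 m) (seg x m (m + n)) * f x * g (shift m x)"

end

theory Submission
  imports Defs
begin

text \<open>The shifts \<open>T\<^sup>n\<close> are local homeomorphisms of the Hausdorff space \<open>\<Lambda>\<^sup>\<infinity>\<close>: on a cylinder over a set on
  which the source map is injective, the inverse prepends the path of degree \<open>n\<close> determined by its
  source. The multiplication preserves the tensor product forms because sums over the fibres of
  \<open>T\<^bsup>m+n\<^esup>\<close> are iterated sums over those of \<open>T\<^sup>n\<close> and \<open>T\<^sup>m\<close> and because the cocycle is unimodular. It has
  dense range by an approximate polar decomposition of \<open>h \<in> Y\<^bsub>m+n\<^esub>\<close>: if \<open>k\<close> is the sum of \<open>|h|\<^sup>2\<close> over the
  fibres of \<open>T\<^sup>m\<close>, then \<open>h\<close> is the limit as \<open>\<epsilon> \<rightarrow> 0\<close> of the products of a function of modulus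
  \<open>|h| (sqrt k / (k + \<epsilon>)) \<circ> T\<^sup>m\<close> with \<open>sqrt k\<close>. Continuity of all fibre sums involved follows from
  domination by a fibre sum that is known to be continuous.\<close>

section \<open>Continuity by neighbourhood filters\<close>

text \<open>The fibres of \<open>shift n\<close> may be infinite, so a fibre sum of continuous
  functions need not be continuous: nearby fibres can receive mass from points that are close to no
  point of the given fibre. The remedy is dominated convergence over a moving fibre. If the sum of a
  majorant is continuous at v, then near v all but a small part of it sits, uniformly, on finitely
  many local sections. Closure of the correspondences under sums and multipliers, membership of
  inner products in C_0 and continuity of k all reduce to this. The internal tensor product is a
  completion of formal sums whose structure is never developed on its own. Each class is identified
  with the limit of its images in the concrete module Y_{m+n}, which is complete. Preservation of
  the forms makes this injective, density makes it surjective, and well-definedness of every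
  operation is inherited from the target. The error of the approximate decomposition tends to 0 only
  pointwise at first. Choosing \<epsilon> along a decreasing sequence makes it monotone, so that
  Dini's theorem gives smallness in the supremum over all fibres, which is the module norm.\<close>

lemma filterlim_nhdsin_continuous_map:
  assumes "continuous_map X Y f" "x \<in> topspace X"
  shows "filterlim f (nhdsin Y (f x)) (nhdsin X x)"
  unfolding filterlim_iff
proof (intro allI impI)
  fix P assume "eventually P (nhdsin Y (f x))"
  moreover have "f x \<in> topspace Y"
    using assms by (auto simp: continuous_map_def)
  ultimately obtain S where S: "openin Y S" "f x \<in> S" "\<forall>y\<in>S. P y"
    by (auto simp: eventually_nhdsin)
  have "openin X {y \<in> topspace X. f y \<in> S}"
    using assms(1) S(1) by (auto simp: continuous_map_def)
  then show "\<forall>\<^sub>F y in nhdsin X x. P (f y)"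
    unfolding eventually_nhdsin using S assms(2) by blast
qed

lemma eventually_nhdsin_openin: "openin X U \<Longrightarrow> x \<in> U \<Longrightarrow> eventually (\<lambda>y. y \<in> U) (nhdsin X x)"
  unfolding eventually_nhdsin by blast

lemma eventually_nhdsin_topspace: "eventually (\<lambda>y. y \<in> topspace X) (nhdsin X x)"
  unfolding eventually_nhdsin using openin_topspace by blast

lemma eventually_nhdsin_self: "eventually P (nhdsin X x) \<Longrightarrow> x \<in> topspace X \<Longrightarrow> P x"
  unfolding eventually_nhdsin by blast

lemma nhdsin_euclidean: "nhdsin euclidean x = nhds x"
  by (intro filter_eqI) (auto simp: eventually_nhdsin eventually_nhds)

text \<open>The path space carries an abstract topology and no type class, so continuity is traded
  for limits along \<open>nhdsin\<close>, which makes the \<open>tendsto\<close> calculus available.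
  The filter is not punctured: an eventual property holds at the point itself.\<close>

lemma continuous_map_iff_tendsto_nhdsin:
  fixes f :: "'a \<Rightarrow> 'b::topological_space"
  shows "continuous_map X euclidean f \<longleftrightarrow> (\<forall>x\<in>topspace X. (f \<longlongrightarrow> f x) (nhdsin X x))"
proof
  assume "continuous_map X euclidean f"
  then show "\<forall>x\<in>topspace X. (f \<longlongrightarrow> f x) (nhdsin X x)"
    using filterlim_nhdsin_continuous_map[of X euclidean f] by (auto simp: nhdsin_euclidean)
next
  assume *: "\<forall>x\<in>topspace X. (f \<longlongrightarrow> f x) (nhdsin X x)"
  have "openin X {x \<in> topspace X. f x \<in> U}" if "open U" for U
    unfolding openin_subopen[of X "{x \<in> topspace X. f x \<in> U}"]
  proof safe
    fix x assume x: "x \<in> topspace X" "f x \<in> U"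
    with * that have "\<forall>\<^sub>F y in nhdsin X x. f y \<in> U"
      by (auto simp: tendsto_def)
    then obtain T where T: "openin X T" "x \<in> T" "\<forall>y\<in>T. f y \<in> U"
      using x(1) by (auto simp: eventually_nhdsin)
    then have "T \<subseteq> {x \<in> topspace X. f x \<in> U}"
      using openin_subset by blast
    with T show "\<exists>T. openin X T \<and> x \<in> T \<and> T \<subseteq> {x \<in> topspace X. f x \<in> U}"
      by blast
  qed
  then show "continuous_map X euclidean f"
    by (auto simp: continuous_map_def)
qed

lemma continuous_map_tendsto_nhdsin:
  fixes f :: "'a \<Rightarrow> 'b::topological_space"
  shows "continuous_map X euclidean f \<Longrightarrow> x \<in> topspace X \<Longrightarrow> (f \<longlongrightarrow> f x) (nhdsin X x)"
  by (simp add: continuous_map_iff_tendsto_nhdsin)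

section \<open>The algebra of continuous functions vanishing at infinity\<close>

lemma C0_set_tendsto: "f \<in> C0_set X \<Longrightarrow> x \<in> topspace X \<Longrightarrow> (f \<longlongrightarrow> f x) (nhdsin X x)"
  by (auto simp: C0_set_def continuous_map_iff_tendsto_nhdsin)

lemma C0_set_outside: "f \<in> C0_set X \<Longrightarrow> x \<notin> topspace X \<Longrightarrow> f x = 0"
  by (auto simp: C0_set_def)

lemma C0_set_compactin: "f \<in> C0_set X \<Longrightarrow> e > 0 \<Longrightarrow> compactin X {x \<in> topspace X. e \<le> cmod (f x)}"
  by (auto simp: C0_set_def)

lemma closedin_cmod_ge:
  assumes "continuous_map X euclidean f"
  shows "closedin X {x \<in> topspace X. e \<le> cmod (f x)}"
proof -
  have "closedin euclidean {z::complex. e \<le> cmod z}"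
    by (simp add: closed_Collect_le continuous_on_norm)
  from closedin_continuous_map_preimage[OF assms this] show ?thesis
    by simp
qed

text \<open>Covers both domination by a function vanishing at infinity and uniform limits.\<close>

lemma C0_setI:
  assumes "\<And>x. x \<notin> topspace X \<Longrightarrow> f x = 0"
    and "\<And>x. x \<in> topspace X \<Longrightarrow> (f \<longlongrightarrow> f x) (nhdsin X x)"
    and "\<And>e. e > 0 \<Longrightarrow> \<exists>g\<in>C0_set X. \<forall>x\<in>topspace X. cmod (f x) \<le> cmod (g x) + e"
  shows "f \<in> C0_set X"
proof -
  have cont: "continuous_map X euclidean f"
    using assms(2) by (simp add: continuous_map_iff_tendsto_nhdsin)
  have "compactin X {x \<in> topspace X. e \<le> cmod (f x)}" if e: "e > 0" for e
  proof -
    obtain g where g: "g \<in> C0_set X" "\<forall>x\<in>topspace X. cmod (f x) \<le> cmod (g x) + e / 2"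
      using assms(3)[of "e/2"] e by auto
    show ?thesis
    proof (rule closed_compactin)
      show "compactin X {x \<in> topspace X. e / 2 \<le> cmod (g x)}"
        using g(1) e by (intro C0_set_compactin) auto
      show "{x \<in> topspace X. e \<le> cmod (f x)} \<subseteq> {x \<in> topspace X. e / 2 \<le> cmod (g x)}"
        using g(2) by fastforce
      show "closedin X {x \<in> topspace X. e \<le> cmod (f x)}"
        using cont by (rule closedin_cmod_ge)
    qed
  qed
  with assms(1) cont show ?thesis
    by (auto simp: C0_set_def)
qed

lemma C0_set_dominated:
  assumes "\<And>x. x \<notin> topspace X \<Longrightarrow> f x = 0"
    and "\<And>x. x \<in> topspace X \<Longrightarrow> (f \<longlongrightarrow> f x) (nhdsin X x)"
    and "g \<in> C0_set X" "\<And>x. x \<in> topspace X \<Longrightarrow> cmod (f x) \<le> cmod (g x)"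
  shows "f \<in> C0_set X"
  using assms by (intro C0_setI) (fastforce intro!: bexI[of _ g])+

lemma C0_set_bounded:
  assumes "f \<in> C0_set X"
  obtains B where "B \<ge> 0" "\<And>x. cmod (f x) \<le> B"
proof -
  have "compactin X {x \<in> topspace X. 1 \<le> cmod (f x)}"
    using assms by (rule C0_set_compactin) auto
  moreover have "continuous_map X euclidean f"
    using assms by (auto simp: C0_set_def)
  ultimately have "compact (f ` {x \<in> topspace X. 1 \<le> cmod (f x)})"
    using image_compactin compactin_euclidean_iff by blast
  then obtain B where B: "\<forall>y\<in>f ` {x \<in> topspace X. 1 \<le> cmod (f x)}. cmod y \<le> B"
    using compact_imp_bounded bounded_iff by blast
  have "cmod (f x) \<le> max 1 B" for x
    using B C0_set_outside[OF assms, of x] by (cases "1 \<le> cmod (f x)") fastforce+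
  then show ?thesis
    using that[of "max 1 B"] by auto
qed

lemma C0_set_zero: "(\<lambda>_. 0) \<in> C0_set X"
  by (auto simp: C0_set_def)

lemma C0_set_scale: "f \<in> C0_set X \<Longrightarrow> (\<lambda>x. z * f x) \<in> C0_set X"
proof -
  assume f: "f \<in> C0_set X"
  have "compactin X {x \<in> topspace X. e \<le> cmod (z * f x)}" if "e > 0" for e
  proof (cases "z = 0")
    case False
    then have "{x \<in> topspace X. e \<le> cmod (z * f x)} = {x \<in> topspace X. e / cmod z \<le> cmod (f x)}"
      by (auto simp: norm_mult field_simps)
    with f False that show ?thesis
      using C0_set_compactin[of f X "e / cmod z"] by simp
  qed (use that in simp)
  moreover have "continuous_map X euclidean (\<lambda>x. z * f x)"
    by (auto simp: continuous_map_iff_tendsto_nhdsin intro!: tendsto_intros C0_set_tendsto[OF f])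
  ultimately show ?thesis
    using f by (auto simp: C0_set_def)
qed

lemma C0_set_add:
  assumes f: "f \<in> C0_set X" and g: "g \<in> C0_set X"
  shows "(\<lambda>x. f x + g x) \<in> C0_set X"
proof -
  have cont: "continuous_map X euclidean (\<lambda>x. f x + g x)"
    by (auto simp: continuous_map_iff_tendsto_nhdsin intro!: tendsto_intros C0_set_tendsto[OF f] C0_set_tendsto[OF g])
  have "compactin X {x \<in> topspace X. e \<le> cmod (f x + g x)}" if e: "e > 0" for e
  proof (rule closed_compactin)
    show "compactin X ({x \<in> topspace X. e / 2 \<le> cmod (f x)} \<union> {x \<in> topspace X. e / 2 \<le> cmod (g x)})"
      using f g e by (intro compactin_Un C0_set_compactin) auto
    show "{x \<in> topspace X. e \<le> cmod (f x + g x)}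
        \<subseteq> {x \<in> topspace X. e / 2 \<le> cmod (f x)} \<union> {x \<in> topspace X. e / 2 \<le> cmod (g x)}"
    proof clarsimp
      fix x assume "e \<le> cmod (f x + g x)" "\<not> e \<le> cmod (g x) * 2"
      with norm_triangle_ineq[of "f x" "g x"] show "e \<le> cmod (f x) * 2" by simp
    qed
  qed (rule closedin_cmod_ge[OF cont])
  with f g cont show ?thesis
    by (auto simp: C0_set_def)
qed

lemma C0_set_mult_bounded:
  assumes f: "f \<in> C0_set X" and B: "\<And>x. x \<in> topspace X \<Longrightarrow> cmod (b x) \<le> B"
    and b: "\<And>x. x \<in> topspace X \<Longrightarrow> (b \<longlongrightarrow> b x) (nhdsin X x)"
  shows "(\<lambda>x. f x * b x) \<in> C0_set X"
proof (rule C0_set_dominated)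
  show "(\<lambda>x. of_real (\<bar>B\<bar>) * f x) \<in> C0_set X"
    using f by (rule C0_set_scale)
  show "cmod (f x * b x) \<le> cmod (complex_of_real \<bar>B\<bar> * f x)" if "x \<in> topspace X" for x
    using B[OF that] by (auto simp: norm_mult mult.commute intro!: mult_right_mono)
qed (auto intro!: tendsto_intros C0_set_tendsto[OF f] b simp: C0_set_outside[OF f])

lemma C0_set_mult: "f \<in> C0_set X \<Longrightarrow> g \<in> C0_set X \<Longrightarrow> (\<lambda>x. f x * g x) \<in> C0_set X"
  by (rule C0_set_bounded[of g X]) (auto intro!: C0_set_mult_bounded C0_set_tendsto)

lemma C0_set_cnj: "f \<in> C0_set X \<Longrightarrow> (\<lambda>x. cnj (f x)) \<in> C0_set X"
  by (rule C0_set_dominated[of X _ f]) (auto intro!: tendsto_intros C0_set_tendsto simp: C0_set_outside)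

text \<open>The superlevel set of \<open>sqrt h\<close> at e is that of h at e^2. As
  \<open>sqrt\<close> is an odd function, this is correct for either sign of
  \<open>h x\<close>.\<close>

lemma C0_set_sqrt:
  assumes "(\<lambda>x. complex_of_real (h x)) \<in> C0_set X"
  shows "(\<lambda>x. complex_of_real (sqrt (h x))) \<in> C0_set X"
proof -
  have h: "(h \<longlongrightarrow> h x) (nhdsin X x)" if "x \<in> topspace X" for x
    using tendsto_Re[OF C0_set_tendsto[OF assms that]] by simp
  have "compactin X {x \<in> topspace X. e \<le> cmod (complex_of_real (sqrt (h x)))}" if "e > 0" for e
  proof -
    have "{x \<in> topspace X. e \<le> cmod (complex_of_real (sqrt (h x)))}
        = {x \<in> topspace X. e\<^sup>2 \<le> cmod (complex_of_real (h x))}"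
    proof -
      have "e \<le> cmod (complex_of_real (sqrt (h x))) \<longleftrightarrow> e\<^sup>2 \<le> cmod (complex_of_real (h x))" for x
      proof -
        have "cmod (complex_of_real (sqrt (h x))) = sqrt \<bar>h x\<bar>"
          by (simp add: abs_if real_sqrt_minus)
        moreover have "e = sqrt (e\<^sup>2)"
          using that by simp
        ultimately show ?thesis
          by (metis norm_of_real real_sqrt_le_iff)
      qed
      then show ?thesis by simp
    qed
    then show ?thesis
      using C0_set_compactin[OF assms, of "e\<^sup>2"] that by simp
  qed
  moreover have "continuous_map X euclidean (\<lambda>x. complex_of_real (sqrt (h x)))"
    by (auto simp: continuous_map_iff_tendsto_nhdsin intro!: tendsto_intros h)
  ultimately show ?thesis
    using assms by (auto simp: C0_set_def)
qed

abbreviation C0_norm :: "('v \<Rightarrow> complex) \<Rightarrow> real" where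
  "C0_norm f \<equiv> SUP x. cmod (f x)"

lemma C0_norm_upper:
  assumes "f \<in> C0_set X" shows "cmod (f x) \<le> C0_norm f"
proof -
  obtain B where "\<And>x. cmod (f x) \<le> B"
    using C0_set_bounded[OF assms] by blast
  then show ?thesis
    by (intro cSUP_upper) (auto intro!: bdd_aboveI2)
qed

lemma C0_norm_least: "(\<And>x. cmod (f x) \<le> B) \<Longrightarrow> C0_norm f \<le> B"
  by (rule cSUP_least) auto

lemma C0_norm_nonneg: "f \<in> C0_set X \<Longrightarrow> 0 \<le> C0_norm f"
  using C0_norm_upper[of f X] norm_ge_zero order_trans by blast

lemma C0_sel [simp]:
  "vcarrier (C0 X) = C0_set X" "vzero (C0 X) = (\<lambda>_. 0)" "vadd (C0 X) = (\<lambda>f g x. f x + g x)"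
  "vscale (C0 X) = (\<lambda>z f x. z * f x)" "amult (C0 X) = (\<lambda>f g x. f x * g x)"
  "astar (C0 X) = (\<lambda>f x. cnj (f x))" "anorm (C0 X) = C0_norm"
  by (auto simp: C0_def)

lemma uniform_limit_tendsto_nhdsin:
  fixes s :: "nat \<Rightarrow> 'a \<Rightarrow> complex"
  assumes s: "\<And>i. (s i \<longlongrightarrow> s i x) (nhdsin X x)"
    and u: "\<And>e. e > 0 \<Longrightarrow> \<exists>i. \<forall>y\<in>topspace X. cmod (s i y - f y) \<le> e"
    and x: "x \<in> topspace X"
  shows "(f \<longlongrightarrow> f x) (nhdsin X x)"
proof (rule tendstoI)
  fix e :: real assume e: "e > 0"
  obtain i where i: "\<forall>y\<in>topspace X. cmod (s i y - f y) \<le> e / 4"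
    \<comment> \<open>Three errors of size at most e/4 each, so the total stays strictly below
      e.\<close>
    using u[of "e/4"] e by auto
  have "\<forall>\<^sub>F y in nhdsin X x. dist (s i y) (s i x) < e / 4"
    using tendstoD[OF s[of i], of "e/4"] e by simp
  with eventually_nhdsin_topspace[of X x] show "\<forall>\<^sub>F y in nhdsin X x. dist (f y) (f x) < e"
  proof eventually_elim
    case (elim y)
    have "f y - f x = (s i y - s i x) - (s i y - f y) + (s i x - f x)" by simp
    also have "cmod \<dots> \<le> cmod (s i y - s i x) + cmod (s i y - f y) + cmod (s i x - f x)"
      by (meson add_right_mono norm_triangle_ineq norm_triangle_ineq4 order_trans)
    also have "\<dots> < e"
      using elim i[THEN bspec, of x] i[THEN bspec, of y] x e by (auto simp: dist_norm)
    finally show ?case by (simp add: dist_norm)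
  qed
qed

text \<open>The uniform rate comes from letting j tend to infinity in the Cauchy estimate with i
  fixed. The value 0 off \<open>A\<close> matches the convention that functions vanish outside their
  space.\<close>

lemma uniformly_Cauchy_pointwise_limit:
  fixes s :: "nat \<Rightarrow> 'a \<Rightarrow> complex"
  assumes "\<And>e. e > 0 \<Longrightarrow> \<exists>M. \<forall>i\<ge>M. \<forall>j\<ge>M. \<forall>x\<in>A. cmod (s i x - s j x) \<le> e"
  obtains f where "\<And>x. x \<in> A \<Longrightarrow> (\<lambda>i. s i x) \<longlonglongrightarrow> f x" "\<And>x. x \<notin> A \<Longrightarrow> f x = 0"
    "\<And>e. e > 0 \<Longrightarrow> \<exists>M. \<forall>i\<ge>M. \<forall>x\<in>A. cmod (s i x - f x) \<le> e"
proof -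
  have "convergent (\<lambda>i. s i x)" if "x \<in> A" for x
  proof (rule Cauchy_convergent, rule metric_CauchyI)
    fix e :: real assume "e > 0"
    then obtain M where "\<forall>i\<ge>M. \<forall>j\<ge>M. \<forall>x\<in>A. cmod (s i x - s j x) \<le> e/2"
      using assms[of "e/2"] by auto
    then show "\<exists>M. \<forall>i\<ge>M. \<forall>j\<ge>M. dist (s i x) (s j x) < e"
      using that \<open>e > 0\<close> by (intro exI[of _ M]) (force simp: dist_norm)
  qed
  then have *: "(\<lambda>i. s i x) \<longlonglongrightarrow> lim (\<lambda>i. s i x)" if "x \<in> A" for x
    using that by (simp add: convergent_LIMSEQ_iff)
  define f where "f = (\<lambda>x. if x \<in> A then lim (\<lambda>i. s i x) else 0)"
  have "\<exists>M. \<forall>i\<ge>M. \<forall>x\<in>A. cmod (s i x - f x) \<le> e" if e: "e > 0" for e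
  proof -
    obtain M where M: "\<forall>i\<ge>M. \<forall>j\<ge>M. \<forall>x\<in>A. cmod (s i x - s j x) \<le> e"
      using assms[OF e] by auto
    have "cmod (s i x - f x) \<le> e" if "i \<ge> M" "x \<in> A" for i x
    proof (rule tendsto_upperbound)
      show "(\<lambda>j. cmod (s i x - s j x)) \<longlonglongrightarrow> cmod (s i x - f x)"
        using *[OF that(2)] that by (auto intro!: tendsto_intros simp: f_def)
      show "\<forall>\<^sub>F j in sequentially. cmod (s i x - s j x) \<le> e"
        using M that by (auto simp: eventually_sequentially)
    qed auto
    then show ?thesis by blast
  qed
  then show ?thesis
    using * that[of f] by (auto simp: f_def)
qed

lemma norm_complete_C0: "norm_complete (C0 X) (anorm (C0 X))"
  unfolding norm_complete_def
proof (intro allI impI)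
  fix s :: "nat \<Rightarrow> 'a \<Rightarrow> complex"
  assume "(\<forall>i. s i \<in> vcarrier (C0 X)) \<and>
    (\<forall>e>0. \<exists>M. \<forall>i\<ge>M. \<forall>j\<ge>M. anorm (C0 X) (vdiff (C0 X) (s i) (s j)) < e)"
  then have s: "\<And>i. s i \<in> C0_set X"
    and C: "\<And>e. e > 0 \<Longrightarrow> \<exists>M. \<forall>i\<ge>M. \<forall>j\<ge>M. C0_norm (\<lambda>x. s i x - s j x) < e"
    by (auto simp: vdiff_def)
  have diff: "(\<lambda>x. s i x - s j x) \<in> C0_set X" for i j
    using C0_set_add[OF s C0_set_scale[OF s, of "-1"]] by simp
  have "\<exists>M. \<forall>i\<ge>M. \<forall>j\<ge>M. \<forall>x\<in>topspace X. cmod (s i x - s j x) \<le> e" if e: "e > 0" for e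
    using C[OF e] C0_norm_upper[OF diff] by (meson order.strict_trans1 less_imp_le)
  then obtain f where f: "\<And>x. x \<in> topspace X \<Longrightarrow> (\<lambda>i. s i x) \<longlonglongrightarrow> f x"
      "\<And>x. x \<notin> topspace X \<Longrightarrow> f x = 0"
      "\<And>e. e > 0 \<Longrightarrow> \<exists>M. \<forall>i\<ge>M. \<forall>x\<in>topspace X. cmod (s i x - f x) \<le> e"
    using uniformly_Cauchy_pointwise_limit by blast
  have "f \<in> C0_set X"
  proof (rule C0_setI)
    show "(f \<longlongrightarrow> f x) (nhdsin X x)" if "x \<in> topspace X" for x
    proof (rule uniform_limit_tendsto_nhdsin[OF C0_set_tendsto[OF s that] _ that])
      show "\<exists>i. \<forall>y\<in>topspace X. cmod (s i y - f y) \<le> e" if "e > 0" for e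
        using f(3)[OF that] by blast
    qed
    show "\<exists>g\<in>C0_set X. \<forall>x\<in>topspace X. cmod (f x) \<le> cmod (g x) + e" if e: "e > 0" for e
    proof -
      obtain M where "\<forall>i\<ge>M. \<forall>x\<in>topspace X. cmod (s i x - f x) \<le> e"
        using f(3)[OF e] by blast
      then have "\<forall>x\<in>topspace X. cmod (s M x - f x) \<le> e"
        by blast
      then have "\<forall>x\<in>topspace X. cmod (f x) \<le> cmod (s M x) + e"
        by (smt (verit) norm_triangle_ineq3)
      then show ?thesis using s by blast
    qed
  qed (rule f)
  moreover have "(\<lambda>i. C0_norm (\<lambda>x. s i x - f x)) \<longlonglongrightarrow> 0"
  proof (rule LIMSEQ_I)
    fix e :: real assume "e > 0"
    then obtain M where M: "\<forall>i\<ge>M. \<forall>x\<in>topspace X. cmod (s i x - f x) \<le> e/2"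
      using f(3)[of "e/2"] by auto
    have "C0_norm (\<lambda>x. s i x - f x) \<le> e/2 \<and> 0 \<le> C0_norm (\<lambda>x. s i x - f x)" if "i \<ge> M" for i
    proof
      have *: "cmod (s i x - f x) \<le> e/2" for x
        using M that f(2) s[THEN C0_set_outside] \<open>e > 0\<close> by (cases "x \<in> topspace X") auto
      then show "C0_norm (\<lambda>x. s i x - f x) \<le> e/2"
        by (rule C0_norm_least)
      have "cmod (s i x - f x) \<le> C0_norm (\<lambda>x. s i x - f x)" for x
        by (rule cSUP_upper[OF UNIV_I]) (rule bdd_aboveI2, rule *)
      then show "0 \<le> C0_norm (\<lambda>x. s i x - f x)"
        by (rule order_trans[OF norm_ge_zero])
    qed
    with \<open>e > 0\<close> show "\<exists>M. \<forall>i\<ge>M. norm (C0_norm (\<lambda>x. s i x - f x) - 0) < e"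
      by (intro exI[of _ M]) fastforce
  qed
  ultimately show "\<exists>x\<in>vcarrier (C0 X). (\<lambda>i. anorm (C0 X) (vdiff (C0 X) (s i) x)) \<longlonglongrightarrow> 0"
    by (auto simp: vdiff_def)
qed

lemma complex_vs_functions:
  assumes "vzero V = (\<lambda>_. 0)" "vadd V = (\<lambda>f g x. f x + g x)" "vscale V = (\<lambda>z f x. z * f x)"
    and "(\<lambda>_. 0) \<in> vcarrier V"
    and "\<And>f g. f \<in> vcarrier V \<Longrightarrow> g \<in> vcarrier V \<Longrightarrow> (\<lambda>x. f x + g x) \<in> vcarrier V"
    and scale: "\<And>f z. f \<in> vcarrier V \<Longrightarrow> (\<lambda>x. z * f x) \<in> vcarrier V"
  shows "complex_vs (V :: ('a \<Rightarrow> complex, 'z) cvs_scheme)"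
proof -
  have "\<exists>g\<in>vcarrier V. (\<lambda>x. f x + g x) = (\<lambda>_. 0)" if "f \<in> vcarrier V" for f
    using scale[OF that, of "-1"] by (intro bexI[of _ "\<lambda>x. - 1 * f x"]) auto
  then show ?thesis
    unfolding complex_vs_def assms(1-3)
    using assms(4-6) by (simp add: algebra_simps)
qed

lemma C0_norm_mult: "f \<in> C0_set X \<Longrightarrow> g \<in> C0_set X \<Longrightarrow> C0_norm (\<lambda>x. f x * g x) \<le> C0_norm f * C0_norm g"
  by (rule C0_norm_least)
    (auto simp: norm_mult intro!: mult_mono C0_norm_upper C0_norm_nonneg)

lemma C0_norm_add: "f \<in> C0_set X \<Longrightarrow> g \<in> C0_set X \<Longrightarrow> C0_norm (\<lambda>x. f x + g x) \<le> C0_norm f + C0_norm g"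
  by (rule C0_norm_least) (rule norm_triangle_le[OF add_mono[OF C0_norm_upper C0_norm_upper]])

lemma C0_norm_scale:
  assumes "f \<in> C0_set X" shows "C0_norm (\<lambda>x. z * f x) = cmod z * C0_norm f"
proof (cases "z = 0")
  case False
  have le: "C0_norm (\<lambda>x. w * g x) \<le> cmod w * C0_norm g" if "g \<in> C0_set X" for w g
    by (rule C0_norm_least) (auto simp: norm_mult intro!: mult_left_mono C0_norm_upper[OF that])
  \<comment> \<open>The reverse inequality is the first one applied to \<open>inverse z\<close> and
    the scaled function.\<close>
  have "C0_norm f \<le> cmod (inverse z) * C0_norm (\<lambda>x. z * f x)"
    using le[OF C0_set_scale[OF assms, of z], of "inverse z"] False
    by (simp add: mult.assoc[symmetric])
  with False have "cmod z * C0_norm f \<le> C0_norm (\<lambda>x. z * f x)"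
    by (simp add: norm_inverse norm_divide field_simps)
  with le[OF assms, of z] show ?thesis by simp
qed auto

text \<open>The C*-identity. In the harder direction, |f x|^2 is a value of the product, so |f x| is
  at most the square root of the norm of the product.\<close>

lemma C0_norm_square:
  assumes f: "f \<in> C0_set X" shows "C0_norm (\<lambda>x. cnj (f x) * f x) = (C0_norm f)\<^sup>2"
proof (rule antisym)
  show "C0_norm (\<lambda>x. cnj (f x) * f x) \<le> (C0_norm f)\<^sup>2"
    by (rule C0_norm_least) (auto simp: norm_mult power2_eq_square intro!: mult_mono C0_norm_upper[OF f] C0_norm_nonneg[OF f])
  have *: "(\<lambda>x. cnj (f x) * f x) \<in> C0_set X"
    using f by (intro C0_set_mult C0_set_cnj)
  have "cmod (f x) \<le> sqrt (C0_norm (\<lambda>x. cnj (f x) * f x))" for x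
    using C0_norm_upper[OF *, of x] by (intro real_le_rsqrt) (simp add: norm_mult power2_eq_square)
  then have "C0_norm f \<le> sqrt (C0_norm (\<lambda>x. cnj (f x) * f x))"
    by (rule C0_norm_least)
  then have "(C0_norm f)\<^sup>2 \<le> (sqrt (C0_norm (\<lambda>x. cnj (f x) * f x)))\<^sup>2"
    using C0_norm_nonneg[OF f] by (rule power_mono)
  then show "(C0_norm f)\<^sup>2 \<le> C0_norm (\<lambda>x. cnj (f x) * f x)"
    using C0_norm_nonneg[OF *] by simp
qed

lemma C0_norm_eq_0: "f \<in> C0_set X \<Longrightarrow> C0_norm f = 0 \<longleftrightarrow> f = (\<lambda>_. 0)"
  using C0_norm_upper[of f X] by fastforce

lemma cstar_algebra_C0: "cstar_algebra (C0 X)"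
proof -
  have "complex_vs (C0 X)"
    by (rule complex_vs_functions) (auto intro: C0_set_zero C0_set_add C0_set_scale)
  then show ?thesis
    unfolding cstar_algebra_def
    by (simp add: mult_ac add_ac ring_distribs C0_norm_square[unfolded mult.commute[of "cnj _"]] norm_complete_C0[simplified] C0_norm_nonneg C0_norm_eq_0 C0_norm_square
        C0_set_mult C0_set_cnj C0_norm_mult C0_norm_add C0_norm_scale)
qed

section \<open>Sums over the fibres of a local homeomorphism\<close>

lemma nhdsin_subtopology_open:
  assumes "openin X U" "x \<in> U"
  shows "nhdsin (subtopology X U) x = nhdsin X x"
proof (intro filter_eqI)
  fix P
  have x: "x \<in> topspace X" using assms openin_subset by blast
  show "eventually P (nhdsin (subtopology X U) x) = eventually P (nhdsin X x)"
  proof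
    assume "eventually P (nhdsin (subtopology X U) x)"
    then obtain S where S: "openin (subtopology X U) S" "x \<in> S" "\<forall>y\<in>S. P y"
      using x assms by (auto simp: eventually_nhdsin)
    then have "openin X S"
      using assms(1) openin_open_subtopology by blast
    with S show "eventually P (nhdsin X x)"
      by (auto simp: eventually_nhdsin)
  next
    assume "eventually P (nhdsin X x)"
    then obtain S where S: "openin X S" "x \<in> S" "\<forall>y\<in>S. P y"
      using x by (auto simp: eventually_nhdsin)
    then have "openin (subtopology X U) (S \<inter> U)"
      by (auto simp: openin_subtopology)
    with S assms(2) show "eventually P (nhdsin (subtopology X U) x)"
      by (auto simp: eventually_nhdsin intro!: exI[of _ "S \<inter> U"])
  qed
qed

lemma local_homeomorphism_tendsto:
  assumes "local_homeomorphism X Y s" "x \<in> topspace X"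
  shows "filterlim s (nhdsin Y (s x)) (nhdsin X x)" "s x \<in> topspace Y"
proof -
  obtain U where U: "openin X U" "x \<in> U" "openin Y (s ` U)"
    "homeomorphic_map (subtopology X U) (subtopology Y (s ` U)) s"
    using assms unfolding local_homeomorphism_def by blast
  have "filterlim s (nhdsin (subtopology Y (s ` U)) (s x)) (nhdsin (subtopology X U) x)"
    using U openin_subset[OF U(1)]
    by (intro filterlim_nhdsin_continuous_map homeomorphic_imp_continuous_map) auto
  then show "filterlim s (nhdsin Y (s x)) (nhdsin X x)"
    using U by (simp add: nhdsin_subtopology_open)
  show "s x \<in> topspace Y"
    using U openin_subset by blast
qed

text \<open>\<open>t\<close> inverts a homeomorphic restriction of \<open>s\<close> to an open
  neighbourhood of x. Only its germ at \<open>s x\<close> matters, so nothing is said about its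
  values elsewhere.\<close>

lemma local_homeomorphism_section:
  assumes "local_homeomorphism X Y s" "x \<in> topspace X"
  obtains t where "filterlim t (nhdsin X x) (nhdsin Y (s x))"
    "\<forall>\<^sub>F y in nhdsin Y (s x). t y \<in> topspace X \<and> s (t y) = y" "t (s x) = x"
proof -
  obtain U where U: "openin X U" "x \<in> U" "openin Y (s ` U)"
    "homeomorphic_map (subtopology X U) (subtopology Y (s ` U)) s"
    using assms unfolding local_homeomorphism_def by blast
  then obtain t where t: "homeomorphic_maps (subtopology X U) (subtopology Y (s ` U)) s t"
    using homeomorphic_map_maps by blast
  have top: "topspace (subtopology X U) = U" "topspace (subtopology Y (s ` U)) = s ` U"
    using openin_subset[OF U(1)] openin_subset[OF U(3)] by auto
  then have ts: "t (s x) = x" and st: "\<forall>y\<in>s ` U. s (t y) = y" and tU: "\<forall>y\<in>s ` U. t y \<in> U"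
    and cont: "continuous_map (subtopology Y (s ` U)) (subtopology X U) t"
    using t U(2) by (auto simp: homeomorphic_maps_def continuous_map_def)
  show ?thesis
  proof
    have "filterlim t (nhdsin (subtopology X U) (t (s x))) (nhdsin (subtopology Y (s ` U)) (s x))"
      using U top by (intro filterlim_nhdsin_continuous_map cont) auto
    then show "filterlim t (nhdsin X x) (nhdsin Y (s x))"
      using U by (simp add: nhdsin_subtopology_open ts)
    have "\<forall>\<^sub>F y in nhdsin Y (s x). y \<in> s ` U"
      using U by (intro eventually_nhdsin_openin) auto
    then show "\<forall>\<^sub>F y in nhdsin Y (s x). t y \<in> topspace X \<and> s (t y) = y"
      by eventually_elim (use st tU openin_subset[OF U(1)] in blast)
  qed (rule ts)
qed

text \<open>The left side is the norm of the sum of F over \<open>A - S\<close>, whose terms are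
  dominated by those of h. With S fixed this bounds the tails of all functions below h at
  once.\<close>

lemma norm_infsum_tail_le:
  fixes F :: "'e \<Rightarrow> 'b::banach"
  assumes h: "h summable_on A" and le: "\<And>x. x \<in> A \<Longrightarrow> norm (F x) \<le> h x" and S: "finite S" "S \<subseteq> A"
  shows "norm (infsum F A - sum F S) \<le> infsum h A - sum h S"
proof -
  have F: "F summable_on A"
    by (rule abs_summable_summable, rule Infinite_Sum.abs_summable_on_comparison_test'[OF h le])
  have hS: "h summable_on S" and FS: "F summable_on S"
    using S by auto
  have "norm (infsum F (A - S)) \<le> infsum h (A - S)"
    by (rule norm_infsum_le[OF has_sum_infsum has_sum_infsum])
      (use le F h S hS FS in \<open>auto intro!: summable_on_Diff\<close>)
  then show ?thesis
    using S F h hS FS by (simp add: infsum_Diff)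
qed

text \<open>Values in a general normed space, because majorants are real and integrands complex. The
  value 0 off the vertex space is the convention of \<open>C0_set\<close>.\<close>

definition fibre_sum :: "('v, 'e) top_graph \<Rightarrow> ('e \<Rightarrow> 'b::real_normed_vector) \<Rightarrow> 'v \<Rightarrow> 'b" where
  "fibre_sum E h v = (if v \<in> topspace (gE0 E) then infsum h (graph_fibre E v) else 0)"

lemma graph_ip_fibre_sum: "graph_ip E f g = fibre_sum E (\<lambda>e. cnj (f e) * g e)"
  by (auto simp: graph_ip_def fibre_sum_def fun_eq_iff)

text \<open>The majorants allowed in dominated convergence: continuous, nonnegative, with a fibre
  sum in C_0. The squared moduli of elements of the correspondence are of this kind.\<close>

definition C0_summable :: "('v, 'e) top_graph \<Rightarrow> ('e \<Rightarrow> real) \<Rightarrow> bool" where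
  "C0_summable E h \<longleftrightarrow>
     (\<forall>e\<in>topspace (gE1 E). 0 \<le> h e \<and> (h \<longlongrightarrow> h e) (nhdsin (gE1 E) e)) \<and>
     (\<forall>v\<in>topspace (gE0 E). h summable_on graph_fibre E v) \<and>
     (\<lambda>v. complex_of_real (fibre_sum E h v)) \<in> C0_set (gE0 E)"

lemma fibre_sum_of_real:
  fixes h :: "'e \<Rightarrow> real"
  assumes "\<forall>v\<in>topspace (gE0 E). h summable_on graph_fibre E v"
  shows "fibre_sum E (\<lambda>e. complex_of_real (h e)) = (\<lambda>v. complex_of_real (fibre_sum E h v))"
  using assms by (auto simp: fibre_sum_def fun_eq_iff intro!: infsumI has_sum_of_real)

lemma fibre_sum_nonneg:
  fixes h :: "'e \<Rightarrow> real"
  assumes "\<And>e. e \<in> topspace (gE1 E) \<Longrightarrow> 0 \<le> h e"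
  shows "0 \<le> fibre_sum E h v"
  using assms by (auto simp: fibre_sum_def graph_fibre_def intro!: infsum_nonneg)

text \<open>Hausdorffness of the edge space is what keeps local sections through distinct points of
  one fibre apart.\<close>

locale hausdorff_graph =
  fixes E :: "('v, 'e) top_graph"
  assumes hausdorff: "Hausdorff_space (gE1 E)"
    and grng: "continuous_map (gE1 E) (gE0 E) (grng E)"
    and gsrc: "local_homeomorphism (gE1 E) (gE0 E) (gsrc E)"
begin

abbreviation V0 where "V0 \<equiv> topspace (gE0 E)"
abbreviation V1 where "V1 \<equiv> topspace (gE1 E)"

lemma gsrc_topspace: "e \<in> V1 \<Longrightarrow> gsrc E e \<in> V0"
  using local_homeomorphism_tendsto(2)[OF gsrc] .

text \<open>Each point of S has a local section of the source map. Distinct points have disjoint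
  neighbourhoods, in which their sections remain near v, so S is carried injectively into every
  nearby fibre.\<close>

lemma finite_fibre_sections:
  assumes v: "v \<in> V0" and S: "finite S" "S \<subseteq> graph_fibre E v"
  obtains t where "\<And>e. e \<in> S \<Longrightarrow> filterlim (t e) (nhdsin (gE1 E) e) (nhdsin (gE0 E) v)"
    "\<And>e. e \<in> S \<Longrightarrow> t e v = e"
    "\<forall>\<^sub>F w in nhdsin (gE0 E) v. inj_on (\<lambda>e. t e w) S \<and> (\<lambda>e. t e w) ` S \<subseteq> graph_fibre E w"
proof -
  have SE: "e \<in> V1" "gsrc E e = v" if "e \<in> S" for e
    using S that by (auto simp: graph_fibre_def)
  have "\<exists>t. filterlim t (nhdsin (gE1 E) e) (nhdsin (gE0 E) v) \<and>
      (\<forall>\<^sub>F w in nhdsin (gE0 E) v. t w \<in> V1 \<and> gsrc E (t w) = w) \<and> t v = e" if e: "e \<in> S" for e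
  proof -
    obtain t where "filterlim t (nhdsin (gE1 E) e) (nhdsin (gE0 E) (gsrc E e))"
      "\<forall>\<^sub>F w in nhdsin (gE0 E) (gsrc E e). t w \<in> V1 \<and> gsrc E (t w) = w"
      "t (gsrc E e) = e"
      by (rule local_homeomorphism_section[OF gsrc SE(1)[OF e]])
    then show ?thesis
      using SE(2)[OF e] by blast
  qed
  then have "\<forall>e\<in>S. \<exists>t. filterlim t (nhdsin (gE1 E) e) (nhdsin (gE0 E) v) \<and>
      (\<forall>\<^sub>F w in nhdsin (gE0 E) v. t w \<in> V1 \<and> gsrc E (t w) = w) \<and> t v = e"
    by blast
  from bchoice[OF this] obtain t where
    "\<forall>e\<in>S. filterlim (t e) (nhdsin (gE1 E) e) (nhdsin (gE0 E) v) \<and>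
      (\<forall>\<^sub>F w in nhdsin (gE0 E) v. t e w \<in> V1 \<and> gsrc E (t e w) = w) \<and> t e v = e"
    ..
  then have t: "\<And>e. e \<in> S \<Longrightarrow> filterlim (t e) (nhdsin (gE1 E) e) (nhdsin (gE0 E) v)"
      "\<And>e. e \<in> S \<Longrightarrow> \<forall>\<^sub>F w in nhdsin (gE0 E) v. t e w \<in> V1 \<and> gsrc E (t e w) = w"
      "\<And>e. e \<in> S \<Longrightarrow> t e v = e"
    by simp_all
  have "\<forall>\<^sub>F w in nhdsin (gE0 E) v. e \<noteq> e' \<longrightarrow> t e w \<noteq> t e' w" if e: "e \<in> S" and e': "e' \<in> S" for e e'
  proof (cases "e = e'")
    case False
    then obtain U U' where U: "openin (gE1 E) U" "openin (gE1 E) U'" "e \<in> U" "e' \<in> U'" "disjnt U U'"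
      using hausdorff SE(1)[OF e] SE(1)[OF e'] unfolding Hausdorff_space_def by meson
    have "\<forall>\<^sub>F w in nhdsin (gE0 E) v. t e w \<in> U" "\<forall>\<^sub>F w in nhdsin (gE0 E) v. t e' w \<in> U'"
      using t(1) e e' U unfolding filterlim_iff by (auto intro: eventually_nhdsin_openin)
    then show ?thesis
      by eventually_elim (use U(5) in \<open>auto simp: disjnt_def\<close>)
  qed simp
  then have "\<forall>\<^sub>F w in nhdsin (gE0 E) v. \<forall>e\<in>S. \<forall>e'\<in>S. e \<noteq> e' \<longrightarrow> t e w \<noteq> t e' w"
    using S(1) by (simp add: eventually_ball_finite)
  moreover have "\<forall>\<^sub>F w in nhdsin (gE0 E) v. \<forall>e\<in>S. t e w \<in> V1 \<and> gsrc E (t e w) = w"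
    using S(1) t(2) by (simp add: eventually_ball_finite)
  ultimately have "\<forall>\<^sub>F w in nhdsin (gE0 E) v. inj_on (\<lambda>e. t e w) S \<and> (\<lambda>e. t e w) ` S \<subseteq> graph_fibre E w"
    by eventually_elim (auto simp: inj_on_def graph_fibre_def)
  then show ?thesis
    using that t by blast
qed

text \<open>The heart of dominated convergence. The mass of h off the sections is the total fibre
  sum minus a finite sum along sections. Both are continuous at v, and their difference at v is
  below \<epsilon> by the choice of S, hence also near v.\<close>

lemma small_tail_sections:
  fixes h :: "'e \<Rightarrow> real"
  assumes v: "v \<in> V0" and \<epsilon>: "\<epsilon> > 0"
    and cont: "\<And>e. e \<in> graph_fibre E v \<Longrightarrow> (h \<longlongrightarrow> h e) (nhdsin (gE1 E) e)"
    and summ: "\<And>w. w \<in> V0 \<Longrightarrow> h summable_on graph_fibre E w"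
    and lim: "(fibre_sum E h \<longlongrightarrow> fibre_sum E h v) (nhdsin (gE0 E) v)"
  obtains S t where "finite S" "S \<subseteq> graph_fibre E v"
    "\<And>e. e \<in> S \<Longrightarrow> filterlim (t e) (nhdsin (gE1 E) e) (nhdsin (gE0 E) v)"
    "\<And>e. e \<in> S \<Longrightarrow> t e v = e"
    "\<forall>\<^sub>F w in nhdsin (gE0 E) v. w \<in> V0 \<and>
       inj_on (\<lambda>e. t e w) S \<and> (\<lambda>e. t e w) ` S \<subseteq> graph_fibre E w \<and>
       infsum h (graph_fibre E w) - sum h ((\<lambda>e. t e w) ` S) < \<epsilon>"
proof -
  obtain S where S: "finite S" "S \<subseteq> graph_fibre E v"
    "dist (sum h S) (infsum h (graph_fibre E v)) \<le> \<epsilon> / 2"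
    using infsum_finite_approximation[OF summ[OF v], of "\<epsilon>/2"] \<epsilon> by auto
  obtain t where t: "\<And>e. e \<in> S \<Longrightarrow> filterlim (t e) (nhdsin (gE1 E) e) (nhdsin (gE0 E) v)"
    "\<And>e. e \<in> S \<Longrightarrow> t e v = e"
    "\<forall>\<^sub>F w in nhdsin (gE0 E) v. inj_on (\<lambda>e. t e w) S \<and> (\<lambda>e. t e w) ` S \<subseteq> graph_fibre E w"
    using finite_fibre_sections[OF v S(1,2)] by blast
  have "((\<lambda>w. h (t e w)) \<longlongrightarrow> h e) (nhdsin (gE0 E) v)" if "e \<in> S" for e
    using filterlim_compose[OF cont t(1)] S(2) that by blast
  then have "((\<lambda>w. fibre_sum E h w - (\<Sum>e\<in>S. h (t e w))) \<longlongrightarrow> fibre_sum E h v - (\<Sum>e\<in>S. h e)) (nhdsin (gE0 E) v)"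
    using lim by (intro tendsto_diff tendsto_sum)
  moreover have "fibre_sum E h v - (\<Sum>e\<in>S. h e) < \<epsilon>"
    using S(3)[unfolded dist_real_def abs_le_iff] v \<epsilon> by (simp add: fibre_sum_def)
  ultimately have "\<forall>\<^sub>F w in nhdsin (gE0 E) v. fibre_sum E h w - (\<Sum>e\<in>S. h (t e w)) < \<epsilon>"
    by (rule order_tendstoD(2))
  with t(3) eventually_nhdsin_topspace[of "gE0 E" v]
  have "\<forall>\<^sub>F w in nhdsin (gE0 E) v. w \<in> V0 \<and>
       inj_on (\<lambda>e. t e w) S \<and> (\<lambda>e. t e w) ` S \<subseteq> graph_fibre E w \<and>
       infsum h (graph_fibre E w) - sum h ((\<lambda>e. t e w) ` S) < \<epsilon>"
    by eventually_elim (auto simp: fibre_sum_def sum.reindex)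
  with S t show ?thesis
    using that by blast
qed

text \<open>A three-term estimate: the finite sum of F along the sections converges, and the tails
  of F over w and over v are bounded by those of h. Continuity of h and F is required only on the
  fibre over v, which is essential for the truncated function in
  \<open>fibre_sum_S_continuous\<close>.\<close>

lemma tendsto_fibre_sum_dominated:
  fixes F :: "'e \<Rightarrow> 'b::banach"
  assumes v: "v \<in> V0"
    and cont: "\<And>e. e \<in> graph_fibre E v \<Longrightarrow> (h \<longlongrightarrow> h e) (nhdsin (gE1 E) e)"
    and summ: "\<And>w. w \<in> V0 \<Longrightarrow> h summable_on graph_fibre E w"
    and lim: "(fibre_sum E h \<longlongrightarrow> fibre_sum E h v) (nhdsin (gE0 E) v)"
    and F: "\<And>e. e \<in> graph_fibre E v \<Longrightarrow> (F \<longlongrightarrow> F e) (nhdsin (gE1 E) e)"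
    and le: "\<And>e. e \<in> V1 \<Longrightarrow> norm (F e) \<le> h e"
  shows "(fibre_sum E F \<longlongrightarrow> fibre_sum E F v) (nhdsin (gE0 E) v)"
proof (rule tendstoI)
  fix \<epsilon> :: real assume \<epsilon>: "\<epsilon> > 0"
  have "\<epsilon>/3 > 0" using \<epsilon> by simp
  from small_tail_sections[OF v this cont summ lim] obtain S t where
    S: "finite S" "S \<subseteq> graph_fibre E v" and
    t: "\<And>e. e \<in> S \<Longrightarrow> filterlim (t e) (nhdsin (gE1 E) e) (nhdsin (gE0 E) v)"
       "\<And>e. e \<in> S \<Longrightarrow> t e v = e" and
    ev: "\<forall>\<^sub>F w in nhdsin (gE0 E) v. w \<in> V0 \<and>
       inj_on (\<lambda>e. t e w) S \<and> (\<lambda>e. t e w) ` S \<subseteq> graph_fibre E w \<and>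
       infsum h (graph_fibre E w) - sum h ((\<lambda>e. t e w) ` S) < \<epsilon>/3"
    by blast
  have "((\<lambda>w. F (t e w)) \<longlongrightarrow> F e) (nhdsin (gE0 E) v)" if "e \<in> S" for e
    using filterlim_compose[OF F t(1)] S(2) that by blast
  then have "((\<lambda>w. \<Sum>e\<in>S. F (t e w)) \<longlongrightarrow> (\<Sum>e\<in>S. F e)) (nhdsin (gE0 E) v)"
    by (intro tendsto_sum)
  then have "\<forall>\<^sub>F w in nhdsin (gE0 E) v. dist (\<Sum>e\<in>S. F (t e w)) (\<Sum>e\<in>S. F e) < \<epsilon>/3"
    using \<open>\<epsilon>/3 > 0\<close> by (rule tendstoD)
  with ev show "\<forall>\<^sub>F w in nhdsin (gE0 E) v. dist (fibre_sum E F w) (fibre_sum E F v) < \<epsilon>"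
  proof eventually_elim
    case (elim w)
    have tail: "dist (infsum F (graph_fibre E w)) (\<Sum>e\<in>S. F (t e w)) < \<epsilon>/3"
      if "w \<in> V0 \<and> inj_on (\<lambda>e. t e w) S \<and> (\<lambda>e. t e w) ` S \<subseteq> graph_fibre E w \<and>
        infsum h (graph_fibre E w) - sum h ((\<lambda>e. t e w) ` S) < \<epsilon>/3" for w
      using norm_infsum_tail_le[of h "graph_fibre E w" F "(\<lambda>e. t e w) ` S"] that S(1) summ le
      by (auto simp: dist_norm graph_fibre_def sum.reindex)
    \<comment> \<open>The tail at v itself is also covered, since v lies in each of its
      neighbourhoods and the sections take S to itself there.\<close>
    have "dist (infsum F (graph_fibre E v)) (\<Sum>e\<in>S. F e) < \<epsilon>/3"
      using tail[OF eventually_nhdsin_self[OF ev v]] t(2) by simp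
    moreover have "dist (infsum F (graph_fibre E w)) (\<Sum>e\<in>S. F (t e w)) < \<epsilon>/3"
      using tail elim by blast
    ultimately have "dist (infsum F (graph_fibre E w)) (infsum F (graph_fibre E v)) < \<epsilon>"
      using elim dist_triangle_third[of _ _ \<epsilon>] dist_commute by metis
    with elim v show ?case by (auto simp: fibre_sum_def)
  qed
qed

lemma C0_summable_tendsto:
  assumes h: "C0_summable E h" and v: "v \<in> V0"
    and F: "\<And>e. e \<in> graph_fibre E v \<Longrightarrow> (F \<longlongrightarrow> F e) (nhdsin (gE1 E) e)"
    and le: "\<And>e. e \<in> V1 \<Longrightarrow> norm (F e) \<le> h e"
  shows "(fibre_sum E F \<longlongrightarrow> fibre_sum E (F :: 'e \<Rightarrow> 'b::banach) v) (nhdsin (gE0 E) v)"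
proof (rule tendsto_fibre_sum_dominated[OF v, of h])
  have "(\<lambda>v. complex_of_real (fibre_sum E h v)) \<in> C0_set (gE0 E)"
    using h by (auto simp: C0_summable_def)
  from tendsto_Re[OF C0_set_tendsto[OF this v]]
  show "(fibre_sum E h \<longlongrightarrow> fibre_sum E h v) (nhdsin (gE0 E) v)" by simp
qed (use h F le in \<open>auto simp: C0_summable_def graph_fibre_def\<close>)

lemma C0_summable_summable_on:
  assumes h: "C0_summable E h" and v: "v \<in> V0"
    and le: "\<And>e. e \<in> V1 \<Longrightarrow> norm (F e) \<le> h e"
  shows "(F :: 'e \<Rightarrow> 'b::banach) summable_on graph_fibre E v"
  by (rule abs_summable_summable, rule Infinite_Sum.abs_summable_on_comparison_test'[of h])
    (use assms in \<open>auto simp: C0_summable_def graph_fibre_def\<close>)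

lemma norm_fibre_sum_le:
  assumes h: "C0_summable E h"
    and le: "\<And>e. e \<in> V1 \<Longrightarrow> norm (F e) \<le> h e"
  shows "norm (fibre_sum E (F :: 'e \<Rightarrow> 'b::banach) v) \<le> fibre_sum E h v"
  \<comment> \<open>With the empty set removed, the tail estimate bounds the whole sum.\<close>
  using norm_infsum_tail_le[of h "graph_fibre E v" F "{}"] assms
  by (auto simp: fibre_sum_def C0_summable_def graph_fibre_def)

lemma fibre_sum_C0_dominated:
  assumes h: "C0_summable E h"
    and F: "\<And>e. e \<in> V1 \<Longrightarrow> (F \<longlongrightarrow> F e) (nhdsin (gE1 E) e)"
    and le: "\<And>e. e \<in> V1 \<Longrightarrow> cmod (F e) \<le> h e"
  shows "fibre_sum E F \<in> C0_set (gE0 E)"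
proof (rule C0_set_dominated)
  show "(\<lambda>v. complex_of_real (fibre_sum E h v)) \<in> C0_set (gE0 E)"
    using h by (auto simp: C0_summable_def)
  show "(fibre_sum E F \<longlongrightarrow> fibre_sum E F v) (nhdsin (gE0 E) v)" if "v \<in> V0" for v
    using that by (intro C0_summable_tendsto[OF h] F le) (auto simp: graph_fibre_def)
  show "cmod (fibre_sum E F v) \<le> cmod (complex_of_real (fibre_sum E h v))" for v
    using norm_fibre_sum_le[OF h le, of v] by simp
qed (auto simp: fibre_sum_def)

lemma C0_summable_dominated:
  assumes h: "C0_summable E h"
    and g: "\<And>e. e \<in> V1 \<Longrightarrow> (g \<longlongrightarrow> g e) (nhdsin (gE1 E) e)"
    and le: "\<And>e. e \<in> V1 \<Longrightarrow> 0 \<le> g e \<and> g e \<le> h e"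
  shows "C0_summable E g"
proof -
  have summ: "g summable_on graph_fibre E v" if "v \<in> V0" for v
    by (rule C0_summable_summable_on[OF h that]) (use le in auto)
  have "fibre_sum E (\<lambda>e. complex_of_real (g e)) \<in> C0_set (gE0 E)"
    by (rule fibre_sum_C0_dominated[OF h]) (use le in \<open>auto intro!: tendsto_of_real g\<close>)
  with summ g le show ?thesis
    by (auto simp: C0_summable_def fibre_sum_of_real)
qed

lemma C0_summable_add:
  assumes "C0_summable E g" "C0_summable E h"
  shows "C0_summable E (\<lambda>e. g e + h e)"
proof -
  have "fibre_sum E (\<lambda>e. g e + h e) v = fibre_sum E g v + fibre_sum E h v" for v
    using assms by (auto simp: fibre_sum_def C0_summable_def infsum_add)
  moreover have "(\<lambda>v. complex_of_real (fibre_sum E g v) + complex_of_real (fibre_sum E h v)) \<in> C0_set (gE0 E)"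
    using assms by (intro C0_set_add) (auto simp: C0_summable_def)
  ultimately show ?thesis
    using assms by (auto simp: C0_summable_def intro!: tendsto_intros summable_on_add)
qed

lemma C0_summable_cmult:
  assumes "C0_summable E h" "c \<ge> 0"
  shows "C0_summable E (\<lambda>e. c * h e)"
proof -
  have "fibre_sum E (\<lambda>e. c * h e) v = c * fibre_sum E h v" for v
    using assms by (auto simp: fibre_sum_def C0_summable_def infsum_cmult_right)
  moreover have "(\<lambda>v. complex_of_real c * complex_of_real (fibre_sum E h v)) \<in> C0_set (gE0 E)"
    using assms by (intro C0_set_scale) (auto simp: C0_summable_def)
  ultimately show ?thesis
    using assms by (auto simp: C0_summable_def intro!: tendsto_intros summable_on_cmult_right)
qed

lemma C0_summable_zero: "C0_summable E (\<lambda>_. 0)"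
  by (simp add: C0_summable_def fibre_sum_def[abs_def] C0_set_zero cong: if_cong)

text \<open>A single value of h is at most its fibre sum, so the set where h is at least r lies over
  the compact set C where the fibre sum is at least r. Over a small neighbourhood of any vertex that
  set is contained in finitely many sections, so finitely many members of an open cover suffice
  there. Compactness of C then finishes the argument.\<close>

lemma C0_summable_imp_C0:
  assumes h: "C0_summable E h" and out: "\<And>e. e \<notin> V1 \<Longrightarrow> h e = 0"
  shows "(\<lambda>e. complex_of_real (h e)) \<in> C0_set (gE1 E)"
proof -
  let ?X = "gE1 E" and ?Y = "gE0 E"
  have h0: "\<And>e. e \<in> topspace ?X \<Longrightarrow> 0 \<le> h e"
    and hc: "\<And>e. e \<in> topspace ?X \<Longrightarrow> (h \<longlongrightarrow> h e) (nhdsin ?X e)"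
    and hs: "\<And>v. v \<in> topspace ?Y \<Longrightarrow> h summable_on graph_fibre E v"
    and H: "(\<lambda>v. complex_of_real (fibre_sum E h v)) \<in> C0_set ?Y"
    using h by (auto simp: C0_summable_def)
  have "compactin ?X {e \<in> topspace ?X. r \<le> cmod (complex_of_real (h e))}" if r: "r > 0" for r
    unfolding compactin_def
  proof (intro conjI allI impI)
    fix \<U> assume \<U>: "Ball \<U> (openin ?X) \<and> {e \<in> topspace ?X. r \<le> cmod (complex_of_real (h e))} \<subseteq> \<Union>\<U>"
    define C where "C = {v \<in> topspace ?Y. r \<le> cmod (complex_of_real (fibre_sum E h v))}"
    have "compactin ?Y C"
      unfolding C_def using H r by (rule C0_set_compactin)
    have local: "\<exists>V \<W>. openin ?Y V \<and> v \<in> V \<and> finite \<W> \<and> \<W> \<subseteq> \<U> \<and>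
        (\<forall>e\<in>topspace ?X. gsrc E e \<in> V \<longrightarrow> r \<le> h e \<longrightarrow> e \<in> \<Union>\<W>)" if v: "v \<in> topspace ?Y" for v
    proof -
      have lim: "(fibre_sum E h \<longlongrightarrow> fibre_sum E h v) (nhdsin ?Y v)"
        using tendsto_Re[OF C0_set_tendsto[OF H v]] by simp
      have hcv: "(h \<longlongrightarrow> h e) (nhdsin ?X e)" if "e \<in> graph_fibre E v" for e
        using hc that by (auto simp: graph_fibre_def)
      \<comment> \<open>With a tail below r, no single point off the sections can reach the value
        r.\<close>
      obtain S t where S: "finite S" "S \<subseteq> graph_fibre E v" and
        t: "\<And>e. e \<in> S \<Longrightarrow> filterlim (t e) (nhdsin ?X e) (nhdsin ?Y v)"
          "\<And>e. e \<in> S \<Longrightarrow> t e v = e" and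
        ev: "\<forall>\<^sub>F w in nhdsin ?Y v. w \<in> topspace ?Y \<and>
          inj_on (\<lambda>e. t e w) S \<and> (\<lambda>e. t e w) ` S \<subseteq> graph_fibre E w \<and>
          infsum h (graph_fibre E w) - sum h ((\<lambda>e. t e w) ` S) < r"
        by (rule small_tail_sections[OF v r hcv hs lim], assumption, assumption, rule that)
      have "\<exists>W. r \<le> h e \<longrightarrow> W \<in> \<U> \<and> e \<in> W" if "e \<in> S" for e
        using \<U> S that by (fastforce simp: graph_fibre_def)
      then obtain W where W: "\<And>e. e \<in> S \<Longrightarrow> r \<le> h e \<Longrightarrow> W e \<in> \<U> \<and> e \<in> W e"
        by metis
      \<comment> \<open>Where h is below r at a point of S, it stays below r along the section, so
        such points require no member of the cover. At the other points the section stays in the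
        chosen open set.\<close>
      have "\<forall>\<^sub>F w in nhdsin ?Y v. r \<le> h (t e w) \<longrightarrow> r \<le> h e \<and> t e w \<in> W e" if e: "e \<in> S" for e
      proof (cases "r \<le> h e")
        case True
        then have "\<forall>\<^sub>F x in nhdsin ?X e. x \<in> W e"
          using W[OF e] \<U> by (intro eventually_nhdsin_openin) auto
        then have "\<forall>\<^sub>F w in nhdsin ?Y v. t e w \<in> W e"
          using t(1)[OF e] unfolding filterlim_iff by blast
        then show ?thesis by eventually_elim (use True in auto)
      next
        case False
        have "((\<lambda>w. h (t e w)) \<longlongrightarrow> h e) (nhdsin ?Y v)"
          using filterlim_compose[OF hcv t(1)] S(2) e by blast
        then have "\<forall>\<^sub>F w in nhdsin ?Y v. h (t e w) < r"
          using False by (intro order_tendstoD) auto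
        then show ?thesis by eventually_elim auto
      qed
      then have "\<forall>\<^sub>F w in nhdsin ?Y v. \<forall>e\<in>S. r \<le> h (t e w) \<longrightarrow> r \<le> h e \<and> t e w \<in> W e"
        using S(1) by (simp add: eventually_ball_finite)
      with ev have "\<forall>\<^sub>F w in nhdsin ?Y v. \<forall>e\<in>graph_fibre E w. r \<le> h e \<longrightarrow> e \<in> \<Union> (W ` {e \<in> S. r \<le> h e})"
      proof eventually_elim
        case (elim w)
        show ?case
        proof (intro ballI impI)
          fix x assume x: "x \<in> graph_fibre E w" "r \<le> h x"
          have "x \<in> (\<lambda>e. t e w) ` S"
          proof (rule ccontr)
            assume "x \<notin> (\<lambda>e. t e w) ` S"
            then have "h x + sum h ((\<lambda>e. t e w) ` S) = sum h (insert x ((\<lambda>e. t e w) ` S))"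
              using S(1) by simp
            also have "\<dots> \<le> infsum h (graph_fibre E w)"
              by (rule finite_sum_le_infsum) (use elim hs S(1) x h0 in \<open>auto simp: graph_fibre_def\<close>)
            finally show False using elim x by simp
          qed
          then show "x \<in> \<Union> (W ` {e \<in> S. r \<le> h e})"
            using elim x by blast
        qed
      qed
      then obtain V where V: "openin ?Y V" "v \<in> V"
        "\<And>w e. w \<in> V \<Longrightarrow> e \<in> graph_fibre E w \<Longrightarrow> r \<le> h e \<Longrightarrow> e \<in> \<Union> (W ` {e \<in> S. r \<le> h e})"
        using v unfolding eventually_nhdsin by blast
      show ?thesis
      proof (intro exI conjI)
        show "\<forall>e\<in>topspace ?X. gsrc E e \<in> V \<longrightarrow> r \<le> h e \<longrightarrow> e \<in> \<Union> (W ` {e \<in> S. r \<le> h e})"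
          using V(3) by (auto simp: graph_fibre_def)
      qed (use V S W in auto)
    qed
    obtain V \<W> where VW: "\<And>v. v \<in> topspace ?Y \<Longrightarrow> openin ?Y (V v) \<and> v \<in> V v \<and> finite (\<W> v) \<and> \<W> v \<subseteq> \<U> \<and>
        (\<forall>e\<in>topspace ?X. gsrc E e \<in> V v \<longrightarrow> r \<le> h e \<longrightarrow> e \<in> \<Union>(\<W> v))"
      using local by metis
    have CY: "C \<subseteq> topspace ?Y"
      by (auto simp: C_def)
    obtain \<F> where "finite \<F>" "\<F> \<subseteq> V ` C" "C \<subseteq> \<Union>\<F>"
      using compactinD[OF \<open>compactin ?Y C\<close>, of "V ` C"] VW CY by blast
    then obtain D where D: "finite D" "D \<subseteq> C" "C \<subseteq> \<Union>(V ` D)"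
      using finite_subset_image by metis
    show "\<exists>\<F>. finite \<F> \<and> \<F> \<subseteq> \<U> \<and> {e \<in> topspace ?X. r \<le> cmod (complex_of_real (h e))} \<subseteq> \<Union>\<F>"
    proof (intro exI conjI)
      have "finite (\<W> v) \<and> \<W> v \<subseteq> \<U>" if "v \<in> D" for v
        using VW[of v] D(2) CY that by blast
      then show "finite (\<Union>(\<W> ` D))" "\<Union>(\<W> ` D) \<subseteq> \<U>"
        using D(1) by blast+
      show "{e \<in> topspace ?X. r \<le> cmod (complex_of_real (h e))} \<subseteq> \<Union>(\<Union>(\<W> ` D))"
      proof clarify
        fix e assume e: "e \<in> topspace ?X" "r \<le> cmod (complex_of_real (h e))"
        then have re: "r \<le> h e" using h0 by auto
        have "h e = sum h {e}" by simp
        also have "\<dots> \<le> infsum h (graph_fibre E (gsrc E e))"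
          by (rule finite_sum_le_infsum) (use e hs gsrc_topspace h0 in \<open>auto simp: graph_fibre_def\<close>)
        finally have "gsrc E e \<in> C"
          using e re gsrc_topspace by (auto simp: C_def fibre_sum_def)
        then obtain v where v: "v \<in> D" "gsrc E e \<in> V v" using D by blast
        then have "v \<in> topspace ?Y" using D CY by blast
        then have "e \<in> \<Union>(\<W> v)"
          using VW v(2) e(1) re by simp
        then show "e \<in> \<Union>(\<Union>(\<W> ` D))"
          using v(1) by blast
      qed
    qed
  qed auto
  moreover have "continuous_map ?X euclidean (\<lambda>e. complex_of_real (h e))"
    using hc by (auto simp: continuous_map_iff_tendsto_nhdsin intro!: tendsto_intros)
  ultimately show ?thesis
    using out by (auto simp: C0_set_def)
qed

end

section \<open>The correspondence of a topological graph\<close>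

lemma summable_on_infsum_le_bound:
  fixes h :: "'a \<Rightarrow> real"
  assumes "\<And>x. x \<in> A \<Longrightarrow> 0 \<le> h x" "\<And>S. finite S \<Longrightarrow> S \<subseteq> A \<Longrightarrow> sum h S \<le> B"
  shows "h summable_on A" "infsum h A \<le> B"
proof -
  show *: "h summable_on A"
    by (rule nonneg_bdd_above_summable_on) (use assms in \<open>auto intro!: bdd_aboveI2\<close>)
  show "infsum h A \<le> B"
    by (rule infsum_le_finite_sums[OF * assms(2)])
qed

lemma sum_le_infsum_nonneg:
  fixes h :: "'a \<Rightarrow> real"
  assumes "h summable_on A" "finite S" "S \<subseteq> A" "\<And>x. x \<in> A \<Longrightarrow> 0 \<le> h x"
  shows "sum h S \<le> infsum h A"
  using assms by (intro finite_sum_le_infsum) auto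

text \<open>Minkowski's inequality for finite sums bounds every finite partial sum by the square of
  the right side. As the terms are nonnegative, this gives both summability and the
  estimate.\<close>

lemma l2_infsum_triangle:
  fixes f g :: "'a \<Rightarrow> complex"
  assumes f: "(\<lambda>x. (cmod (f x))\<^sup>2) summable_on A" and g: "(\<lambda>x. (cmod (g x))\<^sup>2) summable_on A"
  shows "(\<lambda>x. (cmod (f x + g x))\<^sup>2) summable_on A"
    and "sqrt (\<Sum>\<^sub>\<infinity>x\<in>A. (cmod (f x + g x))\<^sup>2)
      \<le> sqrt (\<Sum>\<^sub>\<infinity>x\<in>A. (cmod (f x))\<^sup>2) + sqrt (\<Sum>\<^sub>\<infinity>x\<in>A. (cmod (g x))\<^sup>2)"
proof -
  let ?B = "sqrt (\<Sum>\<^sub>\<infinity>x\<in>A. (cmod (f x))\<^sup>2) + sqrt (\<Sum>\<^sub>\<infinity>x\<in>A. (cmod (g x))\<^sup>2)"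
  have B: "?B \<ge> 0" by (simp add: infsum_nonneg)
  have "(\<Sum>x\<in>S. (cmod (f x + g x))\<^sup>2) \<le> ?B\<^sup>2" if S: "finite S" "S \<subseteq> A" for S
  proof -
    have "sqrt (\<Sum>x\<in>S. (cmod (f x + g x))\<^sup>2) \<le> L2_set (\<lambda>x. cmod (f x) + cmod (g x)) S"
      unfolding L2_set_def by (intro real_sqrt_le_mono sum_mono power_mono norm_triangle_ineq) auto
    also have "\<dots> \<le> L2_set (\<lambda>x. cmod (f x)) S + L2_set (\<lambda>x. cmod (g x)) S"
      by (rule L2_set_triangle_ineq)
    also have "\<dots> \<le> ?B"
      unfolding L2_set_def
      by (intro add_mono real_sqrt_le_mono sum_le_infsum_nonneg f g S) auto
    finally show ?thesis
      using B by (simp add: sqrt_le_D real_sqrt_le_iff flip: real_sqrt_abs)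
  qed
  note * = summable_on_infsum_le_bound[of A "\<lambda>x. (cmod (f x + g x))\<^sup>2", OF _ this]
  show "(\<lambda>x. (cmod (f x + g x))\<^sup>2) summable_on A"
    using *(1) by simp
  show "sqrt (\<Sum>\<^sub>\<infinity>x\<in>A. (cmod (f x + g x))\<^sup>2) \<le> ?B"
    using *(2) B by (intro real_le_lsqrt) (auto simp: infsum_nonneg)
qed

text \<open>The finite inequality is applied to the moduli, which gives absolute summability along
  with the bound.\<close>

lemma l2_infsum_Cauchy_Schwarz:
  fixes f g :: "'a \<Rightarrow> complex"
  assumes f: "(\<lambda>x. (cmod (f x))\<^sup>2) summable_on A" and g: "(\<lambda>x. (cmod (g x))\<^sup>2) summable_on A"
  shows "cmod (\<Sum>\<^sub>\<infinity>x\<in>A. cnj (f x) * g x)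
      \<le> sqrt (\<Sum>\<^sub>\<infinity>x\<in>A. (cmod (f x))\<^sup>2) * sqrt (\<Sum>\<^sub>\<infinity>x\<in>A. (cmod (g x))\<^sup>2)" (is "_ \<le> ?B")
proof -
  have *: "(\<Sum>x\<in>S. cmod (cnj (f x) * g x)) \<le> ?B" if S: "finite S" "S \<subseteq> A" for S
  proof -
    have "(\<Sum>x\<in>S. cmod (cnj (f x) * g x)) = (\<Sum>x\<in>S. \<bar>cmod (f x)\<bar> * \<bar>cmod (g x)\<bar>)"
      by (simp add: norm_mult)
    also have "\<dots> \<le> L2_set (\<lambda>x. cmod (f x)) S * L2_set (\<lambda>x. cmod (g x)) S"
      by (rule L2_set_mult_ineq)
    also have "\<dots> \<le> ?B"
      unfolding L2_set_def
      by (intro mult_mono real_sqrt_le_mono sum_le_infsum_nonneg f g S) (auto simp: infsum_nonneg sum_nonneg)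
    finally show ?thesis .
  qed
  note * = summable_on_infsum_le_bound[of A "\<lambda>x. cmod (cnj (f x) * g x)", OF _ this]
  have "cmod (\<Sum>\<^sub>\<infinity>x\<in>A. cnj (f x) * g x) \<le> (\<Sum>\<^sub>\<infinity>x\<in>A. cmod (cnj (f x) * g x))"
    using *(1) by (intro norm_infsum_bound) auto
  also have "\<dots> \<le> ?B" using *(2) by simp
  finally show ?thesis .
qed

lemma graph_corr_sel [simp]:
  "vzero (graph_corr E) = (\<lambda>_. 0)" "vadd (graph_corr E) = (\<lambda>f g e. f e + g e)"
  "vscale (graph_corr E) = (\<lambda>z f e. z * f e)" "ip (graph_corr E) = graph_ip E"
  "ract (graph_corr E) = (\<lambda>f a e. f e * a (gsrc E e))"
  "lact (graph_corr E) = (\<lambda>a f e. a (grng E e) * f e)"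
  by (auto simp: graph_corr_def)

text \<open>The l2 norm of f on one fibre: elements of the correspondence are sections of a field of
  Hilbert spaces over the vertices, and the module norm is the supremum of these norms.\<close>

definition fibre_norm :: "('v, 'e) top_graph \<Rightarrow> ('e \<Rightarrow> complex) \<Rightarrow> 'v \<Rightarrow> real" where
  "fibre_norm E f v = sqrt (fibre_sum E (\<lambda>e. (cmod (f e))\<^sup>2) v)"

lemma fibre_norm_nonneg: "0 \<le> fibre_norm E f v"
  by (simp add: fibre_norm_def fibre_sum_nonneg)

lemma cnj_mult_self: "cnj z * z = complex_of_real ((cmod z)\<^sup>2)"
  by (subst complex_norm_square) (simp add: mult.commute)

text \<open>Since <f, f> is the fibre sum of |f|^2, the carrier conditions become conditions on one
  real majorant, to which dominated convergence applies. Summability passes between the complex and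
  the real form through real parts.\<close>

lemma graph_corr_carrier_iff:
  "f \<in> vcarrier (graph_corr E) \<longleftrightarrow>
     (\<forall>e. e \<notin> topspace (gE1 E) \<longrightarrow> f e = 0) \<and>
     (\<forall>e\<in>topspace (gE1 E). (f \<longlongrightarrow> f e) (nhdsin (gE1 E) e)) \<and>
     C0_summable E (\<lambda>e. (cmod (f e))\<^sup>2)"
proof -
  have *: "(\<lambda>e. cnj (f e) * f e) summable_on A \<longleftrightarrow> (\<lambda>e. (cmod (f e))\<^sup>2) summable_on A" for A
    unfolding cnj_mult_self using summable_on_Re summable_on_of_real by fastforce
  have **: "graph_ip E f f = (\<lambda>v. complex_of_real (fibre_sum E (\<lambda>e. (cmod (f e))\<^sup>2) v))"
    if "\<forall>v\<in>topspace (gE0 E). (\<lambda>e. (cmod (f e))\<^sup>2) summable_on graph_fibre E v"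
    unfolding graph_ip_fibre_sum cnj_mult_self using that by (rule fibre_sum_of_real)
  have ***: "((\<lambda>e. (cmod (f e))\<^sup>2) \<longlongrightarrow> (cmod (f e))\<^sup>2) (nhdsin (gE1 E) e)"
    if "(f \<longlongrightarrow> f e) (nhdsin (gE1 E) e)" for e
    using that by (intro tendsto_intros)
  show ?thesis
    unfolding graph_corr_def C0_summable_def
    using ** *** by (auto simp: continuous_map_iff_tendsto_nhdsin *)
qed

section \<open>Carrier, norm and completeness of the module of fibrewise square-summable
  functions\<close>

context hausdorff_graph
begin

abbreviation carrier where "carrier \<equiv> vcarrier (graph_corr E)"

abbreviation mnorm :: "('e \<Rightarrow> complex) \<Rightarrow> real" where
  "mnorm \<equiv> cnorm (C0 (gE0 E)) (graph_corr E)"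

context
  fixes f assumes f: "f \<in> carrier"
begin

lemma carrier_outside: "e \<notin> V1 \<Longrightarrow> f e = 0"
  using f by (simp add: graph_corr_carrier_iff)

lemma carrier_tendsto: "e \<in> V1 \<Longrightarrow> (f \<longlongrightarrow> f e) (nhdsin (gE1 E) e)"
  using f by (simp add: graph_corr_carrier_iff)

lemma carrier_C0_summable: "C0_summable E (\<lambda>e. (cmod (f e))\<^sup>2)"
  using f by (simp add: graph_corr_carrier_iff)

lemma carrier_l2_summable:
  "v \<in> V0 \<Longrightarrow> (\<lambda>e. (cmod (f e))\<^sup>2) summable_on graph_fibre E v"
  using carrier_C0_summable by (simp add: C0_summable_def)

lemma graph_ip_self: "graph_ip E f f v = complex_of_real ((fibre_norm E f v)\<^sup>2)"
proof -
  have "graph_ip E f f = (\<lambda>v. complex_of_real (fibre_sum E (\<lambda>e. (cmod (f e))\<^sup>2) v))"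
    unfolding graph_ip_fibre_sum cnj_mult_self
    using carrier_l2_summable by (intro fibre_sum_of_real) auto
  then show ?thesis
    by (simp add: fibre_norm_def fibre_sum_nonneg)
qed

lemma fibre_norm_C0: "(\<lambda>v. complex_of_real (fibre_norm E f v)) \<in> C0_set (gE0 E)"
  unfolding fibre_norm_def using carrier_C0_summable
  by (intro C0_set_sqrt) (simp add: C0_summable_def)

lemma graph_ip_self_C0: "graph_ip E f f \<in> C0_set (gE0 E)"
  using f by (simp add: graph_corr_def)

lemma fibre_norm_le_mnorm: "fibre_norm E f v \<le> mnorm f"
proof -
  have "(fibre_norm E f v)\<^sup>2 \<le> C0_norm (graph_ip E f f)"
    using C0_norm_upper[OF graph_ip_self_C0, of v] by (simp add: graph_ip_self norm_power)
  then show ?thesis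
    by (simp add: cnorm_def real_le_rsqrt)
qed

lemma mnorm_nonneg: "0 \<le> mnorm f"
  using C0_norm_nonneg[OF graph_ip_self_C0] by (simp add: cnorm_def)

lemma mnorm_least: "(\<And>v. v \<in> V0 \<Longrightarrow> fibre_norm E f v \<le> B) \<Longrightarrow> 0 \<le> B \<Longrightarrow> mnorm f \<le> B"
proof -
  assume *: "\<And>v. v \<in> V0 \<Longrightarrow> fibre_norm E f v \<le> B" and B: "0 \<le> B"
  have "cmod (graph_ip E f f v) \<le> B\<^sup>2" for v
  proof -
    have "fibre_norm E f v \<le> B"
      using *[of v] B by (cases "v \<in> V0") (auto simp: fibre_norm_def fibre_sum_def)
    then show ?thesis
      by (simp add: graph_ip_self norm_power power_mono fibre_norm_nonneg)
  qed
  then have "C0_norm (graph_ip E f f) \<le> B\<^sup>2"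
    by (rule C0_norm_least)
  then show ?thesis
    using B C0_norm_nonneg[OF graph_ip_self_C0] by (simp add: cnorm_def real_le_lsqrt)
qed

lemma cmod_le_fibre_norm:
  assumes e: "e \<in> V1" shows "cmod (f e) \<le> fibre_norm E f (gsrc E e)"
proof -
  have "(\<Sum>x\<in>{e}. (cmod (f x))\<^sup>2) \<le> (\<Sum>\<^sub>\<infinity>x\<in>graph_fibre E (gsrc E e). (cmod (f x))\<^sup>2)"
    using e carrier_l2_summable[OF gsrc_topspace[OF e]]
    by (intro sum_le_infsum_nonneg) (auto simp: graph_fibre_def)
  then show ?thesis
    using gsrc_topspace[OF e] by (simp add: fibre_norm_def fibre_sum_def real_le_rsqrt)
qed

lemma cmod_le_mnorm: "cmod (f e) \<le> mnorm f"
  using cmod_le_fibre_norm[of e] fibre_norm_le_mnorm[of "gsrc E e"] carrier_outside[of e] mnorm_nonneg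
  by (cases "e \<in> V1") auto

end

lemma carrier_dominatedI:
  assumes "\<And>e. e \<notin> V1 \<Longrightarrow> F e = 0"
    and F: "\<And>e. e \<in> V1 \<Longrightarrow> (F \<longlongrightarrow> F e) (nhdsin (gE1 E) e)"
    and "C0_summable E h" "\<And>e. e \<in> V1 \<Longrightarrow> (cmod (F e))\<^sup>2 \<le> h e"
  shows "F \<in> carrier"
  unfolding graph_corr_carrier_iff
  using assms by (auto intro!: C0_summable_dominated[of h] tendsto_power tendsto_norm)

lemma carrier_zero: "(\<lambda>_. 0) \<in> carrier"
  by (rule carrier_dominatedI[OF _ _ C0_summable_zero]) auto

text \<open>The mixed term of |f + g|^2 is absorbed by (a + b)^2 <= 2 (a^2 + b^2). This majorant is
  available before anything is known about <f, g>.\<close>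

lemma carrier_add:
  assumes f: "f \<in> carrier" and g: "g \<in> carrier"
  shows "(\<lambda>e. f e + g e) \<in> carrier"
proof (rule carrier_dominatedI)
  show "C0_summable E (\<lambda>e. 2 * ((cmod (f e))\<^sup>2 + (cmod (g e))\<^sup>2))"
    using f g by (intro C0_summable_cmult C0_summable_add carrier_C0_summable) auto
  show "(cmod (f e + g e))\<^sup>2 \<le> 2 * ((cmod (f e))\<^sup>2 + (cmod (g e))\<^sup>2)" for e
  proof -
    have "(cmod (f e + g e))\<^sup>2 \<le> (cmod (f e) + cmod (g e))\<^sup>2"
      by (intro power_mono norm_triangle_ineq) auto
    also have "\<dots> \<le> 2 * ((cmod (f e))\<^sup>2 + (cmod (g e))\<^sup>2)"
      using sum_squares_bound[of "cmod (f e)" "cmod (g e)"] by (simp add: power2_sum)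
    finally show ?thesis .
  qed
qed (auto intro!: tendsto_add carrier_tendsto[OF f] carrier_tendsto[OF g] simp: carrier_outside[OF f] carrier_outside[OF g])

lemma carrier_mult_bounded:
  assumes f: "f \<in> carrier"
    and b: "\<And>e. e \<in> V1 \<Longrightarrow> (b \<longlongrightarrow> b e) (nhdsin (gE1 E) e)"
    and B: "\<And>e. e \<in> V1 \<Longrightarrow> cmod (b e) \<le> B"
  shows "(\<lambda>e. b e * f e) \<in> carrier"
proof (rule carrier_dominatedI)
  show "C0_summable E (\<lambda>e. B\<^sup>2 * (cmod (f e))\<^sup>2)"
    using f by (intro C0_summable_cmult carrier_C0_summable) auto
  show "(cmod (b e * f e))\<^sup>2 \<le> B\<^sup>2 * (cmod (f e))\<^sup>2" if "e \<in> V1" for e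
    using B[OF that] by (auto simp: norm_mult power_mult_distrib intro!: mult_right_mono power_mono)
qed (auto intro!: tendsto_mult b carrier_tendsto[OF f] simp: carrier_outside[OF f])

lemma carrier_scale: "f \<in> carrier \<Longrightarrow> (\<lambda>e. z * f e) \<in> carrier"
  by (rule carrier_mult_bounded[where B = "cmod z"]) auto

lemma carrier_diff:
  "f \<in> carrier \<Longrightarrow> g \<in> carrier \<Longrightarrow> (\<lambda>e. f e - g e) \<in> carrier"
  using carrier_add[OF _ carrier_scale, of f g "-1"] by simp

lemma complex_vs_graph_corr: "complex_vs (graph_corr E)"
  by (rule complex_vs_functions) (auto intro: carrier_zero carrier_add carrier_scale)

lemma carrier_ract:
  assumes f: "f \<in> carrier" and a: "a \<in> C0_set (gE0 E)"
  shows "(\<lambda>e. f e * a (gsrc E e)) \<in> carrier"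
proof -
  obtain B where "\<And>v. cmod (a v) \<le> B" using C0_set_bounded[OF a] by blast
  then have "(\<lambda>e. a (gsrc E e) * f e) \<in> carrier"
    by (intro carrier_mult_bounded f
        filterlim_compose[OF C0_set_tendsto[OF a] local_homeomorphism_tendsto(1)[OF gsrc]] gsrc_topspace)
  then show ?thesis by (simp add: mult.commute)
qed

lemma carrier_lact:
  assumes f: "f \<in> carrier" and a: "a \<in> C0_set (gE0 E)"
  shows "(\<lambda>e. a (grng E e) * f e) \<in> carrier"
proof -
  obtain B where "\<And>v. cmod (a v) \<le> B" using C0_set_bounded[OF a] by blast
  moreover have "grng E e \<in> V0" if "e \<in> V1" for e
    using grng that by (auto simp: continuous_map_def)
  ultimately show ?thesis
    by (intro carrier_mult_bounded f
        filterlim_compose[OF C0_set_tendsto[OF a] filterlim_nhdsin_continuous_map[OF grng]])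
qed

context
  fixes f g assumes f: "f \<in> carrier" and g: "g \<in> carrier"
begin

text \<open>A common majorant for the integrand of <f, g>, by 2ab <= a^2 + b^2. It gives summability
  of the inner product on each fibre and its membership in C_0.\<close>

lemma C0_summable_ip_bound: "C0_summable E (\<lambda>e. (cmod (f e))\<^sup>2 + (cmod (g e))\<^sup>2)"
  using f g by (intro C0_summable_add carrier_C0_summable)

lemma cmod_ip_integrand_le: "cmod (cnj (f e) * g e) \<le> (cmod (f e))\<^sup>2 + (cmod (g e))\<^sup>2"
proof -
  have "2 * cmod (f e) * cmod (g e) \<le> (cmod (f e))\<^sup>2 + (cmod (g e))\<^sup>2"
    by (rule sum_squares_bound)
  moreover have "0 \<le> cmod (f e) * cmod (g e)" by simp
  ultimately have "cmod (f e) * cmod (g e) \<le> (cmod (f e))\<^sup>2 + (cmod (g e))\<^sup>2"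
    by linarith
  then show ?thesis
    by (simp add: norm_mult)
qed

lemma graph_ip_C0: "graph_ip E f g \<in> C0_set (gE0 E)"
  unfolding graph_ip_fibre_sum
  by (rule fibre_sum_C0_dominated[OF C0_summable_ip_bound _ cmod_ip_integrand_le])
    (auto intro!: tendsto_mult tendsto_cnj carrier_tendsto[OF f] carrier_tendsto[OF g])

lemma graph_ip_summable: "v \<in> V0 \<Longrightarrow> (\<lambda>e. cnj (f e) * g e) summable_on graph_fibre E v"
  by (rule C0_summable_summable_on[OF C0_summable_ip_bound _ cmod_ip_integrand_le])

lemma cmod_graph_ip_le: "cmod (graph_ip E f g v) \<le> fibre_norm E f v * fibre_norm E g v"
  using l2_infsum_Cauchy_Schwarz[OF carrier_l2_summable[OF f] carrier_l2_summable[OF g]]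
  by (auto simp: graph_ip_def fibre_norm_def fibre_sum_def)

lemma C0_norm_graph_ip_le: "C0_norm (graph_ip E f g) \<le> mnorm f * mnorm g"
  by (rule C0_norm_least, rule order_trans[OF cmod_graph_ip_le], rule mult_mono)
    (auto intro!: fibre_norm_le_mnorm[OF f] fibre_norm_le_mnorm[OF g] mnorm_nonneg[OF f] fibre_norm_nonneg)

lemma fibre_norm_triangle: "fibre_norm E (\<lambda>e. f e + g e) v \<le> fibre_norm E f v + fibre_norm E g v"
  using l2_infsum_triangle(2)[OF carrier_l2_summable[OF f] carrier_l2_summable[OF g]]
  by (auto simp: fibre_norm_def fibre_sum_def)

lemma mnorm_triangle: "mnorm (\<lambda>e. f e + g e) \<le> mnorm f + mnorm g"
  by (rule mnorm_least[OF carrier_add[OF f g]], rule order_trans[OF fibre_norm_triangle], rule add_mono)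
    (auto intro!: add_nonneg_nonneg fibre_norm_le_mnorm[OF f] fibre_norm_le_mnorm[OF g] mnorm_nonneg[OF f] mnorm_nonneg[OF g])

end

lemma graph_ip_add_right:
  assumes "f \<in> carrier" "g \<in> carrier" "h \<in> carrier"
  shows "graph_ip E f (\<lambda>e. g e + h e) = (\<lambda>v. graph_ip E f g v + graph_ip E f h v)"
  using graph_ip_summable assms by (auto simp: graph_ip_def distrib_left infsum_add fun_eq_iff)

lemma cnj_graph_ip: "cnj (graph_ip E f g v) = graph_ip E g f v"
  by (auto simp: graph_ip_def mult.commute simp flip: infsum_cnj)

lemma graph_ip_scale_right: "graph_ip E f (\<lambda>e. z * g e) = (\<lambda>v. z * graph_ip E f g v)"
  by (simp add: fun_eq_iff graph_ip_def mult.left_commute infsum_cmult_right')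

lemma graph_ip_ract: "graph_ip E f (\<lambda>e. g e * a (gsrc E e)) = (\<lambda>v. graph_ip E f g v * a v)"
proof -
  have "(\<Sum>\<^sub>\<infinity>e\<in>graph_fibre E v. cnj (f e) * (g e * a (gsrc E e)))
      = (\<Sum>\<^sub>\<infinity>e\<in>graph_fibre E v. cnj (f e) * g e * a v)" for v
    by (intro infsum_cong) (auto simp: graph_fibre_def)
  then show ?thesis
    by (simp add: fun_eq_iff graph_ip_def infsum_cmult_left')
qed

lemma graph_ip_self_eq_0:
  assumes f: "f \<in> carrier"
  shows "graph_ip E f f = (\<lambda>_. 0) \<longleftrightarrow> f = (\<lambda>_. 0)"
proof
  assume "graph_ip E f f = (\<lambda>_. 0)"
  then have "mnorm f = 0" by (simp add: cnorm_def)
  then show "f = (\<lambda>_. 0)"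
    using cmod_le_mnorm[OF f] by auto
qed (auto simp: graph_ip_def fun_eq_iff)

text \<open>The pointwise limit is continuous as a uniform limit. That it is square-summable with
  C_0 fibre sums follows by showing that its fibre norm is a uniform limit of the fibre norms of the
  sequence.\<close>

lemma norm_complete_graph_corr: "norm_complete (graph_corr E) mnorm"
  unfolding norm_complete_def
proof (intro allI impI)
  fix s :: "nat \<Rightarrow> 'e \<Rightarrow> complex"
  assume "(\<forall>i. s i \<in> carrier) \<and>
    (\<forall>e>0. \<exists>M. \<forall>i\<ge>M. \<forall>j\<ge>M. mnorm (vdiff (graph_corr E) (s i) (s j)) < e)"
  then have s: "\<And>i. s i \<in> carrier"
    and C: "\<And>r. r > 0 \<Longrightarrow> \<exists>M. \<forall>i\<ge>M. \<forall>j\<ge>M. mnorm (\<lambda>e. s i e - s j e) < r"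
    by (auto simp: vdiff_def)
  note diff = carrier_diff[OF s s]
  \<comment> \<open>The module norm dominates the supremum norm on edges, because each term of a
    fibre sum is at most the sum.\<close>
  have C': "\<exists>M. \<forall>i\<ge>M. \<forall>j\<ge>M. \<forall>x\<in>V1. cmod (s i x - s j x) \<le> r" if r: "r > 0" for r
  proof -
    obtain M where "\<forall>i\<ge>M. \<forall>j\<ge>M. mnorm (\<lambda>e. s i e - s j e) < r"
      using C[OF r] by blast
    then have "cmod (s i x - s j x) \<le> r" if "i \<ge> M" "j \<ge> M" for i j x
      using cmod_le_mnorm[OF diff[of i j], of x] that by fastforce
    then show ?thesis by blast
  qed
  obtain f where f: "\<And>x. x \<in> V1 \<Longrightarrow> (\<lambda>i. s i x) \<longlonglongrightarrow> f x"
      "\<And>x. x \<notin> V1 \<Longrightarrow> f x = 0"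
      "\<And>r. r > 0 \<Longrightarrow> \<exists>M. \<forall>i\<ge>M. \<forall>x\<in>V1. cmod (s i x - f x) \<le> r"
    by (rule uniformly_Cauchy_pointwise_limit[OF C'], assumption, rule that)
  have cont: "(f \<longlongrightarrow> f e) (nhdsin (gE1 E) e)" if e: "e \<in> V1" for e
  proof (rule uniform_limit_tendsto_nhdsin[OF carrier_tendsto[OF s e] _ e])
    show "\<exists>i. \<forall>x\<in>V1. cmod (s i x - f x) \<le> r" if "r > 0" for r
      using f(3)[OF that] by blast
  qed
  \<comment> \<open>Fatou's lemma: the bound on finite partial sums survives the pointwise limit in
    j and then extends to the whole fibre. M is chosen before v, so the estimate is uniform over the
    vertices.\<close>
  have Fatou: "\<exists>M. \<forall>i\<ge>M. \<forall>v\<in>V0.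
      (\<lambda>e. (cmod (s i e - f e))\<^sup>2) summable_on graph_fibre E v \<and>
      fibre_norm E (\<lambda>e. s i e - f e) v \<le> r" if r: "r > 0" for r
  proof -
    obtain M where M: "\<forall>i\<ge>M. \<forall>j\<ge>M. mnorm (\<lambda>e. s i e - s j e) < r"
      using C[OF r] by blast
    have "(\<lambda>e. (cmod (s i e - f e))\<^sup>2) summable_on graph_fibre E v \<and>
      fibre_norm E (\<lambda>e. s i e - f e) v \<le> r" if i: "i \<ge> M" and v: "v \<in> V0" for i v
    proof -
      have bd: "(\<Sum>e\<in>S. (cmod (s i e - f e))\<^sup>2) \<le> r\<^sup>2" if S: "finite S" "S \<subseteq> graph_fibre E v" for S
      proof (rule tendsto_upperbound)
        show "(\<lambda>j. \<Sum>e\<in>S. (cmod (s i e - s j e))\<^sup>2) \<longlonglongrightarrow> (\<Sum>e\<in>S. (cmod (s i e - f e))\<^sup>2)"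
          using S by (intro tendsto_intros f(1)) (auto simp: graph_fibre_def)
        have "(\<Sum>e\<in>S. (cmod (s i e - s j e))\<^sup>2) \<le> r\<^sup>2" if j: "j \<ge> M" for j
        proof -
          have "(\<Sum>e\<in>S. (cmod (s i e - s j e))\<^sup>2) \<le> (\<Sum>\<^sub>\<infinity>e\<in>graph_fibre E v. (cmod (s i e - s j e))\<^sup>2)"
            using S carrier_l2_summable[OF diff v] by (intro sum_le_infsum_nonneg) auto
          also have "\<dots> = (fibre_norm E (\<lambda>e. s i e - s j e) v)\<^sup>2"
            using v by (simp add: fibre_norm_def fibre_sum_def infsum_nonneg)
          also have "\<dots> \<le> r\<^sup>2"
          proof (rule power_mono)
            show "fibre_norm E (\<lambda>e. s i e - s j e) v \<le> r"
              using fibre_norm_le_mnorm[OF diff[of i j], of v] M i j by fastforce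
          qed (rule fibre_norm_nonneg)
          finally show ?thesis .
        qed
        then show "\<forall>\<^sub>F j in sequentially. (\<Sum>e\<in>S. (cmod (s i e - s j e))\<^sup>2) \<le> r\<^sup>2"
          by (auto simp: eventually_sequentially)
      qed simp
      note * = summable_on_infsum_le_bound[of "graph_fibre E v" "\<lambda>e. (cmod (s i e - f e))\<^sup>2", OF _ bd]
      have "fibre_norm E (\<lambda>e. s i e - f e) v \<le> r"
        using *(2) v r by (auto simp: fibre_norm_def fibre_sum_def infsum_nonneg intro!: real_le_lsqrt)
      with *(1) show ?thesis by simp
    qed
    then show ?thesis by blast
  qed
  obtain M0 where M0: "\<forall>i\<ge>M0. \<forall>v\<in>V0.
      (\<lambda>e. (cmod (s i e - f e))\<^sup>2) summable_on graph_fibre E v"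
    using Fatou[of 1] by auto
  \<comment> \<open>Written as (f - s M0) + s M0, both summands are square-summable on the
    fibre.\<close>
  have summ: "(\<lambda>e. (cmod (f e))\<^sup>2) summable_on graph_fibre E v" if v: "v \<in> V0" for v
  proof -
    have "(\<lambda>e. (cmod (f e - s M0 e))\<^sup>2) summable_on graph_fibre E v"
      using M0 v by (simp add: norm_minus_commute)
    from l2_infsum_triangle(1)[OF this carrier_l2_summable[OF s[of M0] v]] show ?thesis by simp
  qed
  \<comment> \<open>The reverse triangle inequality is taken from the l2 inequality on a single
    fibre, because f is not yet known to lie in the carrier.\<close>
  have fn: "\<bar>fibre_norm E (s i) v - fibre_norm E f v\<bar> \<le> fibre_norm E (\<lambda>e. s i e - f e) v"
    if v: "v \<in> V0" and i: "i \<ge> M0" for i v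
  proof -
    have 1: "(\<lambda>e. (cmod (s i e - f e))\<^sup>2) summable_on graph_fibre E v"
      using M0 v i by blast
    then have 2: "(\<lambda>e. (cmod (f e - s i e))\<^sup>2) summable_on graph_fibre E v"
      by (simp add: norm_minus_commute)
    have "fibre_norm E (s i) v \<le> fibre_norm E (\<lambda>e. s i e - f e) v + fibre_norm E f v"
      using l2_infsum_triangle(2)[OF 1 summ[OF v]] v by (simp add: fibre_norm_def fibre_sum_def)
    moreover have "fibre_norm E f v \<le> fibre_norm E (\<lambda>e. s i e - f e) v + fibre_norm E (s i) v"
      using l2_infsum_triangle(2)[OF 2 carrier_l2_summable[OF s[of i] v]] v
      by (simp add: fibre_norm_def fibre_sum_def norm_minus_commute)
    ultimately show ?thesis by simp
  qed
  have unif: "\<exists>i. \<forall>v\<in>V0.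
      cmod (complex_of_real (fibre_norm E (s i) v) - complex_of_real (fibre_norm E f v)) \<le> r" if r: "r > 0" for r
  proof -
    obtain M where M: "\<forall>i\<ge>M. \<forall>v\<in>V0. fibre_norm E (\<lambda>e. s i e - f e) v \<le> r"
      using Fatou[OF r] by blast
    have "cmod (complex_of_real (fibre_norm E (s (max M M0)) v) - complex_of_real (fibre_norm E f v)) \<le> r"
      if "v \<in> V0" for v
      using fn[OF that, of "max M M0"] M that by (auto simp flip: of_real_diff intro: order_trans)
    then show ?thesis by blast
  qed
  have fnC0: "(\<lambda>v. complex_of_real (fibre_norm E f v)) \<in> C0_set (gE0 E)"
  proof (rule C0_setI)
    show "((\<lambda>v. complex_of_real (fibre_norm E f v)) \<longlongrightarrow> complex_of_real (fibre_norm E f v)) (nhdsin (gE0 E) v)"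
      if "v \<in> V0" for v
      by (rule uniform_limit_tendsto_nhdsin[OF C0_set_tendsto[OF fibre_norm_C0[OF s] that] unif that])
    show "\<exists>g\<in>C0_set (gE0 E). \<forall>v\<in>V0.
        cmod (complex_of_real (fibre_norm E f v)) \<le> cmod (g v) + r" if r: "r > 0" for r
    proof -
      obtain i where i: "\<forall>v\<in>V0.
          cmod (complex_of_real (fibre_norm E (s i) v) - complex_of_real (fibre_norm E f v)) \<le> r"
        using unif[OF r] by blast
      have "cmod (complex_of_real (fibre_norm E f v)) \<le> cmod (complex_of_real (fibre_norm E (s i) v)) + r"
        if "v \<in> V0" for v
        using i[THEN bspec, OF that]
        by (intro order_trans[OF norm_triangle_sub add_left_mono]) (subst norm_minus_commute)
      then show ?thesis
        by (intro bexI[OF ballI fibre_norm_C0[OF s[of i]]])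
    qed
  qed (simp add: fibre_norm_def fibre_sum_def)
  \<comment> \<open>The fibre sum of |f|^2 is recovered as the square of a C_0 function.\<close>
  have "complex_of_real (fibre_norm E f v) * complex_of_real (fibre_norm E f v)
      = complex_of_real (fibre_sum E (\<lambda>e. (cmod (f e))\<^sup>2) v)" for v
    by (simp add: fibre_norm_def fibre_sum_nonneg flip: of_real_mult)
  then have "(\<lambda>v. complex_of_real (fibre_sum E (\<lambda>e. (cmod (f e))\<^sup>2) v)) \<in> C0_set (gE0 E)"
    using C0_set_mult[OF fnC0 fnC0] by simp
  then have fcar: "f \<in> carrier"
    unfolding graph_corr_carrier_iff C0_summable_def
    using f(2) cont summ by (auto intro!: tendsto_power tendsto_norm)
  have "(\<lambda>i. mnorm (\<lambda>e. s i e - f e)) \<longlonglongrightarrow> 0"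
  proof (rule LIMSEQ_I)
    fix r :: real assume r: "r > 0"
    then obtain M where M: "\<forall>i\<ge>M. \<forall>v\<in>V0. fibre_norm E (\<lambda>e. s i e - f e) v \<le> r / 2"
      using Fatou[of "r/2"] by auto
    have "mnorm (\<lambda>e. s i e - f e) \<le> r / 2" if "i \<ge> M" for i
      using M that r by (intro mnorm_least carrier_diff s fcar) auto
    then show "\<exists>M. \<forall>i\<ge>M. norm (mnorm (\<lambda>e. s i e - f e) - 0) < r"
      using r mnorm_nonneg[OF carrier_diff[OF s fcar]] by (intro exI[of _ M]) fastforce
  qed
  with fcar show "\<exists>f\<in>carrier. (\<lambda>i. mnorm (vdiff (graph_corr E) (s i) f)) \<longlonglongrightarrow> 0"
    by (auto simp: vdiff_def)
qed

text \<open>The witness is the fibre norm, the pointwise square root of <f, f>, which lies in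
  C_0.\<close>

lemma positive_elt_graph_ip:
  assumes f: "f \<in> carrier"
  shows "positive_elt (C0 (gE0 E)) (graph_ip E f f)"
proof -
  have "graph_ip E f f = (\<lambda>v. cnj (complex_of_real (fibre_norm E f v)) * complex_of_real (fibre_norm E f v))"
    by (auto simp: graph_ip_self[OF f] power2_eq_square)
  then show ?thesis
    unfolding positive_elt_def C0_sel using fibre_norm_C0[OF f] by (rule bexI)
qed

lemma correspondence_graph_corr: "correspondence (C0 (gE0 E)) (graph_corr E)"
proof -
  have "hilbert_module (C0 (gE0 E)) (graph_corr E)"
    unfolding hilbert_module_def
    using complex_vs_graph_corr norm_complete_graph_corr
    by (simp add: carrier_ract graph_ip_C0 cnj_graph_ip graph_ip_add_right graph_ip_scale_right graph_ip_ract
        positive_elt_graph_ip graph_ip_self_eq_0 distrib_left distrib_right mult.assoc mult.left_commute)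
  moreover have "graph_ip E (\<lambda>e. a (grng E e) * f e) g = graph_ip E f (\<lambda>e. cnj (a (grng E e)) * g e)" for a f g
    by (auto simp: graph_ip_def mult_ac)
  ultimately show ?thesis
    unfolding correspondence_def adjoint_maps_def
    by (simp add: Pi_iff carrier_lact carrier_lact[OF _ C0_set_cnj] distrib_right mult.assoc)
qed

end

section \<open>Representing an internal tensor product on a graph correspondence\<close>

context hausdorff_graph
begin

lemma mnorm_dominated:
  assumes f: "f \<in> carrier" and g: "g \<in> carrier" and B: "0 \<le> B"
    and le: "\<And>e. e \<in> V1 \<Longrightarrow> cmod (g e) \<le> B * cmod (f e)"
  shows "mnorm g \<le> B * mnorm f"
proof (rule mnorm_least[OF g])
  fix v assume v: "v \<in> V0"
  have "(\<Sum>\<^sub>\<infinity>e\<in>graph_fibre E v. (cmod (g e))\<^sup>2) \<le> (\<Sum>\<^sub>\<infinity>e\<in>graph_fibre E v. B\<^sup>2 * (cmod (f e))\<^sup>2)"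
    using carrier_l2_summable[OF f v] carrier_l2_summable[OF g v] le
    by (intro infsum_mono summable_on_cmult_right)
      (auto simp: graph_fibre_def simp flip: power_mult_distrib intro!: power_mono)
  also have "\<dots> = B\<^sup>2 * (\<Sum>\<^sub>\<infinity>e\<in>graph_fibre E v. (cmod (f e))\<^sup>2)"
    by (rule infsum_cmult_right')
  finally have "fibre_norm E g v \<le> sqrt (B\<^sup>2 * (\<Sum>\<^sub>\<infinity>e\<in>graph_fibre E v. (cmod (f e))\<^sup>2))"
    using v by (simp add: fibre_norm_def fibre_sum_def)
  also have "\<dots> = B * fibre_norm E f v"
    using v B by (simp add: fibre_norm_def fibre_sum_def real_sqrt_mult)
  also have "\<dots> \<le> B * mnorm f"
    using fibre_norm_le_mnorm[OF f] B by (rule mult_left_mono)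
  finally show "fibre_norm E g v \<le> B * mnorm f" .
qed (use B mnorm_nonneg[OF f] in auto)

lemma mnorm_diff_commute:
  "mnorm (\<lambda>e. f e - g e) = mnorm (\<lambda>e. g e - f e)"
proof -
  have "graph_ip E (\<lambda>e. f e - g e) (\<lambda>e. f e - g e) = graph_ip E (\<lambda>e. g e - f e) (\<lambda>e. g e - f e)"
    by (auto simp: graph_ip_def algebra_simps intro!: infsum_cong)
  then show ?thesis
    by (simp only: cnorm_def graph_corr_sel)
qed

lemma mnorm_diff_triangle:
  assumes "f \<in> carrier" "g \<in> carrier" "h \<in> carrier"
  shows "mnorm (\<lambda>e. f e - h e) \<le> mnorm (\<lambda>e. f e - g e) + mnorm (\<lambda>e. g e - h e)"
  using mnorm_triangle[OF carrier_diff[OF assms(1,2)] carrier_diff[OF assms(2,3)]] by simp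

lemma mnorm_eq_0: "f \<in> carrier \<Longrightarrow> mnorm f = 0 \<Longrightarrow> f = (\<lambda>_. 0)"
  using cmod_le_mnorm[of f] by auto

lemma graph_ip_add_left:
  assumes "f \<in> carrier" "g \<in> carrier" "h \<in> carrier"
  shows "graph_ip E (\<lambda>e. f e + g e) h = (\<lambda>v. graph_ip E f h v + graph_ip E g h v)"
proof -
  have "graph_ip E (\<lambda>e. f e + g e) h v = cnj (graph_ip E h (\<lambda>e. f e + g e) v)" for v
    by (simp add: cnj_graph_ip)
  then show ?thesis
    using assms by (simp add: fun_eq_iff graph_ip_add_right cnj_graph_ip)
qed

lemma tendsto_graph_ip:
  assumes s: "\<And>i. s i \<in> carrier" and t: "\<And>i. t i \<in> carrier"
    and f: "f \<in> carrier" and g: "g \<in> carrier"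
    and sf: "(\<lambda>i. mnorm (\<lambda>e. s i e - f e)) \<longlonglongrightarrow> 0" and tg: "(\<lambda>i. mnorm (\<lambda>e. t i e - g e)) \<longlonglongrightarrow> 0"
  shows "(\<lambda>i. C0_norm (\<lambda>v. graph_ip E (s i) (t i) v - graph_ip E f g v)) \<longlonglongrightarrow> 0"
proof (rule tendsto_sandwich)
  \<comment> \<open>From <s, t> - <f, g> = <s, t - g> + <s - f, g>, with the norm of s bounded by
    that of s - f plus that of f, so that no separate bound on the sequence is required.\<close>
  let ?b = "\<lambda>i. (mnorm (\<lambda>e. s i e - f e) + mnorm f) * mnorm (\<lambda>e. t i e - g e)
    + mnorm (\<lambda>e. s i e - f e) * mnorm g"
  have "(\<lambda>v. graph_ip E (s i) (t i) v - graph_ip E f g v) \<in> C0_set (gE0 E)" for i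
    using C0_set_add[OF graph_ip_C0[OF s[of i] t[of i]] C0_set_scale[OF graph_ip_C0[OF f g], of "-1"]] by simp
  then show "\<forall>\<^sub>F i in sequentially. 0 \<le> C0_norm (\<lambda>v. graph_ip E (s i) (t i) v - graph_ip E f g v)"
    by (auto intro!: always_eventually C0_norm_nonneg)
  have "cmod (graph_ip E (s i) (t i) v - graph_ip E f g v) \<le> ?b i" for i v
  proof -
    note sd = carrier_diff[OF s[of i] f] and td = carrier_diff[OF t[of i] g]
    have "graph_ip E (s i) (t i) v - graph_ip E f g v =
        graph_ip E (s i) (\<lambda>e. t i e - g e) v + graph_ip E (\<lambda>e. s i e - f e) g v"
      using graph_ip_add_right[OF s[of i] td g] graph_ip_add_left[OF sd f g] by (simp add: fun_eq_iff)
    also have "cmod \<dots> \<le> cmod (graph_ip E (s i) (\<lambda>e. t i e - g e) v) + cmod (graph_ip E (\<lambda>e. s i e - f e) g v)"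
      by (rule norm_triangle_ineq)
    also have "\<dots> \<le> mnorm (s i) * mnorm (\<lambda>e. t i e - g e) + mnorm (\<lambda>e. s i e - f e) * mnorm g"
      using C0_norm_upper[OF graph_ip_C0[OF s[of i] td], of v] C0_norm_graph_ip_le[OF s[of i] td]
        C0_norm_upper[OF graph_ip_C0[OF sd g], of v] C0_norm_graph_ip_le[OF sd g] by linarith
    also have "\<dots> \<le> ?b i"
      using mnorm_triangle[OF sd f] mnorm_nonneg[OF td] mnorm_nonneg[OF g] by (intro add_mono mult_right_mono) auto
    finally show ?thesis .
  qed
  then show "\<forall>\<^sub>F i in sequentially. C0_norm (\<lambda>v. graph_ip E (s i) (t i) v - graph_ip E f g v) \<le> ?b i"
    by (auto intro!: always_eventually C0_norm_least)
  have "?b \<longlonglongrightarrow> (0 + mnorm f) * 0 + 0 * mnorm g"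
    using sf tg by (intro tendsto_intros)
  then show "?b \<longlonglongrightarrow> 0" by simp
qed auto

end

text \<open>What it takes to identify \<open>tensor A X Y\<close> with the correspondence of a
  graph: \<open>mul\<close> respects scalars and both actions, preserves the form on elementary
  tensors, and has dense sums. X and Y are arbitrary records; completeness and the triangle
  inequality are taken from the target only.\<close>

locale tensor_representation = hausdorff_graph G
  for G :: "('v, 'g) top_graph" +
  fixes X :: "('v \<Rightarrow> complex, 'x) corr" and Y :: "('v \<Rightarrow> complex, 'y) corr"
    and mul :: "'x \<Rightarrow> 'y \<Rightarrow> 'g \<Rightarrow> complex"
  assumes X_scale: "x \<in> vcarrier X \<Longrightarrow> vscale X z x \<in> vcarrier X"
    and X_lact: "x \<in> vcarrier X \<Longrightarrow> a \<in> C0_set (gE0 G) \<Longrightarrow> lact X a x \<in> vcarrier X"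
    and Y_ract: "y \<in> vcarrier Y \<Longrightarrow> a \<in> C0_set (gE0 G) \<Longrightarrow> ract Y y a \<in> vcarrier Y"
    and mul_closed: "x \<in> vcarrier X \<Longrightarrow> y \<in> vcarrier Y \<Longrightarrow> mul x y \<in> vcarrier (graph_corr G)"
    and mul_scale: "x \<in> vcarrier X \<Longrightarrow> y \<in> vcarrier Y \<Longrightarrow> mul (vscale X z x) y = (\<lambda>e. z * mul x y e)"
    and mul_lact: "x \<in> vcarrier X \<Longrightarrow> y \<in> vcarrier Y \<Longrightarrow> a \<in> C0_set (gE0 G) \<Longrightarrow>
      mul (lact X a x) y = (\<lambda>e. a (grng G e) * mul x y e)"
    and mul_ract: "x \<in> vcarrier X \<Longrightarrow> y \<in> vcarrier Y \<Longrightarrow> a \<in> C0_set (gE0 G) \<Longrightarrow>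
      mul x (ract Y y a) = (\<lambda>e. mul x y e * a (gsrc G e))"
    and mul_ip: "x \<in> vcarrier X \<Longrightarrow> y \<in> vcarrier Y \<Longrightarrow> x' \<in> vcarrier X \<Longrightarrow> y' \<in> vcarrier Y \<Longrightarrow>
      graph_ip G (mul x y) (mul x' y') = ip Y y (lact Y (ip X x x') y')"
    and mul_dense: "h \<in> vcarrier (graph_corr G) \<Longrightarrow> r > 0 \<Longrightarrow>
      \<exists>t\<in>fsums X Y. mnorm (\<lambda>e. (\<Sum>(x, y)\<leftarrow>t. mul x y e) - h e) < r"
begin

section \<open>Evaluation of formal sums in the target module, and limits of such
  evaluations\<close>

abbreviation A where "A \<equiv> C0 (gE0 G)"
abbreviation Z where "Z \<equiv> graph_corr G"

definition eval_fsum :: "('x, 'y) fsum \<Rightarrow> 'g \<Rightarrow> complex" where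
  "eval_fsum t e = (\<Sum>(x, y)\<leftarrow>t. mul x y e)"

lemma eval_fsum_simps [simp]:
  "eval_fsum [] = (\<lambda>_. 0)" "eval_fsum ((x, y) # t) = (\<lambda>e. mul x y e + eval_fsum t e)"
  "eval_fsum (t @ u) = (\<lambda>e. eval_fsum t e + eval_fsum u e)"
  by (auto simp: eval_fsum_def)

lemma fsums_simps [simp]:
  "[] \<in> fsums X Y" "(x, y) # t \<in> fsums X Y \<longleftrightarrow> x \<in> vcarrier X \<and> y \<in> vcarrier Y \<and> t \<in> fsums X Y"
  "t @ u \<in> fsums X Y \<longleftrightarrow> t \<in> fsums X Y \<and> u \<in> fsums X Y"
  by (auto simp: fsums_def)

lemma fsums_induct [consumes 1, case_names Nil Cons]:
  assumes "t \<in> fsums X Y" "P []"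
    and "\<And>x y t. x \<in> vcarrier X \<Longrightarrow> y \<in> vcarrier Y \<Longrightarrow> t \<in> fsums X Y \<Longrightarrow> P t \<Longrightarrow> P ((x, y) # t)"
  shows "P t"
  using assms(1) by (induction t) (auto intro: assms(2,3))

lemma eval_fsum_closed: "t \<in> fsums X Y \<Longrightarrow> eval_fsum t \<in> vcarrier Z"
  by (induction t rule: fsums_induct) (auto intro: carrier_zero carrier_add mul_closed)

lemma eval_fsum_scale:
  "t \<in> fsums X Y \<Longrightarrow> fs_scale X z t \<in> fsums X Y \<and> eval_fsum (fs_scale X z t) = (\<lambda>e. z * eval_fsum t e)"
  by (induction t rule: fsums_induct) (auto simp: fs_scale_def mul_scale X_scale distrib_left)

lemma eval_fsum_lact:
  "t \<in> fsums X Y \<Longrightarrow> a \<in> C0_set (gE0 G) \<Longrightarrow>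
    map (\<lambda>(x, y). (lact X a x, y)) t \<in> fsums X Y \<and>
    eval_fsum (map (\<lambda>(x, y). (lact X a x, y)) t) = (\<lambda>e. a (grng G e) * eval_fsum t e)"
  by (induction t rule: fsums_induct) (auto simp: mul_lact X_lact distrib_left)

lemma eval_fsum_ract:
  "t \<in> fsums X Y \<Longrightarrow> a \<in> C0_set (gE0 G) \<Longrightarrow>
    map (\<lambda>(x, y). (x, ract Y y a)) t \<in> fsums X Y \<and>
    eval_fsum (map (\<lambda>(x, y). (x, ract Y y a)) t) = (\<lambda>e. eval_fsum t e * a (gsrc G e))"
  by (induction t rule: fsums_induct) (auto simp: mul_ract Y_ract distrib_right)

lemma foldr_pointwise_add:
  "foldr (\<lambda>f g v. f v + g v) fs (\<lambda>_. 0) = (\<lambda>v. \<Sum>f\<leftarrow>fs. f v :: complex)"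
  by (induction fs) auto

text \<open>\<open>mul_ip\<close> extended to sums by induction over both lists. It makes the
  seminorm of a formal sum the module norm of its image, so all properties of \<open>fs_dist\<close>
  come from the target.\<close>

lemma fs_ip_eq:
  assumes t: "t \<in> fsums X Y" and u: "u \<in> fsums X Y"
  shows "fs_ip A X Y t u = graph_ip G (eval_fsum t) (eval_fsum u)"
proof -
  have 1: "(\<Sum>(x', y')\<leftarrow>u. ip Y y (lact Y (ip X x x') y') v) = graph_ip G (mul x y) (eval_fsum u) v"
    if "x \<in> vcarrier X" "y \<in> vcarrier Y" for x y v
    using u
  proof (induction u rule: fsums_induct)
    case (Cons x' y' u)
    then show ?case
      using that by (simp add: graph_ip_add_right mul_closed eval_fsum_closed mul_ip)
  qed (simp add: graph_ip_def)
  have "(\<Sum>p\<leftarrow>List.product t u. (case p of ((x, y), (x', y')) \<Rightarrow> ip Y y (lact Y (ip X x x') y')) v)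
      = graph_ip G (eval_fsum t) (eval_fsum u) v" for v
    using t
  proof (induction t rule: fsums_induct)
    case (Cons x y t)
    have "(\<Sum>p\<leftarrow>map (Pair (x, y)) u. (case p of ((x, y), (x', y')) \<Rightarrow> ip Y y (lact Y (ip X x x') y')) v)
        = (\<Sum>(x', y')\<leftarrow>u. ip Y y (lact Y (ip X x x') y') v)"
      by (simp add: o_def split_def)
    with Cons 1[of x y v] show ?case
      using u by (simp add: graph_ip_add_left mul_closed eval_fsum_closed)
  qed (simp add: graph_ip_def)
  then show ?thesis
    by (simp add: fs_ip_def foldr_pointwise_add o_def fun_eq_iff split_def)
qed

lemma fs_dist_eq:
  assumes t: "t \<in> fsums X Y" and u: "u \<in> fsums X Y"
  shows "fs_dist A X Y t u = mnorm (\<lambda>e. eval_fsum t e - eval_fsum u e)"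
  using t eval_fsum_scale[OF u, of "-1"] by (simp add: fs_dist_def Let_def fs_ip_eq cnorm_def)

definition converges :: "(nat \<Rightarrow> ('x, 'y) fsum) \<Rightarrow> ('g \<Rightarrow> complex) \<Rightarrow> bool" where
  "converges s z \<longleftrightarrow> (\<forall>i. s i \<in> fsums X Y) \<and> (\<lambda>i. mnorm (\<lambda>e. eval_fsum (s i) e - z e)) \<longlonglongrightarrow> 0"

lemma converges_bound:
  assumes "\<And>i. s i \<in> fsums X Y" "\<And>i. mnorm (\<lambda>e. eval_fsum (s i) e - z e) \<le> b i" "b \<longlonglongrightarrow> 0" "z \<in> vcarrier Z"
  shows "converges s z"
  unfolding converges_def using assms
  by (auto intro!: tendsto_sandwich[OF _ _ tendsto_const assms(3)] always_eventually mnorm_nonneg carrier_diff eval_fsum_closed)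

lemma ex_converges:
  assumes "z \<in> vcarrier Z" obtains s where "converges s z"
proof -
  have "\<exists>t. t \<in> fsums X Y \<and> mnorm (\<lambda>e. eval_fsum t e - z e) < inverse (real (Suc i))" for i
    using mul_dense[OF assms, of "inverse (real (Suc i))"] by (auto simp: eval_fsum_def)
  then obtain s where s: "\<And>i. s i \<in> fsums X Y \<and> mnorm (\<lambda>e. eval_fsum (s i) e - z e) < inverse (real (Suc i))"
    by metis
  have "converges s z"
    using s by (intro converges_bound[OF _ _ LIMSEQ_inverse_real_of_nat] assms) (auto intro: less_imp_le)
  then show ?thesis by (rule that)
qed

lemma converges_unique:
  assumes s: "converges s z" "converges s w" and z: "z \<in> vcarrier Z" and w: "w \<in> vcarrier Z"
  shows "z = w"
proof -
  have "mnorm (\<lambda>e. z e - w e) \<le> mnorm (\<lambda>e. eval_fsum (s i) e - z e) + mnorm (\<lambda>e. eval_fsum (s i) e - w e)" for i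
    using mnorm_diff_triangle[OF z eval_fsum_closed w, of "s i"] s(1)
    by (simp add: converges_def mnorm_diff_commute[of z])
  moreover have "(\<lambda>i. mnorm (\<lambda>e. eval_fsum (s i) e - z e) + mnorm (\<lambda>e. eval_fsum (s i) e - w e)) \<longlonglongrightarrow> 0 + 0"
    using s by (intro tendsto_add) (auto simp: converges_def)
  ultimately have "mnorm (\<lambda>e. z e - w e) \<le> 0"
    by (intro tendsto_lowerbound[of _ _ sequentially]) (auto intro!: always_eventually)
  then have "(\<lambda>e. z e - w e) = (\<lambda>_. 0)"
    using carrier_diff[OF z w] by (intro mnorm_eq_0 antisym mnorm_nonneg) auto
  then show ?thesis by (simp add: fun_eq_iff)
qed

text \<open>Evaluation is isometric, so Cauchy sequences of formal sums have Cauchy images, and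
  these converge because the graph correspondence is complete.\<close>

lemma fs_cauchy_iff: "s \<in> fs_cauchy A X Y \<longleftrightarrow> (\<exists>z\<in>vcarrier Z. converges s z)"
proof
  assume "s \<in> fs_cauchy A X Y"
  then have s: "\<And>i. s i \<in> fsums X Y"
    and C: "\<forall>r>0. \<exists>M. \<forall>i\<ge>M. \<forall>j\<ge>M. mnorm (\<lambda>e. eval_fsum (s i) e - eval_fsum (s j) e) < r"
    by (auto simp: fs_cauchy_def fs_dist_eq)
  from C s have "\<exists>z\<in>vcarrier Z. (\<lambda>i. mnorm (\<lambda>e. eval_fsum (s i) e - z e)) \<longlonglongrightarrow> 0"
    using norm_complete_graph_corr[unfolded norm_complete_def, THEN spec, of "\<lambda>i. eval_fsum (s i)"]
    by (simp add: vdiff_def eval_fsum_closed)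
  with s show "\<exists>z\<in>vcarrier Z. converges s z"
    by (auto simp: converges_def)
next
  assume "\<exists>z\<in>vcarrier Z. converges s z"
  then obtain z where z: "z \<in> vcarrier Z" and s: "\<And>i. s i \<in> fsums X Y"
    and lim: "(\<lambda>i. mnorm (\<lambda>e. eval_fsum (s i) e - z e)) \<longlonglongrightarrow> 0"
    by (auto simp: converges_def)
  have "\<exists>M. \<forall>i\<ge>M. \<forall>j\<ge>M. fs_dist A X Y (s i) (s j) < r" if r: "r > 0" for r
  proof -
    have "\<forall>\<^sub>F i in sequentially. mnorm (\<lambda>e. eval_fsum (s i) e - z e) < r/2"
      using lim r by (intro order_tendstoD) auto
    then obtain M where M: "\<And>i. i \<ge> M \<Longrightarrow> mnorm (\<lambda>e. eval_fsum (s i) e - z e) < r/2"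
      by (auto simp: eventually_sequentially)
    have "fs_dist A X Y (s i) (s j) < r" if "i \<ge> M" "j \<ge> M" for i j
      using mnorm_diff_triangle[OF eval_fsum_closed[OF s[of i]] z eval_fsum_closed[OF s[of j]]]
        M[OF that(1)] M[OF that(2)] s by (simp add: fs_dist_eq mnorm_diff_commute[of z])
    then show ?thesis by blast
  qed
  with s show "s \<in> fs_cauchy A X Y"
    by (auto simp: fs_cauchy_def)
qed

text \<open>The inverse of the desired isomorphism, from elements of the target to classes of
  sequences.\<close>

definition limit_class :: "('g \<Rightarrow> complex) \<Rightarrow> (nat \<Rightarrow> ('x, 'y) fsum) set" where
  "limit_class z = {s. converges s z}"

text \<open>Two sequences are at vanishing distance exactly when their images have the same limit,
  so the class of s depends on z alone.\<close>

lemma fs_class_eq: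
  assumes s: "converges s z" and z: "z \<in> vcarrier Z"
  shows "fs_class A X Y s = limit_class z"
proof (intro equalityI subsetI)
  fix t assume "t \<in> limit_class z"
  then have t: "converges t z" by (simp add: limit_class_def)
  have "(\<lambda>i. fs_dist A X Y (s i) (t i)) \<longlonglongrightarrow> 0"
  proof (rule tendsto_sandwich[OF _ _ tendsto_const])
    have "(\<lambda>i. mnorm (\<lambda>e. eval_fsum (s i) e - z e) + mnorm (\<lambda>e. eval_fsum (t i) e - z e)) \<longlonglongrightarrow> 0 + 0"
      using s t by (intro tendsto_add) (auto simp: converges_def)
    then show "(\<lambda>i. mnorm (\<lambda>e. eval_fsum (s i) e - z e) + mnorm (\<lambda>e. eval_fsum (t i) e - z e)) \<longlonglongrightarrow> 0"
      by simp
    show "\<forall>\<^sub>F i in sequentially. fs_dist A X Y (s i) (t i) \<le>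
        mnorm (\<lambda>e. eval_fsum (s i) e - z e) + mnorm (\<lambda>e. eval_fsum (t i) e - z e)"
      using mnorm_diff_triangle[OF eval_fsum_closed z eval_fsum_closed] s t
      by (auto intro!: always_eventually simp: fs_dist_eq converges_def mnorm_diff_commute[of z])
    show "\<forall>\<^sub>F i in sequentially. 0 \<le> fs_dist A X Y (s i) (t i)"
      using s t by (auto intro!: always_eventually mnorm_nonneg carrier_diff eval_fsum_closed simp: fs_dist_eq converges_def)
  qed
  then show "t \<in> fs_class A X Y s"
    using t z by (auto simp: fs_class_def fs_cauchy_iff)
next
  fix t assume "t \<in> fs_class A X Y s"
  then have t: "\<And>i. t i \<in> fsums X Y" and lim: "(\<lambda>i. fs_dist A X Y (s i) (t i)) \<longlonglongrightarrow> 0"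
    by (auto simp: fs_class_def fs_cauchy_def)
  have "converges t z"
  proof (rule converges_bound[OF t _ _ z])
    have "(\<lambda>i. fs_dist A X Y (s i) (t i) + mnorm (\<lambda>e. eval_fsum (s i) e - z e)) \<longlonglongrightarrow> 0 + 0"
      using s lim by (intro tendsto_add) (auto simp: converges_def)
    then show "(\<lambda>i. fs_dist A X Y (s i) (t i) + mnorm (\<lambda>e. eval_fsum (s i) e - z e)) \<longlonglongrightarrow> 0"
      by simp
    show "mnorm (\<lambda>e. eval_fsum (t i) e - z e)
        \<le> fs_dist A X Y (s i) (t i) + mnorm (\<lambda>e. eval_fsum (s i) e - z e)" for i
      using mnorm_diff_triangle[OF eval_fsum_closed[OF t[of i]] eval_fsum_closed[of "s i"] z] s t
      by (simp add: fs_dist_eq converges_def mnorm_diff_commute[of "eval_fsum (t i)"])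
  qed
  then show "t \<in> limit_class z"
    by (simp add: limit_class_def)
qed

lemma limit_class_nonempty: "z \<in> vcarrier Z \<Longrightarrow> \<exists>s. s \<in> limit_class z"
  using ex_converges by (auto simp: limit_class_def)

lemma inj_on_limit_class: "inj_on limit_class (vcarrier Z)"
proof (rule inj_onI)
  fix z w assume zw: "z \<in> vcarrier Z" "w \<in> vcarrier Z" "limit_class z = limit_class w"
  then obtain s where "s \<in> limit_class z" using limit_class_nonempty by blast
  with zw show "z = w"
    using converges_unique[of s z w] by (auto simp: limit_class_def)
qed

lemma tensor_carrier: "vcarrier (tensor A X Y) = limit_class ` vcarrier Z"
proof -
  have "fs_class A X Y ` fs_cauchy A X Y = limit_class ` vcarrier Z"
  proof safe
    fix s assume "s \<in> fs_cauchy A X Y"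
    then show "fs_class A X Y s \<in> limit_class ` vcarrier Z"
      using fs_class_eq by (auto simp: fs_cauchy_iff)
  next
    fix z assume z: "z \<in> vcarrier Z"
    then obtain s where s: "converges s z" using ex_converges by blast
    with z have "s \<in> fs_cauchy A X Y" by (auto simp: fs_cauchy_iff)
    with fs_class_eq[OF s z] show "limit_class z \<in> fs_class A X Y ` fs_cauchy A X Y"
      by blast
  qed
  then show ?thesis by (simp add: tensor_def)
qed

lemma converges_add:
  assumes s: "converges s z" and t: "converges t w" and z: "z \<in> vcarrier Z" and w: "w \<in> vcarrier Z"
  shows "converges (\<lambda>i. s i @ t i) (\<lambda>e. z e + w e)"
proof (rule converges_bound)
  have "(\<lambda>i. mnorm (\<lambda>e. eval_fsum (s i) e - z e) + mnorm (\<lambda>e. eval_fsum (t i) e - w e)) \<longlonglongrightarrow> 0 + 0"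
    using s t by (intro tendsto_add) (auto simp: converges_def)
  then show "(\<lambda>i. mnorm (\<lambda>e. eval_fsum (s i) e - z e) + mnorm (\<lambda>e. eval_fsum (t i) e - w e)) \<longlonglongrightarrow> 0"
    by simp
  fix i
  have "mnorm (\<lambda>e. (eval_fsum (s i) e - z e) + (eval_fsum (t i) e - w e))
      \<le> mnorm (\<lambda>e. eval_fsum (s i) e - z e) + mnorm (\<lambda>e. eval_fsum (t i) e - w e)"
    using s t z w by (intro mnorm_triangle carrier_diff eval_fsum_closed) (auto simp: converges_def)
  then show "mnorm (\<lambda>e. eval_fsum (s i @ t i) e - (z e + w e))
      \<le> mnorm (\<lambda>e. eval_fsum (s i) e - z e) + mnorm (\<lambda>e. eval_fsum (t i) e - w e)"
    by (simp add: algebra_simps)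
qed (use s t z w in \<open>auto simp: converges_def intro: carrier_add\<close>)

text \<open>Scalars, the right action and the left action are all multiplication by a bounded
  function b on the edges, namely a constant, a function of the source or a function of the
  range.\<close>

lemma converges_mult:
  assumes s: "converges s z" and z: "z \<in> vcarrier Z" and bz: "(\<lambda>e. b e * z e) \<in> vcarrier Z"
    and t: "\<And>i. t i \<in> fsums X Y" "\<And>i. eval_fsum (t i) = (\<lambda>e. b e * eval_fsum (s i) e)"
    and B: "\<And>e. e \<in> topspace (gE1 G) \<Longrightarrow> cmod (b e) \<le> B" "0 \<le> B"
  shows "converges t (\<lambda>e. b e * z e)"
proof (rule converges_bound[OF t(1) _ _ bz])
  have "(\<lambda>i. B * mnorm (\<lambda>e. eval_fsum (s i) e - z e)) \<longlonglongrightarrow> B * 0"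
    using s by (intro tendsto_mult tendsto_const) (auto simp: converges_def)
  then show "(\<lambda>i. B * mnorm (\<lambda>e. eval_fsum (s i) e - z e)) \<longlonglongrightarrow> 0" by simp
  fix i
  show "mnorm (\<lambda>e. eval_fsum (t i) e - b e * z e) \<le> B * mnorm (\<lambda>e. eval_fsum (s i) e - z e)"
  proof (rule mnorm_dominated)
    show "(\<lambda>e. eval_fsum (s i) e - z e) \<in> vcarrier Z"
      using s z by (intro carrier_diff eval_fsum_closed) (auto simp: converges_def)
    show "(\<lambda>e. eval_fsum (t i) e - b e * z e) \<in> vcarrier Z"
      by (intro carrier_diff eval_fsum_closed t bz)
    show "cmod (eval_fsum (t i) e - b e * z e) \<le> B * cmod (eval_fsum (s i) e - z e)"
      if "e \<in> topspace (gE1 G)" for e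
    proof -
      have "eval_fsum (t i) e - b e * z e = b e * (eval_fsum (s i) e - z e)"
        by (simp add: t algebra_simps)
      then show ?thesis
        using B(1)[OF that] by (simp add: norm_mult mult_right_mono)
    qed
  qed (rule B)
qed

text \<open>The operations of \<open>tensor\<close> are unions over representatives. Every
  representative yields the same class and there is at least one, so the union is that class; this
  is well-definedness.\<close>

lemma UN_limit_class:
  assumes z: "z \<in> vcarrier Z" and w: "w \<in> vcarrier Z"
    and conv: "\<And>s. converges s z \<Longrightarrow> converges (g s) w"
  shows "(\<Union>s\<in>limit_class z. fs_class A X Y (g s)) = limit_class w"
  using limit_class_nonempty[OF z] fs_class_eq[OF conv w] by (auto simp: limit_class_def)

lemma tensor_add:
  assumes z: "z \<in> vcarrier Z" and w: "w \<in> vcarrier Z"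
  shows "vadd (tensor A X Y) (limit_class z) (limit_class w) = limit_class (\<lambda>e. z e + w e)"
proof -
  have "(\<Union>t\<in>limit_class w. fs_class A X Y (\<lambda>i. s i @ t i)) = limit_class (\<lambda>e. z e + w e)"
    if "s \<in> limit_class z" for s
    using that by (intro UN_limit_class w carrier_add z converges_add) (auto simp: limit_class_def)
  then show ?thesis
    using limit_class_nonempty[OF z] by (auto simp: tensor_def)
qed

lemma tensor_scale:
  assumes z: "z \<in> vcarrier Z"
  shows "vscale (tensor A X Y) c (limit_class z) = limit_class (\<lambda>e. c * z e)"
proof -
  have "converges (\<lambda>i. fs_scale X c (s i)) (\<lambda>e. c * z e)" if "converges s z" for s
    by (rule converges_mult[where b = "\<lambda>_. c", OF that z carrier_scale[OF z], of _ "cmod c"])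
      (use that eval_fsum_scale in \<open>auto simp: converges_def\<close>)
  then show ?thesis
    unfolding tensor_def using z by (simp add: UN_limit_class carrier_scale)
qed

lemma tensor_ract:
  assumes z: "z \<in> vcarrier Z" and a: "a \<in> C0_set (gE0 G)"
  shows "ract (tensor A X Y) (limit_class z) a = limit_class (\<lambda>e. z e * a (gsrc G e))"
proof -
  obtain B where B: "0 \<le> B" "\<And>v. cmod (a v) \<le> B" using C0_set_bounded[OF a] by blast
  have "converges (\<lambda>i. map (\<lambda>(x, y). (x, ract Y y a)) (s i)) (\<lambda>e. a (gsrc G e) * z e)"
    if "converges s z" for s
  proof (rule converges_mult[where b = "\<lambda>e. a (gsrc G e)" and B = B, OF that z])
    show "(\<lambda>e. a (gsrc G e) * z e) \<in> vcarrier Z"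
      using carrier_ract[OF z a] by (simp add: mult.commute)
  qed (use that B eval_fsum_ract[OF _ a] in \<open>auto simp: converges_def mult.commute\<close>)
  then show ?thesis
    unfolding tensor_def using z a carrier_ract[OF z a] by (simp add: UN_limit_class mult.commute)
qed

lemma tensor_lact:
  assumes z: "z \<in> vcarrier Z" and a: "a \<in> C0_set (gE0 G)"
  shows "lact (tensor A X Y) a (limit_class z) = limit_class (\<lambda>e. a (grng G e) * z e)"
proof -
  obtain B where B: "0 \<le> B" "\<And>v. cmod (a v) \<le> B" using C0_set_bounded[OF a] by blast
  have "converges (\<lambda>i. map (\<lambda>(x, y). (lact X a x, y)) (s i)) (\<lambda>e. a (grng G e) * z e)"
    if "converges s z" for s
    by (rule converges_mult[where b = "\<lambda>e. a (grng G e)" and B = B, OF that z carrier_lact[OF z a]])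
      (use that B eval_fsum_lact[OF _ a] in \<open>auto simp: converges_def\<close>)
  then show ?thesis
    unfolding tensor_def using z a by (simp add: UN_limit_class carrier_lact)
qed

text \<open>Continuity of the inner product shows that its value in the target satisfies the
  description, and uniqueness of limits in the supremum norm, tested on one pair of representatives,
  shows that nothing else does.\<close>

lemma tensor_ip:
  assumes z: "z \<in> vcarrier Z" and w: "w \<in> vcarrier Z"
  shows "ip (tensor A X Y) (limit_class z) (limit_class w) = graph_ip G z w"
proof -
  have lim: "(\<lambda>i. anorm A (vdiff A (fs_ip A X Y (s i) (t i)) (graph_ip G z w))) \<longlonglongrightarrow> 0"
    if "s \<in> limit_class z" "t \<in> limit_class w" for s t
    using that tendsto_graph_ip[of "\<lambda>i. eval_fsum (s i)" "\<lambda>i. eval_fsum (t i)", OF _ _ z w]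
    by (simp add: limit_class_def converges_def fs_ip_eq vdiff_def eval_fsum_closed)
  have uniq: "a = graph_ip G z w" if a: "a \<in> C0_set (gE0 G)"
    "\<forall>s\<in>limit_class z. \<forall>t\<in>limit_class w. (\<lambda>i. anorm A (vdiff A (fs_ip A X Y (s i) (t i)) a)) \<longlonglongrightarrow> 0" for a
  proof -
    obtain s t where st: "s \<in> limit_class z" "t \<in> limit_class w"
      using limit_class_nonempty z w by blast
    then have fs: "\<And>i. fs_ip A X Y (s i) (t i) \<in> C0_set (gE0 G)"
      by (auto simp: limit_class_def converges_def fs_ip_eq intro!: graph_ip_C0 eval_fsum_closed)
    have d: "cmod (a v - graph_ip G z w v) \<le> 0" for v
    proof (rule tendsto_lowerbound)
      show "(\<lambda>i. C0_norm (\<lambda>v. fs_ip A X Y (s i) (t i) v - a v)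
          + C0_norm (\<lambda>v. fs_ip A X Y (s i) (t i) v - graph_ip G z w v)) \<longlonglongrightarrow> 0"
        using tendsto_add[OF a(2)[rule_format, OF st] lim[OF st]] by (simp add: vdiff_def)
      have "cmod (a v - graph_ip G z w v) \<le> C0_norm (\<lambda>v. fs_ip A X Y (s i) (t i) v - a v)
          + C0_norm (\<lambda>v. fs_ip A X Y (s i) (t i) v - graph_ip G z w v)" for i
      proof -
        have up: "cmod (fs_ip A X Y (s i) (t i) v - b v) \<le> C0_norm (\<lambda>v. fs_ip A X Y (s i) (t i) v - b v)"
          if "b \<in> C0_set (gE0 G)" for b
          using C0_norm_upper[OF C0_set_add[OF fs[of i] C0_set_scale[OF that, of "-1"]], of v] by simp
        show ?thesis
          using up[OF a(1)] up[OF graph_ip_C0[OF z w]]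
            norm_triangle_ineq4[of "fs_ip A X Y (s i) (t i) v - graph_ip G z w v" "fs_ip A X Y (s i) (t i) v - a v"]
          by simp
      qed
      then show "\<forall>\<^sub>F i in sequentially. cmod (a v - graph_ip G z w v) \<le> C0_norm (\<lambda>v. fs_ip A X Y (s i) (t i) v - a v)
          + C0_norm (\<lambda>v. fs_ip A X Y (s i) (t i) v - graph_ip G z w v)"
        by (rule always_eventually[OF allI])
    qed simp
    then show ?thesis by (simp add: fun_eq_iff)
  qed
  have "(THE a. a \<in> vcarrier A \<and> (\<forall>s\<in>limit_class z. \<forall>t\<in>limit_class w.
      (\<lambda>i. anorm A (vdiff A (fs_ip A X Y (s i) (t i)) a)) \<longlonglongrightarrow> 0)) = graph_ip G z w"
  proof (rule the_equality)
    show "graph_ip G z w \<in> vcarrier A \<and> (\<forall>s\<in>limit_class z. \<forall>t\<in>limit_class w.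
        (\<lambda>i. anorm A (vdiff A (fs_ip A X Y (s i) (t i)) (graph_ip G z w))) \<longlonglongrightarrow> 0)"
      using lim graph_ip_C0[OF z w] by (intro conjI ballI) (simp only: C0_sel)
  qed (elim conjE, rule uniq, simp_all only: C0_sel)
  then show ?thesis
    unfolding tensor_def by (simp only: corr.select_convs)
qed

text \<open>F is the inverse of \<open>limit_class\<close>, through which all operations have been
  computed. An elementary tensor is the class of a constant sequence, whose limit is the value of
  \<open>mul\<close>.\<close>

theorem corr_iso_tensor:
  "\<exists>F. corr_iso A (tensor A X Y) Z F \<and>
     (\<forall>x\<in>vcarrier X. \<forall>y\<in>vcarrier Y. F (elem_tensor A X Y x y) = mul x y)"
proof (intro exI conjI ballI)
  let ?F = "the_inv_into (vcarrier Z) limit_class"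
  have F: "?F (limit_class z) = z" if "z \<in> vcarrier Z" for z
    using that inj_on_limit_class by (rule the_inv_into_f_f[rotated])
  have "bij_betw ?F (vcarrier (tensor A X Y)) (vcarrier Z)"
    unfolding tensor_carrier
    using inj_on_limit_class by (intro bij_betw_the_inv_into) (simp add: bij_betw_def)
  then show "corr_iso A (tensor A X Y) Z ?F"
    unfolding corr_iso_def
    by (auto simp: tensor_carrier tensor_add tensor_scale tensor_ip tensor_ract tensor_lact F
        carrier_add carrier_scale carrier_ract carrier_lact)
  fix x y assume xy: "x \<in> vcarrier X" "y \<in> vcarrier Y"
  have "graph_ip G (\<lambda>_. 0) (\<lambda>_. 0) = (\<lambda>_. 0)"
    by (auto simp: graph_ip_def fun_eq_iff)
  then have "mnorm (\<lambda>_. 0) = 0"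
    by (simp add: cnorm_def)
  with xy have "converges (\<lambda>_. [(x, y)]) (mul x y)"
    by (simp add: converges_def)
  then have "elem_tensor A X Y x y = limit_class (mul x y)"
    unfolding elem_tensor_def using xy by (intro fs_class_eq mul_closed)
  then show "?F (elem_tensor A X Y x y) = mul x y"
    using xy by (simp add: F mul_closed)
qed

end

section \<open>Composing local homeomorphisms\<close>

context hausdorff_graph
begin

text \<open>Dini's theorem, applied on the compact set where the dominating fibre sum is at least \<open>r\<close>.\<close>

lemma C0_summable_Dini:
  fixes D :: "nat \<Rightarrow> 'e \<Rightarrow> real"
  assumes h: "C0_summable E h"
    and cont: "\<And>n e. e \<in> V1 \<Longrightarrow> (D n \<longlongrightarrow> D n e) (nhdsin (gE1 E) e)"
    and D: "\<And>n e. e \<in> V1 \<Longrightarrow> 0 \<le> D n e \<and> D n e \<le> h e"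
    and mono: "\<And>m n e. e \<in> V1 \<Longrightarrow> m \<le> n \<Longrightarrow> D n e \<le> D m e"
    and lim: "\<And>e. e \<in> V1 \<Longrightarrow> (\<lambda>n. D n e) \<longlonglongrightarrow> 0"
    and r: "r > 0"
  obtains n where "\<And>v. fibre_sum E (D n) v < r"
proof -
  let ?Y = "gE0 E"
  have nD: "norm (D n e) \<le> h e" if "e \<in> V1" for n e
    using D[OF that] by simp
  have hs: "h summable_on graph_fibre E v" if "v \<in> topspace ?Y" for v
    using h that by (simp add: C0_summable_def)
  have Ds: "D n summable_on graph_fibre E v" if "v \<in> topspace ?Y" for n v
    using C0_summable_summable_on[OF h that nD] .
  have mono': "fibre_sum E (D n) v \<le> fibre_sum E (D m) v" if "m \<le> n" for m n v
    using Ds mono that by (auto simp: fibre_sum_def graph_fibre_def intro!: infsum_mono)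
  \<comment> \<open>Off a finite part S of the fibre the sum of \<open>D n\<close> is at most the
    tail of h, hence at most r/2 for all n at once; on S the finite sum tends to 0.\<close>
  have ptw: "\<exists>n. fibre_sum E (D n) v < r" if v: "v \<in> topspace ?Y" for v
  proof -
    obtain S where S: "finite S" "S \<subseteq> graph_fibre E v"
      "dist (sum h S) (infsum h (graph_fibre E v)) \<le> r / 2"
      using infsum_finite_approximation[OF hs[OF v], of "r/2"] r by auto
    have "(\<lambda>n. \<Sum>e\<in>S. D n e) \<longlonglongrightarrow> (\<Sum>e\<in>S. 0)"
      using S lim by (intro tendsto_sum) (auto simp: graph_fibre_def)
    then have "\<forall>\<^sub>F n in sequentially. (\<Sum>e\<in>S. D n e) < r / 2"
      using r by (intro order_tendstoD(2)[of _ 0]) auto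
    then obtain n where n: "(\<Sum>e\<in>S. D n e) < r / 2"
      using eventually_happens' sequentially_bot by blast
    have "norm (infsum (D n) (graph_fibre E v) - sum (D n) S) \<le> infsum h (graph_fibre E v) - sum h S"
      using S nD by (intro norm_infsum_tail_le hs v) (auto simp: graph_fibre_def)
    with n S(3)[unfolded dist_real_def abs_le_iff] v show ?thesis
      by (intro exI[of _ n]) (simp add: fibre_sum_def abs_le_iff)
  qed
  have local: "\<exists>n V. openin ?Y V \<and> v \<in> V \<and> (\<forall>w\<in>V. fibre_sum E (D n) w < r)" if v: "v \<in> topspace ?Y" for v
  proof -
    obtain n where n: "fibre_sum E (D n) v < r" using ptw[OF v] by blast
    have "(fibre_sum E (D n) \<longlongrightarrow> fibre_sum E (D n) v) (nhdsin ?Y v)"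
      using nD cont by (intro C0_summable_tendsto[OF h v]) (auto simp: graph_fibre_def)
    then have "\<forall>\<^sub>F w in nhdsin ?Y v. fibre_sum E (D n) w < r"
      using n by (rule order_tendstoD(2))
    then show ?thesis
      using v unfolding eventually_nhdsin by blast
  qed
  define C where "C = {v \<in> topspace ?Y. r \<le> cmod (complex_of_real (fibre_sum E h v))}"
  have "compactin ?Y C"
    unfolding C_def using h r by (intro C0_set_compactin) (simp_all add: C0_summable_def)
  have "\<forall>v\<in>C. \<exists>nV. openin ?Y (snd nV) \<and> v \<in> snd nV \<and> (\<forall>w\<in>snd nV. fibre_sum E (D (fst nV)) w < r)"
    using local by (auto simp: C_def)
  from bchoice[OF this] obtain nV where
    nV: "\<forall>v\<in>C. openin ?Y (snd (nV v)) \<and> v \<in> snd (nV v) \<and> (\<forall>w\<in>snd (nV v). fibre_sum E (D (fst (nV v))) w < r)"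
    ..
  have "\<exists>\<F>. finite \<F> \<and> \<F> \<subseteq> (\<lambda>v. snd (nV v)) ` C \<and> C \<subseteq> \<Union>\<F>"
    using nV by (intro compactinD[OF \<open>compactin ?Y C\<close>]) auto
  then obtain K where K: "finite K" "K \<subseteq> C" "C \<subseteq> (\<Union>v\<in>K. snd (nV v))"
    by (metis finite_subset_image)
  \<comment> \<open>The inserted 0 covers the case of an empty K.\<close>
  define n where "n = Max (insert 0 ((\<lambda>v. fst (nV v)) ` K))"
  have "fibre_sum E (D n) v < r" for v
  proof (cases "v \<in> C")
    case True
    then obtain w where w: "w \<in> K" "v \<in> snd (nV w)" using K by blast
    then have "fst (nV w) \<le> n"
      using K(1) by (auto simp: n_def)
    then have "fibre_sum E (D n) v \<le> fibre_sum E (D (fst (nV w))) v"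
      by (rule mono')
    also have "\<dots> < r" using nV w K by blast
    finally show ?thesis .
  next
    case False
    \<comment> \<open>Off C the fibre sum of the majorant is already below r.\<close>
    have "fibre_sum E (D n) v \<le> fibre_sum E h v"
      using norm_fibre_sum_le[where F = "D n" and v = v, OF h nD] by simp
    with False r show ?thesis
      by (cases "v \<in> topspace ?Y") (auto simp: C_def fibre_sum_def)
  qed
  then show ?thesis by (rule that)
qed

end

text \<open>The range map is a parameter because it will be \<open>shift 0\<close>, which is the
  identity on paths but not on the whole type.\<close>

definition lh_graph :: "'a topology \<Rightarrow> ('a \<Rightarrow> 'a) \<Rightarrow> ('a \<Rightarrow> 'a) \<Rightarrow> ('a, 'a) top_graph" where
  "lh_graph X r s = \<lparr>gE0 = X, gE1 = X, grng = r, gsrc = s\<rparr>"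

lemma lh_graph_sel [simp]:
  "gE0 (lh_graph X r s) = X" "gE1 (lh_graph X r s) = X" "grng (lh_graph X r s) = r" "gsrc (lh_graph X r s) = s"
  by (simp_all add: lh_graph_def)

lemma graph_fibre_lh_graph [simp]: "graph_fibre (lh_graph X r s) v = {x \<in> topspace X. s x = v}"
  by (simp add: graph_fibre_def)

lemma hausdorff_graph_lh_graph:
  assumes "Hausdorff_space X" "\<And>x. x \<in> topspace X \<Longrightarrow> r x = x" "local_homeomorphism X X s"
  shows "hausdorff_graph (lh_graph X r s)"
proof
  have "continuous_map X X r"
    using continuous_map_id by (rule continuous_map_eq) (simp add: assms(2))
  then show "continuous_map (gE1 (lh_graph X r s)) (gE0 (lh_graph X r s)) (grng (lh_graph X r s))"
    by simp
qed (use assms in simp_all)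

text \<open>To be read with S, T, R the shifts by m, n, m + n and \<omega> the cocycle factor. For a
  single pair of degrees only continuity and modulus 1 of \<omega> enter; the cocycle identity
  concerns associativity.\<close>

locale composed_local_homeomorphisms =
  fixes X :: "'a topology" and r S T R :: "'a \<Rightarrow> 'a" and \<omega> :: "'a \<Rightarrow> complex"
  assumes X: "Hausdorff_space X"
    and r: "x \<in> topspace X \<Longrightarrow> r x = x"
    and S: "local_homeomorphism X X S" and T: "local_homeomorphism X X T"
    and R: "local_homeomorphism X X R"
    and RTS: "x \<in> topspace X \<Longrightarrow> R x = T (S x)"
    and \<omega>: "continuous_map X euclidean \<omega>" "x \<in> topspace X \<Longrightarrow> cmod (\<omega> x) = 1"
begin

abbreviation ES where "ES \<equiv> lh_graph X r S"
abbreviation ET where "ET \<equiv> lh_graph X r T"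
abbreviation ER where "ER \<equiv> lh_graph X r R"

sublocale S: hausdorff_graph ES
  using X r S by (rule hausdorff_graph_lh_graph)

sublocale T: hausdorff_graph ET
  using X r T by (rule hausdorff_graph_lh_graph)

sublocale R: hausdorff_graph ER
  using X r R by (rule hausdorff_graph_lh_graph)

abbreviation XS where "XS \<equiv> graph_corr ES"
abbreviation XT where "XT \<equiv> graph_corr ET"
abbreviation XR where "XR \<equiv> graph_corr ER"

lemma S_in: "x \<in> topspace X \<Longrightarrow> S x \<in> topspace X"
  and T_in: "x \<in> topspace X \<Longrightarrow> T x \<in> topspace X"
  using S T by (auto dest: local_homeomorphism_tendsto(2))

lemma tendsto_S: "x \<in> topspace X \<Longrightarrow> (f \<longlongrightarrow> l) (nhdsin X (S x)) \<Longrightarrow> ((\<lambda>x. f (S x)) \<longlongrightarrow> l) (nhdsin X x)"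
  using filterlim_compose[OF _ local_homeomorphism_tendsto(1)[OF S]] by blast

text \<open>The fibre of R over v is the disjoint union of the fibres of S over the points of the
  fibre of T. Fubini for fibre sums rests on this bijection.\<close>

lemma fibre_bij:
  "bij_betw snd (SIGMA y:{y \<in> topspace X. T y = v}. {x \<in> topspace X. S x = y}) {x \<in> topspace X. R x = v}"
  by (rule bij_betwI[of _ _ _ "\<lambda>x. (S x, x)"]) (auto simp: RTS S_in)

lemma fibre_infsum:
  fixes F :: "'a \<Rightarrow> 'b::banach"
  assumes "F summable_on {x \<in> topspace X. R x = v}"
  shows "infsum F {x \<in> topspace X. R x = v}
    = (\<Sum>\<^sub>\<infinity>y\<in>{y \<in> topspace X. T y = v}. infsum F {x \<in> topspace X. S x = y})"
proof -
  have "(\<lambda>p. F (snd p)) summable_on (SIGMA y:{y \<in> topspace X. T y = v}. {x \<in> topspace X. S x = y})"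
    using assms summable_on_reindex_bij_betw[OF fibre_bij, of F v] by simp
  from infsum_Sigma_banach[OF this] show ?thesis
    using infsum_reindex_bij_betw[OF fibre_bij, of F v] by simp
qed

text \<open>Tonelli's theorem: for nonnegative h, summability of the iterated sums implies
  summability on the union of the fibres.\<close>

lemma fibre_summable:
  fixes h :: "'a \<Rightarrow> real"
  assumes "\<And>y. y \<in> topspace X \<Longrightarrow> h summable_on {x \<in> topspace X. S x = y}"
    and "(\<lambda>y. infsum h {x \<in> topspace X. S x = y}) summable_on {y \<in> topspace X. T y = v}"
    and "\<And>x. x \<in> topspace X \<Longrightarrow> 0 \<le> h x"
  shows "h summable_on {x \<in> topspace X. R x = v}"
proof -
  have "(\<lambda>p. h (snd p)) summable_on (SIGMA y:{y \<in> topspace X. T y = v}. {x \<in> topspace X. S x = y})"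
    by (rule summable_on_SigmaI[OF _ assms(2)]) (use assms in auto)
  then show ?thesis
    using summable_on_reindex_bij_betw[OF fibre_bij, of h v] by simp
qed

lemma fibre_summableD:
  fixes F :: "'a \<Rightarrow> 'b::banach"
  assumes "\<And>v. v \<in> topspace X \<Longrightarrow> F summable_on {x \<in> topspace X. R x = v}" "y \<in> topspace X"
  shows "F summable_on {x \<in> topspace X. S x = y}"
proof (rule summable_on_subset_banach[OF assms(1)[OF T_in[OF assms(2)]]])
  show "{x \<in> topspace X. S x = y} \<subseteq> {x \<in> topspace X. R x = T y}"
    by (auto simp: RTS)
qed

lemma fibre_summable_outer:
  fixes F :: "'a \<Rightarrow> 'b::banach"
  assumes "F summable_on {x \<in> topspace X. R x = v}"
  shows "(\<lambda>y. infsum F {x \<in> topspace X. S x = y}) summable_on {y \<in> topspace X. T y = v}"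
proof -
  have "(\<lambda>p. F (snd p)) summable_on (SIGMA y:{y \<in> topspace X. T y = v}. {x \<in> topspace X. S x = y})"
    using assms summable_on_reindex_bij_betw[OF fibre_bij, of F v] by simp
  from summable_on_Sigma_banach[of "\<lambda>_. F"] this show ?thesis
    by (simp add: case_prod_beta')
qed

section \<open>Multiplication twisted by a unimodular function: well-definedness, isometry and
  density\<close>

definition twisted_mult :: "('a \<Rightarrow> complex) \<Rightarrow> ('a \<Rightarrow> complex) \<Rightarrow> 'a \<Rightarrow> complex" where
  "twisted_mult f g x = \<omega> x * f x * g (S x)"

text \<open>By Tonelli the sum of |f|^2 |g o S|^2 over a fibre of R is the sum of k |g|^2 over the
  fibre of T, where k = <f, f> is bounded. Hence a multiple of |g|^2 is a majorant along T.\<close>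

lemma twisted_mult_carrier:
  assumes f: "f \<in> vcarrier XS" and g: "g \<in> vcarrier XT"
  shows "twisted_mult f g \<in> vcarrier XR"
proof -
  define k where "k = (\<lambda>y. fibre_sum ES (\<lambda>x. (cmod (f x))\<^sup>2) y)"
  define h where "h = (\<lambda>x. (cmod (f x))\<^sup>2 * (cmod (g (S x)))\<^sup>2)"
  have kC: "(\<lambda>y. complex_of_real (k y)) \<in> C0_set X"
    using S.carrier_C0_summable[OF f] by (simp add: C0_summable_def k_def)
  obtain B where B: "B \<ge> 0" "\<And>y. cmod (complex_of_real (k y)) \<le> B"
    using C0_set_bounded[OF kC] by blast
  have k0: "0 \<le> k y" for y
    by (simp add: k_def fibre_sum_nonneg)
  have kc: "(k \<longlongrightarrow> k y) (nhdsin X y)" if "y \<in> topspace X" for y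
    using tendsto_Re[OF C0_set_tendsto[OF kC that]] by simp
  have gc: "(g \<longlongrightarrow> g y) (nhdsin X y)" if "y \<in> topspace X" for y
    using T.carrier_tendsto[OF g] that by simp
  have fc: "(f \<longlongrightarrow> f y) (nhdsin X y)" if "y \<in> topspace X" for y
    using S.carrier_tendsto[OF f] that by simp
  have gS: "((\<lambda>x. g (S x)) \<longlongrightarrow> g (S x)) (nhdsin X x)" if "x \<in> topspace X" for x
    using that by (intro tendsto_S gc S_in)
  have kg: "C0_summable ET (\<lambda>y. k y * (cmod (g y))\<^sup>2)"
  proof (rule T.C0_summable_dominated)
    show "C0_summable ET (\<lambda>y. B * (cmod (g y))\<^sup>2)"
      by (intro T.C0_summable_cmult T.carrier_C0_summable g B)
    show "0 \<le> k y * (cmod (g y))\<^sup>2 \<and> k y * (cmod (g y))\<^sup>2 \<le> B * (cmod (g y))\<^sup>2" for y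
      using B(2)[of y] k0[of y] by (auto intro!: mult_right_mono)
    show "((\<lambda>y. k y * (cmod (g y))\<^sup>2) \<longlongrightarrow> k y * (cmod (g y))\<^sup>2) (nhdsin (gE1 ET) y)"
      if "y \<in> topspace (gE1 ET)" for y
      using that by (auto intro!: tendsto_intros kc gc)
  qed
  have fs: "(\<lambda>x. (cmod (f x))\<^sup>2) summable_on {x \<in> topspace X. S x = y}" if "y \<in> topspace X" for y
    using S.carrier_l2_summable[OF f, of y] that by simp
  have heq: "h summable_on {x \<in> topspace X. S x = y}"
    "infsum h {x \<in> topspace X. S x = y} = k y * (cmod (g y))\<^sup>2" if "y \<in> topspace X" for y
  proof -
    have "h summable_on {x \<in> topspace X. S x = y} \<longleftrightarrow>
        (\<lambda>x. (cmod (f x))\<^sup>2 * (cmod (g y))\<^sup>2) summable_on {x \<in> topspace X. S x = y}"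
      by (rule summable_on_cong) (auto simp: h_def)
    then show "h summable_on {x \<in> topspace X. S x = y}"
      using fs[OF that] by (simp add: summable_on_cmult_left)
    have "infsum h {x \<in> topspace X. S x = y} = (\<Sum>\<^sub>\<infinity>x\<in>{x \<in> topspace X. S x = y}. (cmod (f x))\<^sup>2 * (cmod (g y))\<^sup>2)"
      by (rule infsum_cong) (auto simp: h_def)
    then show "infsum h {x \<in> topspace X. S x = y} = k y * (cmod (g y))\<^sup>2"
      using that by (simp add: infsum_cmult_left' k_def fibre_sum_def)
  qed
  have out: "(\<lambda>y. infsum h {x \<in> topspace X. S x = y}) summable_on {y \<in> topspace X. T y = v}
      \<longleftrightarrow> (\<lambda>y. k y * (cmod (g y))\<^sup>2) summable_on {y \<in> topspace X. T y = v}" for v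
    by (rule summable_on_cong) (simp add: heq)
  have hs: "h summable_on {x \<in> topspace X. R x = v}" if "v \<in> topspace X" for v
  proof (rule fibre_summable[OF heq(1)])
    show "(\<lambda>y. infsum h {x \<in> topspace X. S x = y}) summable_on {y \<in> topspace X. T y = v}"
      using kg that by (simp add: out C0_summable_def)
  qed (simp_all add: h_def)
  have "fibre_sum ER h v = fibre_sum ET (\<lambda>y. k y * (cmod (g y))\<^sup>2) v" for v
    using hs by (auto simp: fibre_sum_def fibre_infsum heq intro!: infsum_cong)
  then have hC: "C0_summable ER h"
    using kg hs by (auto simp: C0_summable_def h_def S_in intro!: tendsto_intros fc gS)
  show ?thesis
  proof (rule R.carrier_dominatedI[OF _ _ hC])
    show "twisted_mult f g x = 0" if "x \<notin> topspace (gE1 ER)" for x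
      using S.carrier_outside[OF f] that by (simp add: twisted_mult_def)
    show "(twisted_mult f g \<longlongrightarrow> twisted_mult f g x) (nhdsin (gE1 ER) x)"
      if "x \<in> topspace (gE1 ER)" for x
      using that unfolding twisted_mult_def[abs_def]
      by (auto intro!: tendsto_mult fc gS continuous_map_tendsto_nhdsin[OF \<omega>(1)] S_in)
    show "(cmod (twisted_mult f g x))\<^sup>2 \<le> h x" if "x \<in> topspace (gE1 ER)" for x
      using \<omega>(2) that by (simp add: twisted_mult_def h_def norm_mult power_mult_distrib)
  qed
qed

lemma twisted_mult_ip:
  assumes f: "f \<in> vcarrier XS" and g: "g \<in> vcarrier XT" and f': "f' \<in> vcarrier XS" and g': "g' \<in> vcarrier XT"
  shows "graph_ip ER (twisted_mult f g) (twisted_mult f' g')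
    = graph_ip ET g (\<lambda>y. graph_ip ES f f' (r y) * g' y)"
proof
  fix v
  let ?F = "\<lambda>x. cnj (twisted_mult f g x) * twisted_mult f' g' x"
  show "graph_ip ER (twisted_mult f g) (twisted_mult f' g') v
    = graph_ip ET g (\<lambda>y. graph_ip ES f f' (r y) * g' y) v"
  proof (cases "v \<in> topspace X")
    case True
    have "?F summable_on {x \<in> topspace X. R x = v}"
      using R.graph_ip_summable[OF twisted_mult_carrier[OF f g] twisted_mult_carrier[OF f' g'], of v] True by simp
    then have "graph_ip ER (twisted_mult f g) (twisted_mult f' g') v
        = (\<Sum>\<^sub>\<infinity>y\<in>{y \<in> topspace X. T y = v}. infsum ?F {x \<in> topspace X. S x = y})"
      using True by (simp add: graph_ip_def fibre_infsum)
    also have "\<dots> = (\<Sum>\<^sub>\<infinity>y\<in>{y \<in> topspace X. T y = v}. cnj (g y) * (graph_ip ES f f' (r y) * g' y))"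
    proof (rule infsum_cong)
      fix y assume y: "y \<in> {y \<in> topspace X. T y = v}"
      have "?F x = cnj (f x) * f' x * (cnj (g y) * g' y)" if "x \<in> {x \<in> topspace X. S x = y}" for x
      proof -
        have "cnj (\<omega> x) * \<omega> x = 1"
          using \<omega>(2) that by (simp add: cnj_mult_self)
        then have "?F x = (cnj (\<omega> x) * \<omega> x) * (cnj (f x) * f' x * (cnj (g y) * g' y))"
          using that by (simp add: twisted_mult_def mult_ac)
        then show ?thesis
          using \<open>cnj (\<omega> x) * \<omega> x = 1\<close> by simp
      qed
      then have "infsum ?F {x \<in> topspace X. S x = y}
          = (\<Sum>\<^sub>\<infinity>x\<in>{x \<in> topspace X. S x = y}. cnj (f x) * f' x * (cnj (g y) * g' y))"
        by (rule infsum_cong)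
      also have "\<dots> = (\<Sum>\<^sub>\<infinity>x\<in>{x \<in> topspace X. S x = y}. cnj (f x) * f' x) * (cnj (g y) * g' y)"
        by (rule infsum_cmult_left')
      finally show "infsum ?F {x \<in> topspace X. S x = y} = cnj (g y) * (graph_ip ES f f' (r y) * g' y)"
        using y by (simp add: graph_ip_def r)
    qed
    finally show ?thesis
      using True by (simp add: graph_ip_def)
  qed (simp add: graph_ip_def)
qed

text \<open>The majorant is given along R, whereas continuity is wanted along S. On an open N around
  y0 where T is injective, the fibre of S over y is the part of the fibre of R over
  \<open>T y\<close> that S maps into N. So the sum equals the R-fibre sum at \<open>T y\<close> of
  the truncation F of h, and h dominates F.\<close>

lemma fibre_sum_S_continuous:
  assumes h: "C0_summable ER h" and y0: "y0 \<in> topspace X"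
  shows "(fibre_sum ES h \<longlongrightarrow> fibre_sum ES h y0) (nhdsin X y0)"
proof -
  obtain N where N: "openin X N" "y0 \<in> N" "openin X (T ` N)"
    "homeomorphic_map (subtopology X N) (subtopology X (T ` N)) T"
    using T y0 unfolding local_homeomorphism_def by blast
  have NX: "N \<subseteq> topspace X" using N(1) openin_subset by blast
  have inj: "inj_on T N"
    using N(4) NX by (simp add: homeomorphic_eq_everything_map Int_absorb1)
  have open_image: "openin X (T ` (B \<inter> N))" if "openin X B" for B
  proof -
    have "openin (subtopology X N) (B \<inter> N)"
      using that by (auto simp: openin_subtopology)
    then have "openin (subtopology X (T ` N)) (T ` (B \<inter> N))"
      using N(4) by (auto simp: homeomorphic_eq_everything_map open_map_def)
    then show ?thesis
      using N(3) openin_open_subtopology by blast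
  qed
  define F where "F = (\<lambda>x. if S x \<in> N then h x else 0)"
  have hc: "(h \<longlongrightarrow> h x) (nhdsin X x)" and h0: "0 \<le> h x" if "x \<in> topspace X" for x
    using h that by (auto simp: C0_summable_def)
  \<comment> \<open>F may jump over the boundary of N, but not on the R-fibre over
    \<open>T y0\<close>. Where \<open>S x = y0\<close>, F agrees with h nearby. Otherwise S x and y0
    have disjoint neighbourhoods A and B; near x, R takes values in \<open>T (B \<inter> N)\<close>
    and S in A, so by injectivity of T on N no such value of S lies in N, and F vanishes.\<close>
  have Fc: "(F \<longlongrightarrow> F x) (nhdsin X x)" if x: "x \<in> topspace X" "R x = T y0" for x
  proof (cases "S x = y0")
    case True
    have "\<forall>\<^sub>F x' in nhdsin X x. S x' \<in> N"
      using local_homeomorphism_tendsto(1)[OF S x(1)] eventually_nhdsin_openin[OF N(1), of "S x"] True N(2)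
      unfolding filterlim_iff by blast
    then have "\<forall>\<^sub>F x' in nhdsin X x. h x' = F x'"
      by eventually_elim (simp add: F_def)
    then have "(F \<longlongrightarrow> h x) (nhdsin X x)"
      using hc[OF x(1)] by (rule Lim_transform_eventually[rotated])
    then show ?thesis using True N(2) by (simp add: F_def)
  next
    case False
    obtain A B where AB: "openin X A" "openin X B" "S x \<in> A" "y0 \<in> B" "disjnt A B"
      using X S_in[OF x(1)] y0 False unfolding Hausdorff_space_def by meson
    have "\<forall>\<^sub>F x' in nhdsin X x. S x' \<in> A"
      using local_homeomorphism_tendsto(1)[OF S x(1)] eventually_nhdsin_openin[OF AB(1) AB(3)]
      unfolding filterlim_iff by blast
    moreover have "\<forall>\<^sub>F z in nhdsin X (R x). z \<in> T ` (B \<inter> N)"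
      using x(2) N(2) AB by (intro eventually_nhdsin_openin open_image) auto
    then have "\<forall>\<^sub>F x' in nhdsin X x. R x' \<in> T ` (B \<inter> N)"
      using local_homeomorphism_tendsto(1)[OF R x(1)] unfolding filterlim_iff by blast
    ultimately have "\<forall>\<^sub>F x' in nhdsin X x. F x' = 0"
      using eventually_nhdsin_topspace[of X x]
    proof eventually_elim
      case (elim x')
      then obtain b where b: "b \<in> B" "b \<in> N" "T (S x') = T b"
        by (auto simp: RTS)
      have "S x' \<notin> N"
      proof
        assume "S x' \<in> N"
        with b inj have "S x' = b" by (auto dest: inj_onD)
        with b elim AB(5) show False by (auto simp: disjnt_def)
      qed
      then show ?case by (simp add: F_def)
    qed
    moreover from this have "F x = 0"
      using x(1) by (rule eventually_nhdsin_self)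
    ultimately show ?thesis
      by (simp add: tendsto_eventually)
  qed
  have lim: "(fibre_sum ER F \<longlongrightarrow> fibre_sum ER F (T y0)) (nhdsin X (T y0))"
    using R.C0_summable_tendsto[OF h, of "T y0" F] Fc h0 T_in[OF y0] by (auto simp: F_def)
  have eq: "fibre_sum ES h y = fibre_sum ER F (T y)" if y: "y \<in> N" for y
  proof -
    have "S x = y" if "x \<in> topspace X" "R x = T y" "S x \<in> N" for x
      using that y inj by (auto simp: RTS dest: inj_onD)
    then have "infsum h {x \<in> topspace X. S x = y} = infsum F {x \<in> topspace X. R x = T y}"
      using y by (intro infsum_cong_neutral) (auto simp: F_def RTS)
    then show ?thesis
      using y NX T_in by (auto simp: fibre_sum_def)
  qed
  have "((\<lambda>y. fibre_sum ER F (T y)) \<longlongrightarrow> fibre_sum ER F (T y0)) (nhdsin X y0)"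
    using lim local_homeomorphism_tendsto(1)[OF T y0] by (rule filterlim_compose)
  moreover have "\<forall>\<^sub>F y in nhdsin X y0. fibre_sum ER F (T y) = fibre_sum ES h y"
    using eventually_nhdsin_openin[OF N(1,2)] by eventually_elim (simp add: eq)
  ultimately show ?thesis
    using eq[OF N(2)] Lim_transform_eventually by force
qed

text \<open>With \<open>k\<close> the sum of \<open>|h|\<^sup>2\<close> over the fibres of \<open>S\<close>, the polar decomposition of \<open>h\<close> would be
  \<open>h = (h / sqrt k \<circ> S) (sqrt k \<circ> S)\<close>. The first factor is made continuous by a regularisation
  at the zeros of \<open>k\<close>.\<close>

lemma twisted_mult_dense:
  assumes h: "h \<in> vcarrier XR" and \<delta>: "\<delta> > 0"
  obtains f g where "f \<in> vcarrier XS" "g \<in> vcarrier XT" "R.mnorm (\<lambda>x. twisted_mult f g x - h x) < \<delta>"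
proof -
  define k where "k = fibre_sum ES (\<lambda>x. (cmod (h x))\<^sup>2)"
  have hR: "C0_summable ER (\<lambda>x. (cmod (h x))\<^sup>2)"
    using R.carrier_C0_summable[OF h] .
  have hc: "(h \<longlongrightarrow> h x) (nhdsin X x)" if "x \<in> topspace X" for x
    using R.carrier_tendsto[OF h] that by simp
  have hout: "h x = 0" if "x \<notin> topspace X" for x
    using R.carrier_outside[OF h] that by simp
  have hsR: "(\<lambda>x. (cmod (h x))\<^sup>2) summable_on {x \<in> topspace X. R x = v}" if "v \<in> topspace X" for v
    using R.carrier_l2_summable[OF h, of v] that by simp
  have hsS: "(\<lambda>x. (cmod (h x))\<^sup>2) summable_on {x \<in> topspace X. S x = y}" if "y \<in> topspace X" for y
    using fibre_summableD[OF hsR that] .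
  have k0: "0 \<le> k y" for y
    by (simp add: k_def fibre_sum_nonneg)
  have kc: "(k \<longlongrightarrow> k y) (nhdsin X y)" if "y \<in> topspace X" for y
    unfolding k_def using hR that by (rule fibre_sum_S_continuous)
  have kout: "k y = 0" if "y \<notin> topspace X" for y
    using that by (simp add: k_def fibre_sum_def)
  have keq: "k y = infsum (\<lambda>x. (cmod (h x))\<^sup>2) {x \<in> topspace X. S x = y}" if "y \<in> topspace X" for y
    using that by (simp add: k_def fibre_sum_def)
  have ks: "k summable_on {y \<in> topspace X. T y = v}" if "v \<in> topspace X" for v
  proof -
    have "k summable_on {y \<in> topspace X. T y = v} \<longleftrightarrow>
        (\<lambda>y. infsum (\<lambda>x. (cmod (h x))\<^sup>2) {x \<in> topspace X. S x = y}) summable_on {y \<in> topspace X. T y = v}"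
      by (rule summable_on_cong) (simp add: keq)
    then show ?thesis using fibre_summable_outer[OF hsR[OF that]] by simp
  qed
  \<comment> \<open>By Fubini, k summed along T gives back the R-fibre sum of |h|^2, which lies in
    C_0.\<close>
  have "fibre_sum ET k v = fibre_sum ER (\<lambda>x. (cmod (h x))\<^sup>2) v" for v
    using hsR by (auto simp: fibre_sum_def fibre_infsum keq intro!: infsum_cong)
  then have kT: "C0_summable ET k"
    using hR ks kc k0 by (auto simp: C0_summable_def)
  \<comment> \<open>A function with C_0 fibre sums along T vanishes at infinity itself; this is
    required for the fibre sums of |f|^2 along S.\<close>
  have kC: "(\<lambda>y. complex_of_real (k y)) \<in> C0_set X"
    using T.C0_summable_imp_C0[OF kT] kout by simp
  define g where "g = (\<lambda>y. complex_of_real (sqrt (k y)))"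
  \<comment> \<open>The conjugate of \<omega> cancels the twist. The factor sqrt k / (k +
    \<epsilon>) approximates 1 / sqrt k and is continuous also where k vanishes.\<close>
  define f where "f = (\<lambda>\<epsilon> x. cnj (\<omega> x) * h x * complex_of_real (sqrt (k (S x)) / (k (S x) + \<epsilon>)))"
  have g: "g \<in> vcarrier XT"
    unfolding graph_corr_carrier_iff g_def
    using kT k0 kc by (auto intro!: tendsto_intros simp: kout)
  have f: "f \<epsilon> \<in> vcarrier XS" if \<epsilon>: "\<epsilon> > 0" for \<epsilon>
  proof -
    have pos: "k y + \<epsilon> > 0" for y using k0[of y] \<epsilon> by simp
    have kS: "((\<lambda>x. k (S x)) \<longlongrightarrow> k (S x)) (nhdsin X x)" if "x \<in> topspace X" for x
      using that by (intro tendsto_S kc S_in)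
    have fc: "(f \<epsilon> \<longlongrightarrow> f \<epsilon> x) (nhdsin X x)" if "x \<in> topspace X" for x
      unfolding f_def
      using that pos[of "S x"] by (intro tendsto_intros hc kS continuous_map_tendsto_nhdsin[OF \<omega>(1)]) auto
    have f2: "(cmod (f \<epsilon> x))\<^sup>2 = (cmod (h x))\<^sup>2 * (k y / (k y + \<epsilon>)\<^sup>2)" if "x \<in> topspace X" "S x = y" for x y
      using \<omega>(2)[OF that(1)] that k0[of y] 
      by (simp add: f_def norm_mult power_mult_distrib power_divide del: of_real_divide of_real_add)
    have fs: "(\<lambda>x. (cmod (f \<epsilon> x))\<^sup>2) summable_on {x \<in> topspace X. S x = y}"
      "infsum (\<lambda>x. (cmod (f \<epsilon> x))\<^sup>2) {x \<in> topspace X. S x = y} = k y * (k y / (k y + \<epsilon>)\<^sup>2)"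
      if "y \<in> topspace X" for y
    proof -
      have "(\<lambda>x. (cmod (f \<epsilon> x))\<^sup>2) summable_on {x \<in> topspace X. S x = y} \<longleftrightarrow>
          (\<lambda>x. (cmod (h x))\<^sup>2 * (k y / (k y + \<epsilon>)\<^sup>2)) summable_on {x \<in> topspace X. S x = y}"
        by (rule summable_on_cong) (simp add: f2)
      then show "(\<lambda>x. (cmod (f \<epsilon> x))\<^sup>2) summable_on {x \<in> topspace X. S x = y}"
        using summable_on_cmult_left[OF hsS[OF that]] by blast
      have "infsum (\<lambda>x. (cmod (f \<epsilon> x))\<^sup>2) {x \<in> topspace X. S x = y}
          = infsum (\<lambda>x. (cmod (h x))\<^sup>2 * (k y / (k y + \<epsilon>)\<^sup>2)) {x \<in> topspace X. S x = y}"
        by (rule infsum_cong) (simp add: f2)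
      then show "infsum (\<lambda>x. (cmod (f \<epsilon> x))\<^sup>2) {x \<in> topspace X. S x = y} = k y * (k y / (k y + \<epsilon>)\<^sup>2)"
        by (simp only: infsum_cmult_left' keq[OF that])
    qed
    have "(\<lambda>y. complex_of_real (k y * (k y / (k y + \<epsilon>)\<^sup>2))) \<in> C0_set X"
    proof (rule C0_set_dominated)
      \<comment> \<open>The constant comes from k / (k + \<epsilon>) <= 1 and 1 / (k + \<epsilon>)
        <= 1 / \<epsilon>.\<close>
      show "(\<lambda>y. complex_of_real (1 / \<epsilon>) * complex_of_real (k y)) \<in> C0_set X"
        by (rule C0_set_scale[OF kC])
      show "((\<lambda>y. complex_of_real (k y * (k y / (k y + \<epsilon>)\<^sup>2))) \<longlongrightarrow>
          complex_of_real (k y * (k y / (k y + \<epsilon>)\<^sup>2))) (nhdsin X y)" if "y \<in> topspace X" for y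
        using pos[of y] that by (intro tendsto_intros kc) auto
      show "cmod (complex_of_real (k y * (k y / (k y + \<epsilon>)\<^sup>2))) \<le> cmod (complex_of_real (1 / \<epsilon>) * complex_of_real (k y))" for y
      proof -
        have "k y / (k y + \<epsilon>)\<^sup>2 = (k y / (k y + \<epsilon>)) * (1 / (k y + \<epsilon>))"
          by (simp add: power2_eq_square)
        also have "\<dots> \<le> 1 * (1 / \<epsilon>)"
          using k0[of y] \<epsilon> pos[of y] by (intro mult_mono) (auto simp: frac_le)
        finally have "k y * (k y / (k y + \<epsilon>)\<^sup>2) \<le> k y * (1 / \<epsilon>)"
          using k0[of y] by (intro mult_left_mono) auto
        moreover have "0 \<le> k y * (k y / (k y + \<epsilon>)\<^sup>2)"
          using k0[of y] by simp
        ultimately show ?thesis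
          using k0[of y] \<epsilon> by (simp only: norm_of_real norm_mult) (simp add: mult.commute)
      qed
    qed (simp add: kout)
    moreover have "fibre_sum ES (\<lambda>x. (cmod (f \<epsilon> x))\<^sup>2) y = k y * (k y / (k y + \<epsilon>)\<^sup>2)" for y
      by (cases "y \<in> topspace X") (simp_all add: fibre_sum_def fs(2) kout)
    ultimately have "C0_summable ES (\<lambda>x. (cmod (f \<epsilon> x))\<^sup>2)"
      using fs(1) fc by (auto simp: C0_summable_def intro!: tendsto_power tendsto_norm)
    moreover have "f \<epsilon> x = 0" if "x \<notin> topspace X" for x
      using hout[OF that] by (simp add: f_def)
    ultimately show ?thesis
      using fc by (simp add: graph_corr_carrier_iff)
  qed
  \<comment> \<open>Any positive sequence decreasing to 0 would serve; monotonicity is what Dini's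
    theorem requires.\<close>
  define \<epsilon> where "\<epsilon> = (\<lambda>n. inverse (real (Suc n)))"
  have \<epsilon>0: "\<epsilon> n > 0" for n by (simp add: \<epsilon>_def)
  \<comment> \<open>The squared error: the product equals h times k / (k + \<epsilon>) at S x, and
    this fraction differs from 1 by \<epsilon> / (k + \<epsilon>).\<close>
  define D where "D = (\<lambda>n x. (cmod (h x))\<^sup>2 * (\<epsilon> n / (k (S x) + \<epsilon> n))\<^sup>2)"
  have diff: "(cmod (twisted_mult (f (\<epsilon> n)) g x - h x))\<^sup>2 = D n x" if "x \<in> topspace X" for n x
  proof -
    have "\<omega> x * cnj (\<omega> x) = 1"
      using \<omega>(2)[OF that] cnj_mult_self[of "\<omega> x"] by (simp add: mult.commute)
    moreover have "complex_of_real (sqrt (k (S x))) * complex_of_real (sqrt (k (S x))) = complex_of_real (k (S x))"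
      using k0[of "S x"] by (simp flip: of_real_mult)
    moreover have "twisted_mult (f (\<epsilon> n)) g x = (\<omega> x * cnj (\<omega> x)) * h x *
        (complex_of_real (sqrt (k (S x))) * complex_of_real (sqrt (k (S x)))) / complex_of_real (k (S x) + \<epsilon> n)"
      by (simp add: twisted_mult_def f_def g_def)
    ultimately have "twisted_mult (f (\<epsilon> n)) g x - h x
        = h x * complex_of_real (k (S x) / (k (S x) + \<epsilon> n) - 1)"
      by (simp add: algebra_simps)
    moreover have "k (S x) / (k (S x) + \<epsilon> n) - 1 = - (\<epsilon> n / (k (S x) + \<epsilon> n))"
      using \<epsilon>0[of n] k0[of "S x"] by (simp add: field_simps)
    ultimately show ?thesis
      by (simp only: D_def norm_mult norm_of_real power_mult_distrib abs_minus_cancel power2_abs)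
  qed
  have frac: "0 \<le> \<epsilon> n / (k y + \<epsilon> n) \<and> \<epsilon> n / (k y + \<epsilon> n) \<le> 1" for n y
    using \<epsilon>0[of n] k0[of y] by (simp add: divide_le_eq_1)
  have "(\<delta>/2)\<^sup>2 > 0" using \<delta> by simp
  \<comment> \<open>Fibre sums below the square of \<delta>/2 give a norm of at most \<delta>/2,
    which is strictly below \<delta> after the supremum.\<close>
  then obtain n where n: "\<And>v. fibre_sum ER (D n) v < (\<delta>/2)\<^sup>2"
  proof (rule R.C0_summable_Dini[OF hR, rotated 4])
    show "(D n \<longlongrightarrow> D n x) (nhdsin (gE1 ER) x)" if "x \<in> topspace (gE1 ER)" for n x
    proof -
      have "((\<lambda>x. k (S x)) \<longlongrightarrow> k (S x)) (nhdsin X x)"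
        using that by (intro tendsto_S kc S_in) auto
      moreover have "k (S x) + \<epsilon> n \<noteq> 0"
        using \<epsilon>0[of n] k0[of "S x"] by simp
      ultimately show ?thesis
        using hc[of x] that unfolding D_def by (auto intro!: tendsto_intros)
    qed
    show "0 \<le> D n x \<and> D n x \<le> (cmod (h x))\<^sup>2" for n x
      using frac[of n "S x"] by (auto simp: D_def power_le_one mult_left_le)
    show "D n x \<le> D m x" if "m \<le> n" for m n x
    proof -
      have "\<epsilon> n \<le> \<epsilon> m" using that by (simp add: \<epsilon>_def)
      then have "k (S x) * \<epsilon> n \<le> k (S x) * \<epsilon> m"
        using k0 by (rule mult_left_mono)
      then have "\<epsilon> n / (k (S x) + \<epsilon> n) \<le> \<epsilon> m / (k (S x) + \<epsilon> m)"
        using \<epsilon>0[of n] \<epsilon>0[of m] k0[of "S x"] by (simp add: frac_le_eq divide_simps algebra_simps)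
      then show ?thesis
        using frac[of n "S x"] by (auto simp: D_def intro!: mult_left_mono power_mono)
    qed
    show "(\<lambda>n. D n x) \<longlonglongrightarrow> 0" if x: "x \<in> topspace (gE1 ER)" for x
    proof (cases "h x = 0")
      \<comment> \<open>Here |h x|^2 is a positive term of the sum k (S x), so the denominators stay
        away from 0. Where h vanishes the error is 0 anyway.\<close>
      case False
      have "(cmod (h x))\<^sup>2 \<le> k (S x)"
        using sum_le_infsum_nonneg[OF hsS[OF S_in], of x "{x}"] x by (simp add: keq S_in)
      with False have "k (S x) > 0"
        by (meson less_le_trans zero_less_norm_iff zero_less_power)
      then have "(\<lambda>n. (cmod (h x))\<^sup>2 * (\<epsilon> n / (k (S x) + \<epsilon> n))\<^sup>2) \<longlonglongrightarrow> (cmod (h x))\<^sup>2 * (0 / (k (S x) + 0))\<^sup>2"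
        unfolding \<epsilon>_def by (intro tendsto_intros LIMSEQ_inverse_real_of_nat) auto
      then show ?thesis by (simp add: D_def)
    qed (simp add: D_def)
  qed (rule that)
  have car: "(\<lambda>x. twisted_mult (f (\<epsilon> n)) g x - h x) \<in> vcarrier XR"
    by (intro R.carrier_diff twisted_mult_carrier f g h \<epsilon>0)
  have "R.mnorm (\<lambda>x. twisted_mult (f (\<epsilon> n)) g x - h x) \<le> \<delta>/2"
  proof (rule R.mnorm_least[OF car])
    fix v assume "v \<in> topspace (gE0 ER)"
    then have "fibre_sum ER (\<lambda>x. (cmod (twisted_mult (f (\<epsilon> n)) g x - h x))\<^sup>2) v
        = fibre_sum ER (D n) v"
      by (auto simp: fibre_sum_def diff intro!: infsum_cong)
    then have "fibre_norm ER (\<lambda>x. twisted_mult (f (\<epsilon> n)) g x - h x) v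
        = sqrt (fibre_sum ER (D n) v)"
      by (simp add: fibre_norm_def)
    also have "\<dots> \<le> sqrt ((\<delta>/2)\<^sup>2)"
      using n[of v] by (intro real_sqrt_le_mono less_imp_le)
    also have "\<dots> = \<delta>/2"
      using \<delta> by simp
    finally show "fibre_norm ER (\<lambda>x. twisted_mult (f (\<epsilon> n)) g x - h x) v \<le> \<delta>/2" .
  qed (use \<delta> in simp)
  with \<delta> show ?thesis
    using that[OF f[OF \<epsilon>0[of n]] g] by simp
qed

sublocale tensor_representation ER XS XT twisted_mult
proof
  fix f g a z
  show "vscale XS z f \<in> vcarrier XS" if "f \<in> vcarrier XS" for f z
    using S.carrier_scale[OF that] by simp
  show "lact XS a f \<in> vcarrier XS" if "f \<in> vcarrier XS" "a \<in> C0_set (gE0 ER)" for f a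
    using S.carrier_lact that by simp
  show "ract XT g a \<in> vcarrier XT" if "g \<in> vcarrier XT" "a \<in> C0_set (gE0 ER)" for g a
    using T.carrier_ract that by simp
  show "\<exists>t\<in>fsums XS XT. R.mnorm (\<lambda>e. (\<Sum>(x, y)\<leftarrow>t. twisted_mult x y e) - h e) < \<delta>"
    if h: "h \<in> vcarrier XR" and \<delta>: "\<delta> > 0" for h \<delta>
  proof -
    obtain f g where "f \<in> vcarrier XS" "g \<in> vcarrier XT" "R.mnorm (\<lambda>x. twisted_mult f g x - h x) < \<delta>"
      using twisted_mult_dense[OF h \<delta>] by blast
    \<comment> \<open>Single products are already dense, so a formal sum of length one
      suffices.\<close>
    then show ?thesis
      by (intro bexI[of _ "[(f, g)]"]) (auto simp: fsums_def)
  qed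
  show "twisted_mult f (ract XT g a) = (\<lambda>e. twisted_mult f g e * a (gsrc ER e))"
    if "f \<in> vcarrier XS" for f g a
  proof
    fix x
    show "twisted_mult f (ract XT g a) x = twisted_mult f g x * a (gsrc ER x)"
      \<comment> \<open>\<open>RTS\<close> is available on the space only; outside it both sides
        vanish with f.\<close>
      using S.carrier_outside[OF that, of x]
      by (cases "x \<in> topspace X") (auto simp: twisted_mult_def RTS)
  qed
qed (auto simp: twisted_mult_carrier twisted_mult_ip twisted_mult_def fun_eq_iff)

end

section \<open>Infinite paths in a topological k-graph\<close>

lemma le_iff_add_vec: "m \<le> n \<longleftrightarrow> (\<exists>q. n = m + (q :: nat ^ 'k))"
proof
  assume "m \<le> n"
  then have "n = m + (n - m)"
    by (simp add: vec_eq_iff less_eq_vec_def)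
  then show "\<exists>q. n = m + q" ..
qed (auto simp: less_eq_vec_def)

lemma add_diff_vec [simp]: "m + n - m = (n :: nat ^ 'k)"
  by (simp add: vec_eq_iff)

lemma le_add_vec [simp]: "m \<le> m + (n :: nat ^ 'k)" "m \<le> n + (m :: nat ^ 'k)" "0 \<le> (m :: nat ^ 'k)"
  by (simp_all add: less_eq_vec_def)

lemma Mor_Omega: "Mor Omega = {(m, n). m \<le> n}"
  by (simp add: Omega_def)

section \<open>Unique factorisation in a k-graph and the continuity of its factors\<close>

locale top_kgraph =
  fixes L :: "('o, 'm, 'k::finite) top_kgraph"
  assumes kgraph: "topological_kgraph L"
begin

lemma category: "small_category L"
  using kgraph by (simp add: topological_kgraph_def)

lemma rng_src_Obj: "l \<in> Mor L \<Longrightarrow> rng L l \<in> Obj L" "l \<in> Mor L \<Longrightarrow> src L l \<in> Obj L"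
  using category by (auto simp: small_category_def)

lemma ident_Mor: "v \<in> Obj L \<Longrightarrow> ident L v \<in> Mor L" "v \<in> Obj L \<Longrightarrow> rng L (ident L v) = v"
    "v \<in> Obj L \<Longrightarrow> src L (ident L v) = v"
  using category by (auto simp: small_category_def)

lemma composableD: "(l, m) \<in> composable L \<Longrightarrow> l \<in> Mor L \<and> m \<in> Mor L \<and> src L l = rng L m"
  by (simp add: composable_def)

lemma composableI: "l \<in> Mor L \<Longrightarrow> m \<in> Mor L \<Longrightarrow> src L l = rng L m \<Longrightarrow> (l, m) \<in> composable L"
  by (simp add: composable_def)

lemma cmp_Mor:
  assumes "(l, m) \<in> composable L"
  shows "cmp L l m \<in> Mor L" "rng L (cmp L l m) = rng L l" "src L (cmp L l m) = src L m"
  using category assms by (auto simp: small_category_def)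

lemma cmp_ident:
  "l \<in> Mor L \<Longrightarrow> cmp L (ident L (rng L l)) l = l" "l \<in> Mor L \<Longrightarrow> cmp L l (ident L (src L l)) = l"
  using category by (auto simp: small_category_def)

lemma cmp_assoc:
  "(l, m) \<in> composable L \<Longrightarrow> (m, n) \<in> composable L \<Longrightarrow> cmp L (cmp L l m) n = cmp L l (cmp L m n)"
  using category unfolding small_category_def by blast

lemma deg_functor: "is_functor L Nk_cat (\<lambda>_. ()) (deg L)"
  using kgraph by (simp add: topological_kgraph_def)

lemma deg_cmp: "(l, m) \<in> composable L \<Longrightarrow> deg L (cmp L l m) = deg L l + deg L m"
  using deg_functor by (auto simp: is_functor_def Nk_cat_def)

lemma deg_ident: "v \<in> Obj L \<Longrightarrow> deg L (ident L v) = 0"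
  using deg_functor by (auto simp: is_functor_def Nk_cat_def)

lemma unique_factorization:
  "l \<in> Mor L \<Longrightarrow> deg L l = m + n \<Longrightarrow>
    \<exists>!p. p \<in> composable L \<and> l = cmp L (fst p) (snd p) \<and> deg L (fst p) = m \<and> deg L (snd p) = n"
  using kgraph unfolding topological_kgraph_def by blast

text \<open>The degree of the second factor is forced. For m below the degree of l,
  \<open>prefix m l\<close> and \<open>suffix m l\<close> are the segments usually written l(0, m)
  and l(m, d(l)); otherwise the value is unspecified.\<close>

definition factors :: "nat ^ 'k \<Rightarrow> 'm \<Rightarrow> 'm \<times> 'm" where
  "factors m l = (THE p. p \<in> composable L \<and> l = cmp L (fst p) (snd p) \<and>
     deg L (fst p) = m \<and> deg L (snd p) = deg L l - m)"

definition prefix :: "nat ^ 'k \<Rightarrow> 'm \<Rightarrow> 'm" where "prefix m l = fst (factors m l)"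

definition suffix :: "nat ^ 'k \<Rightarrow> 'm \<Rightarrow> 'm" where "suffix m l = snd (factors m l)"

lemma prefix_suffix:
  assumes "l \<in> Mor L" "m \<le> deg L l"
  shows "(prefix m l, suffix m l) \<in> composable L" "cmp L (prefix m l) (suffix m l) = l"
    "deg L (prefix m l) = m" "deg L (suffix m l) = deg L l - m"
proof -
  obtain n where "deg L l = m + n" using assms(2) by (auto simp: le_iff_add_vec)
  then have "\<exists>!p. p \<in> composable L \<and> l = cmp L (fst p) (snd p) \<and>
      deg L (fst p) = m \<and> deg L (snd p) = deg L l - m"
    using unique_factorization[OF assms(1), of m n] by simp
  from theI'[OF this] show "(prefix m l, suffix m l) \<in> composable L" "cmp L (prefix m l) (suffix m l) = l"
    "deg L (prefix m l) = m" "deg L (suffix m l) = deg L l - m"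
    by (simp_all add: factors_def prefix_def suffix_def)
qed

lemma prefix_suffix_cmp:
  assumes ab: "(a, b) \<in> composable L"
  shows "prefix (deg L a) (cmp L a b) = a" "suffix (deg L a) (cmp L a b) = b"
proof -
  let ?l = "cmp L a b" and ?p = "factors (deg L a) (cmp L a b)"
  have l: "?l \<in> Mor L" "deg L ?l = deg L a + deg L b" "deg L a \<le> deg L ?l"
    using ab by (simp_all add: cmp_Mor deg_cmp)
  have "?p = (a, b)"
    unfolding factors_def l(2) add_diff_vec
    by (rule the1_equality[OF unique_factorization[OF l(1,2)]]) (simp add: ab)
  then show "prefix (deg L a) (cmp L a b) = a" "suffix (deg L a) (cmp L a b) = b"
    by (simp_all add: prefix_def suffix_def)
qed

lemma prefix_deg: "l \<in> Mor L \<Longrightarrow> prefix (deg L l) l = l"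
  using prefix_suffix_cmp(1)[of l "ident L (src L l)"]
  by (simp add: cmp_ident composableI ident_Mor rng_src_Obj)

lemma suffix_0: "l \<in> Mor L \<Longrightarrow> suffix 0 l = l"
  using prefix_suffix_cmp(2)[of "ident L (rng L l)" l]
  by (simp add: cmp_ident composableI ident_Mor rng_src_Obj deg_ident)

lemma suffix_deg: "l \<in> Mor L \<Longrightarrow> suffix (deg L l) l = ident L (src L l)"
  using prefix_suffix_cmp(2)[of l "ident L (src L l)"]
  by (simp add: cmp_ident composableI ident_Mor rng_src_Obj)

text \<open>Factoring a and reassociating exhibits a factorisation of the composite with first
  factor \<open>prefix m a\<close>; uniqueness does the rest.\<close>

lemma prefix_cmp:
  assumes ab: "(a, b) \<in> composable L" and m: "m \<le> deg L a"
  shows "prefix m (cmp L a b) = prefix m a"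
proof -
  have a: "a \<in> Mor L" using composableD[OF ab] by simp
  note p = prefix_suffix[OF a m]
  have sb: "(suffix m a, b) \<in> composable L"
    using composableD[OF p(1)] composableD[OF ab] cmp_Mor[OF p(1)] p(2) by (auto intro: composableI)
  then have "cmp L a b = cmp L (prefix m a) (cmp L (suffix m a) b)"
    using cmp_assoc[OF p(1) sb] p(2) by simp
  moreover have "(prefix m a, cmp L (suffix m a) b) \<in> composable L"
    using composableD[OF p(1)] cmp_Mor[OF sb] by (auto intro: composableI)
  ultimately show ?thesis
    using prefix_suffix_cmp(1)[of "prefix m a"] p(3) by simp
qed

lemma prefix_prefix:
  assumes "l \<in> Mor L" "n \<le> deg L l" "m \<le> n"
  shows "prefix m (prefix n l) = prefix m l"
  using prefix_cmp[of "prefix n l" "suffix n l" m] prefix_suffix[OF assms(1,2)] assms(3) by simp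

lemma mor_topspace: "topspace (mor_top L) = Mor L"
  using kgraph by (simp add: topological_kgraph_def)

lemma openin_deg_part: "openin (mor_top L) (deg_part L n)"
proof -
  have "continuous_map (mor_top L) (discrete_topology UNIV) (deg L)"
    using kgraph by (simp add: topological_kgraph_def)
  then have "openin (mor_top L) {l \<in> topspace (mor_top L). deg L l \<in> {n}}"
    by (rule openin_continuous_map_preimage) simp
  then show ?thesis by (simp add: mor_topspace deg_part_def)
qed

lemma openin_cmp_image:
  assumes "openin (mor_top L) U" "openin (mor_top L) V"
  shows "openin (mor_top L) ((\<lambda>(l, m). cmp L l m) ` (U \<times> V \<inter> composable L))"
proof -
  have "openin (composable_top L) (U \<times> V \<inter> composable L)"
    unfolding composable_top_def openin_subtopology
    using assms by (intro exI[of _ "U \<times> V"]) (simp add: openin_prod_Times_iff)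
  moreover have "open_map (composable_top L) (mor_top L) (\<lambda>(l, m). cmp L l m)"
    using kgraph by (simp add: topological_kgraph_def)
  ultimately show ?thesis by (simp add: open_map_def)
qed

lemma topspace_deg_part_top: "topspace (deg_part_top L n) = deg_part L n"
  unfolding deg_part_top_def using openin_subset[OF openin_deg_part] by auto

text \<open>Continuity of factorisation is openness of composition: within degree m + n, the
  preimage of W under \<open>prefix m\<close> is the set of all composites of morphisms of degree m
  in W with morphisms of degree n. The case of \<open>suffix\<close> is symmetric.\<close>

lemma continuous_prefix: "continuous_map (deg_part_top L (m + n)) (mor_top L) (prefix m)"
  and continuous_suffix: "continuous_map (deg_part_top L (m + n)) (mor_top L) (suffix m)"
proof -
  have p: "(prefix m l, suffix m l) \<in> composable L" "cmp L (prefix m l) (suffix m l) = l"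
    "prefix m l \<in> deg_part L m" "suffix m l \<in> deg_part L n" if "l \<in> deg_part L (m + n)" for l
    using prefix_suffix[of l m] that composableD by (auto simp: deg_part_def)
  have ab: "prefix m (cmp L a b) = a" "suffix m (cmp L a b) = b" "cmp L a b \<in> deg_part L (m + n)"
    if "(a, b) \<in> composable L" "a \<in> deg_part L m" "b \<in> deg_part L n" for a b
    using prefix_suffix_cmp[OF that(1)] that deg_cmp[OF that(1)] cmp_Mor[OF that(1)] by (auto simp: deg_part_def)
  have "openin (deg_part_top L (m + n)) {l \<in> deg_part L (m + n). prefix m l \<in> W}"
    if "openin (mor_top L) W" for W
  proof -
    have "{l \<in> deg_part L (m + n). prefix m l \<in> W}
        = (\<lambda>(l, m). cmp L l m) ` ((W \<inter> deg_part L m) \<times> deg_part L n \<inter> composable L)" (is "?A = ?B")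
    proof (intro equalityI subsetI)
      fix l assume "l \<in> ?A"
      then show "l \<in> ?B"
        using p[of l] by (intro image_eqI[of _ _ "(prefix m l, suffix m l)"]) auto
    next
      fix l assume "l \<in> ?B"
      then obtain a b where "l = cmp L a b" "(a, b) \<in> (W \<inter> deg_part L m) \<times> deg_part L n" "(a, b) \<in> composable L"
        by auto
      then show "l \<in> ?A"
        using ab[of a b] by auto
    qed
    moreover have "openin (mor_top L) \<dots>"
      using that by (intro openin_cmp_image openin_Int openin_deg_part)
    ultimately show ?thesis
      unfolding deg_part_top_def openin_open_subtopology[OF openin_deg_part] by auto
  qed
  then show "continuous_map (deg_part_top L (m + n)) (mor_top L) (prefix m)"
    unfolding continuous_map_def topspace_deg_part_top mor_topspace using p(3) by (auto simp: deg_part_def)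
  have "openin (deg_part_top L (m + n)) {l \<in> deg_part L (m + n). suffix m l \<in> W}"
    if "openin (mor_top L) W" for W
  proof -
    have "{l \<in> deg_part L (m + n). suffix m l \<in> W}
        = (\<lambda>(l, m). cmp L l m) ` (deg_part L m \<times> (W \<inter> deg_part L n) \<inter> composable L)" (is "?A = ?B")
    proof (intro equalityI subsetI)
      fix l assume "l \<in> ?A"
      then show "l \<in> ?B"
        using p[of l] by (intro image_eqI[of _ _ "(prefix m l, suffix m l)"]) auto
    next
      fix l assume "l \<in> ?B"
      then obtain a b where "l = cmp L a b" "(a, b) \<in> deg_part L m \<times> (W \<inter> deg_part L n)" "(a, b) \<in> composable L"
        by auto
      then show "l \<in> ?A"
        using ab[of a b] by auto
    qed
    moreover have "openin (mor_top L) \<dots>"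
      using that by (intro openin_cmp_image openin_Int openin_deg_part)
    ultimately show ?thesis
      unfolding deg_part_top_def openin_open_subtopology[OF openin_deg_part] by auto
  qed
  then show "continuous_map (deg_part_top L (m + n)) (mor_top L) (suffix m)"
    unfolding continuous_map_def topspace_deg_part_top mor_topspace using p(4) by (auto simp: deg_part_def)
qed

section \<open>Infinite paths as coherent families of initial segments; shifting and
  prepending\<close>

lemma inf_pathsI:
  assumes "\<And>m. fst x m \<in> Obj L" "\<And>m. seg x m m = ident L (fst x m)"
    and "\<And>m n. m \<le> n \<Longrightarrow> seg x m n \<in> Mor L \<and> rng L (seg x m n) = fst x m \<and>
      src L (seg x m n) = fst x n \<and> deg L (seg x m n) = n - m"
    and "\<And>m n p. m \<le> n \<Longrightarrow> n \<le> p \<Longrightarrow> cmp L (seg x m n) (seg x n p) = seg x m p"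
    and "snd x \<in> extensional (Mor Omega)"
  shows "x \<in> inf_paths L"
proof -
  have "is_functor Omega L (fst x) (snd x)"
    unfolding is_functor_def using assms by (auto simp: Omega_def composable_def seg_def)
  with assms(3,5) show ?thesis
    by (simp add: inf_paths_def case_prod_beta seg_def)
qed

lemma path_Obj: "x \<in> inf_paths L \<Longrightarrow> fst x m \<in> Obj L"
  by (auto simp: inf_paths_def is_functor_def Omega_def)

lemma seg_Mor:
  assumes "x \<in> inf_paths L" "m \<le> n"
  shows "seg x m n \<in> Mor L" "rng L (seg x m n) = fst x m" "src L (seg x m n) = fst x n"
    "deg L (seg x m n) = n - m"
  using assms by (auto simp: inf_paths_def is_functor_def Omega_def seg_def)

lemma seg_refl: "x \<in> inf_paths L \<Longrightarrow> seg x m m = ident L (fst x m)"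
  by (auto simp: inf_paths_def is_functor_def Omega_def seg_def)

lemma seg_composable:
  assumes "x \<in> inf_paths L" "m \<le> n" "n \<le> p"
  shows "(seg x m n, seg x n p) \<in> composable L"
  using seg_Mor[OF assms(1,2)] seg_Mor[OF assms(1,3)] by (auto intro: composableI)

lemma seg_cmp:
  assumes "x \<in> inf_paths L" "m \<le> n" "n \<le> p"
  shows "cmp L (seg x m n) (seg x n p) = seg x m p"
proof -
  have "is_functor Omega L (fst x) (snd x)"
    using assms(1) by (auto simp: inf_paths_def)
  moreover have "((m, n), (n, p)) \<in> composable Omega"
    using assms by (simp add: composable_def Omega_def)
  ultimately have "snd x (cmp Omega (m, n) (n, p)) = cmp L (snd x (m, n)) (snd x (n, p))"
    unfolding is_functor_def by blast
  then show ?thesis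
    by (simp add: seg_def Omega_def)
qed

lemma seg_deg_part: "x \<in> inf_paths L \<Longrightarrow> seg x 0 n \<in> deg_part L n"
  by (simp add: deg_part_def seg_Mor)

lemma seg_suffix: "x \<in> inf_paths L \<Longrightarrow> seg x m (m + n) = suffix m (seg x 0 (m + n))"
  using prefix_suffix_cmp(2)[OF seg_composable[of x 0 m "m + n"]] seg_cmp[of x 0 m "m + n"]
    seg_deg_part[of x m] by (simp add: deg_part_def)

lemma seg_prefix:
  assumes "x \<in> inf_paths L" "m \<le> n" shows "seg x 0 m = prefix m (seg x 0 n)"
  using prefix_suffix_cmp(1)[OF seg_composable[of x 0 m n]] seg_cmp[of x 0 m n] seg_deg_part[of x m] assms
  by (simp add: deg_part_def)

text \<open>x(m, n) is a suffix of x(0, n), and objects are the ranges of the segments x(m, m). At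
  pairs that are not ordered, extensionality fixes the values.\<close>

lemma path_eqI:
  assumes x: "x \<in> inf_paths L" and y: "y \<in> inf_paths L" and eq: "\<And>n. seg x 0 n = seg y 0 n"
  shows "x = y"
proof (rule prod_eqI)
  have "snd x (m, n) = snd y (m, n)" for m n
  proof (cases "m \<le> n")
    case True
    then show ?thesis
      using seg_suffix[OF x] seg_suffix[OF y] eq by (auto simp: le_iff_add_vec seg_def)
  next
    case False
    then show ?thesis
      using x y by (auto simp: inf_paths_def Mor_Omega extensional_def)
  qed
  then show "snd x = snd y" by auto
  then show "fst x = fst y"
    using seg_Mor(2)[OF x order_refl] seg_Mor(2)[OF y order_refl] by (auto simp: seg_def fun_eq_iff)
qed

lemma seg_shift: "a \<le> b \<Longrightarrow> seg (shift p x) a b = seg x (a + p) (b + p)"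
  by (simp add: shift_def seg_def Mor_Omega)

lemma shift_inf_paths:
  assumes x: "x \<in> inf_paths L" shows "shift p x \<in> inf_paths L"
proof -
  have le: "m + p \<le> n + p" if "m \<le> n" for m n :: "nat ^ 'k"
    using that by (simp add: less_eq_vec_def)
  have diff: "n + p - (m + p) = n - m" for m n :: "nat ^ 'k"
    by (simp add: vec_eq_iff)
  have f: "fst (shift p x) m = fst x (m + p)" for m
    by (simp add: shift_def)
  show ?thesis
  proof (rule inf_pathsI)
    show "cmp L (seg (shift p x) m n) (seg (shift p x) n q) = seg (shift p x) m q" if "m \<le> n" "n \<le> q" for m n q
      using that order_trans[OF that] by (simp add: seg_shift seg_cmp[OF x le le])
    show "snd (shift p x) \<in> extensional (Mor Omega)"
      by (simp add: shift_def)
  qed (simp_all add: f path_Obj[OF x] seg_shift seg_refl[OF x] seg_Mor[OF x le] diff)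
qed

lemma shift_shift: "shift m (shift n x) = shift (m + n) (x :: ('o, 'm, 'k) path)"
proof -
  have "a + m \<le> b + m" if "a \<le> b" for a b :: "nat ^ 'k"
    using that by (simp add: less_eq_vec_def)
  then show ?thesis
    by (auto simp: shift_def seg_def Mor_Omega add.assoc restrict_def fun_eq_iff)
qed

lemma shift_0: "x \<in> inf_paths L \<Longrightarrow> shift 0 x = x"
  by (rule path_eqI) (simp_all add: shift_inf_paths seg_shift)

text \<open>The inverse of taking initial segments: a coherent family z determines the path with
  x(0, n) = z n.\<close>

definition path_of :: "(nat ^ 'k \<Rightarrow> 'm) \<Rightarrow> ('o, 'm, 'k) path" where
  "path_of z = (\<lambda>n. src L (z n), restrict (\<lambda>(m, n). suffix m (z n)) (Mor Omega))"

lemma path_of: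
  assumes z: "\<And>n. z n \<in> deg_part L n" and coh: "\<And>m n. m \<le> n \<Longrightarrow> z m = prefix m (z n)"
  shows "path_of z \<in> inf_paths L" "seg (path_of z) 0 n = z n"
proof -
  have zM: "z n \<in> Mor L" "deg L (z n) = n" for n
    using z[of n] by (auto simp: deg_part_def)
  have suf: "(z m, suffix m (z n)) \<in> composable L" "cmp L (z m) (suffix m (z n)) = z n"
    "deg L (suffix m (z n)) = n - m" if "m \<le> n" for m n
    using prefix_suffix[OF zM(1), of m n] zM(2)[of n] coh[OF that] that by auto
  have id: "suffix n (z n) = ident L (src L (z n))" for n
    using suffix_deg[OF zM(1), of n] by (simp add: zM)
  have rs: "suffix m (z n) \<in> Mor L" "rng L (suffix m (z n)) = src L (z m)" "src L (suffix m (z n)) = src L (z n)"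
    if "m \<le> n" for m n
    using composableD[OF suf(1)[OF that]] cmp_Mor(3)[OF suf(1)[OF that]] suf(2)[OF that] by auto
  have cmp: "cmp L (suffix m (z n)) (suffix n (z p)) = suffix m (z p)" if "m \<le> n" "n \<le> p" for m n p
  proof -
    have c: "(suffix m (z n), suffix n (z p)) \<in> composable L"
      using rs that by (auto intro: composableI)
    have c': "(z m, cmp L (suffix m (z n)) (suffix n (z p))) \<in> composable L"
      using cmp_Mor[OF c] rs[OF that(1)] zM by (auto intro: composableI)
    \<comment> \<open>Functoriality comes from uniqueness: both sides are second factors of z p
      after the first factor z m.\<close>
    have "z p = cmp L (z m) (cmp L (suffix m (z n)) (suffix n (z p)))"
      using cmp_assoc[OF suf(1)[OF that(1)] c] suf(2) that by simp
    then show ?thesis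
      using prefix_suffix_cmp(2)[OF c'] zM(2)[of m] by simp
  qed
  have sg: "seg (path_of z) m n = suffix m (z n)" if "m \<le> n" for m n
    using that by (simp add: seg_def path_of_def Mor_Omega)
  have f: "fst (path_of z) n = src L (z n)" for n
    by (simp add: path_of_def)
  show "path_of z \<in> inf_paths L"
  proof (rule inf_pathsI)
    show "cmp L (seg (path_of z) m n) (seg (path_of z) n p) = seg (path_of z) m p" if "m \<le> n" "n \<le> p" for m n p
      using that order_trans[OF that] by (simp add: sg cmp)
    show "snd (path_of z) \<in> extensional (Mor Omega)"
      by (simp add: path_of_def)
  qed (simp_all add: f sg id rs suf(3) rng_src_Obj(2)[OF zM(1)])
  show "seg (path_of z) 0 n = z n"
    by (simp add: sg suffix_0 zM)
qed

text \<open>The path l y. Its segment of degree n is cut out of l y(0, n), which is long enough; a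
  definition by n - d(l) would fail, since n and d(l) may be incomparable.\<close>

definition concat_path :: "'m \<Rightarrow> ('o, 'm, 'k) path \<Rightarrow> ('o, 'm, 'k) path" where
  "concat_path l y = path_of (\<lambda>n. prefix n (cmp L l (seg y 0 n)))"

context
  fixes l y assumes l: "l \<in> Mor L" and y: "y \<in> inf_paths L" and ly: "src L l = fst y 0"
begin

lemma concat_composable: "(l, seg y 0 n) \<in> composable L"
  using l ly seg_Mor[OF y, of 0 n] by (auto intro: composableI)

lemma concat_deg: "cmp L l (seg y 0 n) \<in> deg_part L (deg L l + n)"
  using cmp_Mor(1)[OF concat_composable] deg_cmp[OF concat_composable] seg_deg_part[OF y, of n]
  by (simp add: deg_part_def)

text \<open>Prolonging the segment of y only appends on the right, so prefixes that fit into the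
  shorter composite are unchanged. This yields coherence of the family defining l y.\<close>

lemma concat_prefix:
  assumes "m \<le> n" "p \<le> deg L l + m"
  shows "prefix p (cmp L l (seg y 0 n)) = prefix p (cmp L l (seg y 0 m))"
proof -
  have s: "(seg y 0 m, seg y m n) \<in> composable L"
    using seg_composable[OF y _ assms(1)] by simp
  have "cmp L l (seg y 0 n) = cmp L (cmp L l (seg y 0 m)) (seg y m n)"
    using cmp_assoc[OF concat_composable s] seg_cmp[OF y _ assms(1), of 0] by simp
  moreover have "(cmp L l (seg y 0 m), seg y m n) \<in> composable L"
    using cmp_Mor[OF concat_composable, of m] composableD[OF s] by (auto intro: composableI)
  ultimately show ?thesis
    using prefix_cmp assms(2) concat_deg[of m] by (simp add: deg_part_def)
qed

lemma concat_path: "concat_path l y \<in> inf_paths L"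
    "seg (concat_path l y) 0 n = prefix n (cmp L l (seg y 0 n))"
proof -
  let ?z = "\<lambda>n. prefix n (cmp L l (seg y 0 n))"
  have z: "?z n \<in> deg_part L n" for n
    using prefix_suffix[of "cmp L l (seg y 0 n)" n] concat_deg[of n] composableD by (auto simp: deg_part_def)
  have coh: "?z m = prefix m (?z n)" if "m \<le> n" for m n
    using concat_prefix[OF that, of m] prefix_prefix[of "cmp L l (seg y 0 n)" n m] that concat_deg[of n]
    by (simp add: deg_part_def)
  show "concat_path l y \<in> inf_paths L" "seg (concat_path l y) 0 n = ?z n"
    unfolding concat_path_def using path_of[of ?z, OF z coh] by auto
qed

lemma seg_concat_path: "seg (concat_path l y) 0 (deg L l + n) = cmp L l (seg y 0 n)"
  using concat_prefix[of n "deg L l + n" "deg L l + n"] concat_deg[of n] prefix_deg[of "cmp L l (seg y 0 n)"]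
  by (simp add: concat_path deg_part_def)

lemma seg_concat_path_deg: "seg (concat_path l y) 0 (deg L l) = l"
  using seg_concat_path[of 0] cmp_ident(2)[OF l] ly by (simp add: seg_refl[OF y])

lemma shift_concat_path: "shift (deg L l) (concat_path l y) = y"
proof (rule path_eqI[OF shift_inf_paths[OF concat_path(1)] y])
  fix n
  have "seg (shift (deg L l) (concat_path l y)) 0 n = suffix (deg L l) (cmp L l (seg y 0 n))"
    using seg_suffix[OF concat_path(1), of "deg L l" n]
    by (simp add: seg_shift seg_concat_path add.commute[of n])
  then show "seg (shift (deg L l) (concat_path l y)) 0 n = seg y 0 n"
    by (simp add: prefix_suffix_cmp(2)[OF concat_composable])
qed

end

lemma concat_path_shift:
  assumes x: "x \<in> inf_paths L" shows "concat_path (seg x 0 n) (shift n x) = x"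
proof -
  note s = shift_inf_paths[OF x, of n]
  have l: "seg x 0 n \<in> Mor L" "src L (seg x 0 n) = fst (shift n x) 0"
    using seg_Mor[OF x, of 0 n] by (simp_all add: shift_def)
  show ?thesis
  proof (rule path_eqI[OF concat_path(1)[OF l(1) s l(2)] x])
    fix p
    have "cmp L (seg x 0 n) (seg (shift n x) 0 p) = seg x 0 (n + p)"
      using seg_cmp[OF x, of 0 n "n + p"] by (simp add: seg_shift add.commute)
    then show "seg (concat_path (seg x 0 n) (shift n x)) 0 p = seg x 0 p"
      using seg_prefix[OF x, of p "n + p"] by (simp add: concat_path(2)[OF l(1) s l(2)])
  qed
qed

section \<open>The topology of the path space\<close>

text \<open>The existential quantifier in \<open>cyl\<close> disappears because the degree of a
  segment determines n.\<close>

lemma cyl_eq: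
  assumes "U \<subseteq> deg_part L n" shows "cyl L U = {x \<in> inf_paths L. seg x 0 n \<in> U}"
  using assms seg_deg_part by (auto simp: cyl_def deg_part_def)

lemma topspace_path_top: "topspace (path_top L) = inf_paths L"
proof -
  have "cyl L (deg_part L 0) = inf_paths L"
    using cyl_eq[of "deg_part L 0" 0] seg_deg_part by auto
  moreover have "openin (deg_part_top L 0) (deg_part L 0)"
    using openin_topspace[of "deg_part_top L 0"] by (simp add: topspace_deg_part_top)
  ultimately have "inf_paths L \<subseteq> \<Union>{cyl L U | U n. openin (deg_part_top L n) U}"
    by blast
  then show ?thesis
    unfolding path_top_def topology_generated_by_topspace by (auto simp: cyl_def)
qed

lemma openin_cyl:
  assumes "openin (mor_top L) U" shows "openin (path_top L) {x \<in> inf_paths L. seg x 0 n \<in> U}"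
proof -
  have "openin (deg_part_top L n) (U \<inter> deg_part L n)"
    unfolding deg_part_top_def using assms by (auto simp: openin_subtopology)
  then have "openin (path_top L) (cyl L (U \<inter> deg_part L n))"
    unfolding path_top_def by (intro topology_generated_by_Basis) blast
  moreover have "cyl L (U \<inter> deg_part L n) = {x \<in> inf_paths L. seg x 0 n \<in> U}"
    using cyl_eq[of "U \<inter> deg_part L n" n] seg_deg_part by auto
  ultimately show ?thesis by simp
qed

lemma continuous_seg_0: "continuous_map (path_top L) (mor_top L) (\<lambda>x. seg x 0 n)"
  unfolding continuous_map_def topspace_path_top mor_topspace using openin_cyl by (auto simp: seg_Mor)

lemma continuous_seg_0': "continuous_map (path_top L) (deg_part_top L n) (\<lambda>x. seg x 0 n)"
  unfolding deg_part_top_def using continuous_seg_0 seg_deg_part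
  by (auto intro!: continuous_map_into_subtopology simp: topspace_path_top)

lemma continuous_seg: "continuous_map (path_top L) (mor_top L) (\<lambda>x. seg x m (m + n))"
proof (rule continuous_map_eq)
  show "continuous_map (path_top L) (mor_top L) (suffix m \<circ> (\<lambda>x. seg x 0 (m + n)))"
    using continuous_seg_0' continuous_suffix by (rule continuous_map_compose)
qed (simp add: topspace_path_top seg_suffix)

text \<open>The cylinder topology is the initial topology for the maps taking x to x(0, n), so
  continuity can be tested on initial segments.\<close>

lemma continuous_into_path_top:
  assumes f: "f \<in> topspace Z \<rightarrow> inf_paths L"
    and seg: "\<And>n. continuous_map Z (mor_top L) (\<lambda>z. seg (f z) 0 n)"
  shows "continuous_map Z (path_top L) f"
  unfolding path_top_def
proof (rule continuous_on_generated_topo)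
  fix C assume "C \<in> {cyl L U | U n. openin (deg_part_top L n) U}"
  then obtain U n where U: "C = cyl L U" "openin (deg_part_top L n) U" by blast
  then have "openin (mor_top L) U" "U \<subseteq> deg_part L n"
    unfolding deg_part_top_def openin_open_subtopology[OF openin_deg_part] by auto
  then have "openin Z {z \<in> topspace Z. seg (f z) 0 n \<in> U}"
    using seg[of n] by (intro openin_continuous_map_preimage)
  moreover have "f -` C \<inter> topspace Z = {z \<in> topspace Z. seg (f z) 0 n \<in> U}"
    using U(1) cyl_eq[OF \<open>U \<subseteq> deg_part L n\<close>] f by auto
  ultimately show "openin Z (f -` C \<inter> topspace Z)" by simp
next
  show "f ` topspace Z \<subseteq> \<Union>{cyl L U | U n. openin (deg_part_top L n) U}"
    using f topspace_path_top unfolding path_top_def topology_generated_by_topspace by auto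
qed

lemma Hausdorff_path_top: "Hausdorff_space (path_top L)"
  unfolding Hausdorff_space_def topspace_path_top
proof (intro allI impI, elim conjE)
  fix x y assume xy: "x \<in> inf_paths L" "y \<in> inf_paths L" "x \<noteq> y"
  then obtain n where n: "seg x 0 n \<noteq> seg y 0 n" using path_eqI by blast
  have "Hausdorff_space (mor_top L)"
    using kgraph by (simp add: topological_kgraph_def)
  then obtain U V where UV: "openin (mor_top L) U" "openin (mor_top L) V"
      "seg x 0 n \<in> U" "seg y 0 n \<in> V" "disjnt U V"
    using n seg_Mor(1)[OF xy(1), of 0 n] seg_Mor(1)[OF xy(2), of 0 n]
    unfolding Hausdorff_space_def mor_topspace by (meson le_add_vec(3))
  let ?C = "\<lambda>W. {x \<in> inf_paths L. seg x 0 n \<in> W}"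
  have "x \<in> ?C U \<and> y \<in> ?C V \<and> disjnt (?C U) (?C V)"
    using UV(3-5) xy by (auto simp: disjnt_def)
  then show "\<exists>U V. openin (path_top L) U \<and> openin (path_top L) V \<and> x \<in> U \<and> y \<in> V \<and> disjnt U V"
    using openin_cyl[OF UV(1), of n] openin_cyl[OF UV(2), of n] by blast
qed

lemma continuous_shift: "continuous_map (path_top L) (path_top L) (shift n)"
proof (rule continuous_into_path_top)
  show "continuous_map (path_top L) (mor_top L) (\<lambda>z. seg (shift n z) 0 p)" for p
    using continuous_seg[of n p] by (simp add: seg_shift add.commute)
qed (auto simp: topspace_path_top shift_inf_paths)

lemma continuous_source: "continuous_map (path_top L) (obj_top L) (\<lambda>y. fst y 0)"
proof (rule continuous_map_eq)
  have "continuous_map (mor_top L) (obj_top L) (rng L)"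
    using kgraph by (simp add: topological_kgraph_def)
  then show "continuous_map (path_top L) (obj_top L) (rng L \<circ> (\<lambda>x. seg x 0 0))"
    using continuous_seg_0 by (rule continuous_map_compose[rotated])
qed (simp add: topspace_path_top seg_Mor)

lemma local_homeomorphism_shift: "local_homeomorphism (path_top L) (path_top L) (shift n)"
  unfolding local_homeomorphism_def topspace_path_top
proof
  fix x assume x: "x \<in> inf_paths L"
  have "local_homeomorphism (mor_top L) (obj_top L) (src L)"
    using kgraph by (simp add: topological_kgraph_def)
  then obtain U where U: "openin (mor_top L) U" "seg x 0 n \<in> U" "openin (obj_top L) (src L ` U)"
      "homeomorphic_map (subtopology (mor_top L) U) (subtopology (obj_top L) (src L ` U)) (src L)"
    using seg_Mor(1)[OF x, of 0 n] unfolding local_homeomorphism_def mor_topspace by (meson le_add_vec(3))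
  then obtain t where t: "homeomorphic_maps (subtopology (mor_top L) U) (subtopology (obj_top L) (src L ` U)) (src L) t"
    using homeomorphic_map_maps by blast
  have topU: "topspace (subtopology (mor_top L) U) = U" "topspace (subtopology (obj_top L) (src L ` U)) = src L ` U"
    using openin_subset[OF U(1)] openin_subset[OF U(3)] by auto
  have UM: "U \<subseteq> Mor L" using openin_subset[OF U(1)] by (simp add: mor_topspace)
  have ts: "t (src L l) = l" if "l \<in> U" for l
    using t that unfolding homeomorphic_maps_def topU by blast
  \<comment> \<open>Cutting down to degree n makes every element of the chart prependable with the
    same shift n.\<close>
  define U' where "U' = U \<inter> deg_part L n"
  have "openin (obj_top L) (src L ` U')"
  proof -
    have "openin (subtopology (mor_top L) U) U'"
      unfolding U'_def using openin_deg_part by (auto simp: openin_subtopology)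
    then have "openin (subtopology (obj_top L) (src L ` U)) (src L ` U')"
      using U(4) by (auto simp: homeomorphic_eq_everything_map open_map_def)
    then show ?thesis using U(3) openin_open_subtopology by blast
  qed
  \<comment> \<open>C is the cylinder over the chart, and V consists of the paths whose range is the
    source of some element of the chart. The inverse of the shift takes y in V to t(r(y)) y.\<close>
  define C where "C = {x \<in> inf_paths L. seg x 0 n \<in> U'}"
  define V where "V = {y \<in> inf_paths L. fst y 0 \<in> src L ` U'}"
  have C: "openin (path_top L) C"
    unfolding C_def U'_def by (intro openin_cyl openin_Int U openin_deg_part)
  have V: "openin (path_top L) V"
    using openin_continuous_map_preimage[OF continuous_source \<open>openin (obj_top L) (src L ` U')\<close>]
    by (simp add: V_def topspace_path_top)
  have topCV: "topspace (subtopology (path_top L) C) = C" "topspace (subtopology (path_top L) V) = V"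
    by (auto simp: C_def V_def topspace_path_top)
  let ?g = "\<lambda>y. concat_path (t (fst y 0)) y"
  have l: "t (fst y 0) \<in> Mor L" "y \<in> inf_paths L" "src L (t (fst y 0)) = fst y 0"
    "deg L (t (fst y 0)) = n" "t (fst y 0) \<in> U'" if "y \<in> V" for y
    using that ts UM by (auto simp: V_def U'_def deg_part_def)
  have shiftC: "shift n z \<in> V" "?g (shift n z) = z" if "z \<in> C" for z
  proof -
    have z: "z \<in> inf_paths L" "seg z 0 n \<in> U'" using that by (auto simp: C_def)
    have "fst (shift n z) 0 = src L (seg z 0 n)"
      using seg_Mor(3)[OF z(1), of 0 n] by (simp add: shift_def)
    moreover from this have "t (fst (shift n z) 0) = seg z 0 n"
      using ts[of "seg z 0 n"] z(2) by (simp add: U'_def)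
    ultimately show "shift n z \<in> V" "?g (shift n z) = z"
      using z concat_path_shift[OF z(1), of n] by (auto simp: V_def shift_inf_paths)
  qed
  have gV: "?g y \<in> C" "shift n (?g y) = y" if "y \<in> V" for y
    using concat_path(1)[OF l(1-3)[OF that]] seg_concat_path_deg[OF l(1-3)[OF that]]
      shift_concat_path[OF l(1-3)[OF that]] l(4,5)[OF that] by (simp_all add: C_def)
  have image: "shift n ` C = V"
  proof (intro equalityI subsetI)
    show "y \<in> shift n ` C" if "y \<in> V" for y
      using gV[OF that] by (rule image_eqI[OF sym, rotated])
  qed (use shiftC(1) in blast)
  have "homeomorphic_maps (subtopology (path_top L) C) (subtopology (path_top L) V) (shift n) ?g"
    unfolding homeomorphic_maps_def topCV
  proof (intro conjI ballI)
    show "continuous_map (subtopology (path_top L) C) (subtopology (path_top L) V) (shift n)"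
      using continuous_shift shiftC(1) topCV
      by (intro continuous_map_into_subtopology continuous_map_from_subtopology) auto
    have "continuous_map (subtopology (path_top L) V) (path_top L) ?g"
    proof (rule continuous_into_path_top)
      show "?g \<in> topspace (subtopology (path_top L) V) \<rightarrow> inf_paths L"
        using gV(1) by (auto simp: C_def topspace_path_top)
      fix p
      have src: "continuous_map (subtopology (path_top L) V) (mor_top L) (\<lambda>y. t (fst y 0))"
      proof -
        have "continuous_map (subtopology (path_top L) V) (subtopology (obj_top L) (src L ` U)) (\<lambda>y. fst y 0)"
          using continuous_source
          by (intro continuous_map_into_subtopology continuous_map_from_subtopology) (auto simp: V_def U'_def)
        moreover have "continuous_map (subtopology (obj_top L) (src L ` U)) (mor_top L) t"
          using t by (auto simp: homeomorphic_maps_def continuous_map_in_subtopology)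
        ultimately have "continuous_map (subtopology (path_top L) V) (mor_top L) (t \<circ> (\<lambda>y. fst y 0))"
          by (rule continuous_map_compose)
        then show ?thesis by (simp add: o_def)
      qed
      have "continuous_map (subtopology (path_top L) V) (composable_top L) (\<lambda>y. (t (fst y 0), seg y 0 p))"
        unfolding composable_top_def
      proof (rule continuous_map_into_subtopology)
        show "continuous_map (subtopology (path_top L) V) (prod_topology (mor_top L) (mor_top L))
            (\<lambda>y. (t (fst y 0), seg y 0 p))"
          by (intro continuous_map_pairedI src continuous_map_from_subtopology[OF continuous_seg_0])
        show "(\<lambda>y. (t (fst y 0), seg y 0 p)) \<in> topspace (subtopology (path_top L) V) \<rightarrow> composable L"
          using concat_composable l by (auto simp: topspace_path_top)
      qed
      moreover have "continuous_map (composable_top L) (mor_top L) (\<lambda>(l, m). cmp L l m)"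
        using kgraph by (simp add: topological_kgraph_def)
      ultimately have "continuous_map (subtopology (path_top L) V) (mor_top L) ((\<lambda>(l, m). cmp L l m) \<circ> (\<lambda>y. (t (fst y 0), seg y 0 p)))"
        by (rule continuous_map_compose)
      \<comment> \<open>\<open>prefix p\<close> is continuous on components of fixed degree, so the
        composite is first placed in degree p + n.\<close>
      then have "continuous_map (subtopology (path_top L) V) (deg_part_top L (p + n)) (\<lambda>y. cmp L (t (fst y 0)) (seg y 0 p))"
        unfolding deg_part_top_def o_def
      proof (intro continuous_map_into_subtopology)
        have "cmp L (t (fst y 0)) (seg y 0 p) \<in> deg_part L (p + n)" if "y \<in> V" for y
          using concat_deg[OF l(1-3)[OF that], of p] l(4)[OF that] by (simp add: add.commute)
        then show "(\<lambda>y. cmp L (t (fst y 0)) (seg y 0 p)) \<in> topspace (subtopology (path_top L) V) \<rightarrow> deg_part L (p + n)"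
          unfolding topCV by blast
      qed simp
      then have "continuous_map (subtopology (path_top L) V) (mor_top L) (prefix p \<circ> (\<lambda>y. cmp L (t (fst y 0)) (seg y 0 p)))"
        using continuous_prefix by (rule continuous_map_compose)
      then show "continuous_map (subtopology (path_top L) V) (mor_top L) (\<lambda>y. seg (?g y) 0 p)"
        by (rule continuous_map_eq) (simp add: concat_path(2) l)
    qed
    then show "continuous_map (subtopology (path_top L) V) (subtopology (path_top L) C) ?g"
      using gV(1) topCV by (intro continuous_map_into_subtopology) auto
  qed (use shiftC gV in auto)
  then have "homeomorphic_map (subtopology (path_top L) C) (subtopology (path_top L) (shift n ` C)) (shift n)"
    unfolding image using homeomorphic_map_maps by blast
  moreover have "x \<in> C"
    using x U(2) seg_deg_part[OF x] by (simp add: C_def U'_def)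
  ultimately show "\<exists>U. openin (path_top L) U \<and> x \<in> U \<and> openin (path_top L) (shift n ` U) \<and>
      homeomorphic_map (subtopology (path_top L) U) (subtopology (path_top L) (shift n ` U)) (shift n)"
    using C V image by auto
qed

end

section \<open>The product system\<close>

text \<open>The fibres of s are single points, so the fibre norm of f is |f| and the module is the
  algebra itself. This identifies the fibre of the product system over 0.\<close>

lemma lh_graph_identity:
  assumes X: "Hausdorff_space X" and r: "\<And>x. x \<in> topspace X \<Longrightarrow> r x = x"
    and s: "\<And>x. x \<in> topspace X \<Longrightarrow> s x = x" and lh: "local_homeomorphism X X s"
  shows "vcarrier (graph_corr (lh_graph X r s)) = C0_set X"
    and "f \<in> C0_set X \<Longrightarrow> graph_ip (lh_graph X r s) f g = (\<lambda>x. cnj (f x) * g x)"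
proof -
  interpret hausdorff_graph "lh_graph X r s"
    using X r lh by (rule hausdorff_graph_lh_graph)
  have fib: "{x \<in> topspace X. s x = v} = {v}" if "v \<in> topspace X" for v
    using s that by auto
  have sum: "fibre_sum (lh_graph X r s) (\<lambda>x. (cmod (f x))\<^sup>2) v = (cmod (f v))\<^sup>2"
    if "\<And>x. x \<notin> topspace X \<Longrightarrow> f x = 0" for f v
    using that by (cases "v \<in> topspace X") (auto simp: fibre_sum_def fib)
  show "vcarrier (graph_corr (lh_graph X r s)) = C0_set X"
  proof (intro equalityI subsetI)
    fix f assume f: "f \<in> vcarrier (graph_corr (lh_graph X r s))"
    then have out: "\<And>x. x \<notin> topspace X \<Longrightarrow> f x = 0"
      by (simp add: graph_corr_carrier_iff)
    have "fibre_norm (lh_graph X r s) f v = cmod (f v)" for v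
      by (simp add: fibre_norm_def sum[OF out])
    then have "(\<lambda>v. complex_of_real (cmod (f v))) \<in> C0_set X"
      using fibre_norm_C0[OF f] by simp
    then show "f \<in> C0_set X"
      using f by (intro C0_set_dominated[of X f "\<lambda>v. complex_of_real (cmod (f v))"]) (auto simp: graph_corr_carrier_iff)
  next
    fix f assume f: "f \<in> C0_set X"
    have "(\<lambda>v. complex_of_real ((cmod (f v))\<^sup>2)) \<in> C0_set X"
      using C0_set_mult[OF C0_set_cnj[OF f] f] by (simp only: cnj_mult_self)
    then show "f \<in> vcarrier (graph_corr (lh_graph X r s))"
      unfolding graph_corr_carrier_iff C0_summable_def
      using C0_set_tendsto[OF f] C0_set_outside[OF f]
      by (auto simp: sum[OF C0_set_outside[OF f]] fib intro!: tendsto_power tendsto_norm)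
  qed
  show "graph_ip (lh_graph X r s) f g = (\<lambda>x. cnj (f x) * g x)" if f: "f \<in> C0_set X"
  proof
    fix x show "graph_ip (lh_graph X r s) f g x = cnj (f x) * g x"
      using C0_set_outside[OF f, of x] by (cases "x \<in> topspace X") (simp_all add: graph_ip_def fib)
  qed
qed

lemma path_corr_eq: "path_corr L n = graph_corr (lh_graph (path_top L) (shift 0) (shift n))"
  by (simp add: path_corr_def path_graph_def lh_graph_def)

locale kgraph_cocycle = top_kgraph L for L :: "('o, 'm, 'k::finite) top_kgraph" +
  fixes c :: "'m \<Rightarrow> 'm \<Rightarrow> complex"
  assumes cocycle: "continuous_cocycle L c"
begin

lemma cocycle_identity:
  "(a, b) \<in> composable L \<Longrightarrow> (b, d) \<in> composable L \<Longrightarrow>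
    c a b * c (cmp L a b) d = c a (cmp L b d) * c b d"
  using cocycle unfolding continuous_cocycle_def by blast

lemma cocycle_ident: "l \<in> Mor L \<Longrightarrow> c l (ident L (src L l)) = 1" "l \<in> Mor L \<Longrightarrow> c (ident L (rng L l)) l = 1"
  using cocycle unfolding continuous_cocycle_def by blast+

lemma continuous_path_cocycle:
  "continuous_map (path_top L) (top_of_set {z. cmod z = 1}) (\<lambda>x. c (seg x 0 m) (seg x m (m + n)))"
proof -
  have "continuous_map (path_top L) (composable_top L) (\<lambda>x. (seg x 0 m, seg x m (m + n)))"
    unfolding composable_top_def
    by (intro continuous_map_into_subtopology continuous_map_pairedI continuous_seg_0 continuous_seg)
      (auto simp: topspace_path_top seg_composable)
  moreover have "continuous_map (composable_top L) (top_of_set {z. cmod z = 1}) (\<lambda>(a, b). c a b)"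
    using cocycle by (simp add: continuous_cocycle_def)
  ultimately have "continuous_map (path_top L) (top_of_set {z. cmod z = 1})
      ((\<lambda>(a, b). c a b) \<circ> (\<lambda>x. (seg x 0 m, seg x m (m + n))))"
    by (rule continuous_map_compose)
  then show ?thesis by (simp add: o_def)
qed

lemma composed_shifts:
  "composed_local_homeomorphisms (path_top L) (shift 0) (shift m) (shift n) (shift (m + n))
    (\<lambda>x. c (seg x 0 m) (seg x m (m + n)))"
proof
  show "continuous_map (path_top L) euclidean (\<lambda>x. c (seg x 0 m) (seg x m (m + n)))"
    using continuous_path_cocycle by (rule continuous_map_into_fulltopology)
  show "cmod (c (seg x 0 m) (seg x m (m + n))) = 1" if "x \<in> topspace (path_top L)" for x
    using continuous_path_cocycle[of m n] that by (auto simp: continuous_map_def)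
qed (auto simp: Hausdorff_path_top local_homeomorphism_shift shift_0 topspace_path_top shift_shift add.commute)

lemma path_mult_eq:
  "path_mult c m n = composed_local_homeomorphisms.twisted_mult (shift m) (\<lambda>x :: ('o, 'm, 'k) path. c (seg x 0 m) (seg x m (m + n)))"
  by (intro ext) (simp only: path_mult_def composed_local_homeomorphisms.twisted_mult_def[OF composed_shifts[of m n]])

lemma path_mult_closed:
  "f \<in> vcarrier (path_corr L m) \<Longrightarrow> g \<in> vcarrier (path_corr L n) \<Longrightarrow>
    path_mult c m n f g \<in> vcarrier (path_corr L (m + n))"
  unfolding path_mult_eq path_corr_eq
  by (rule composed_local_homeomorphisms.twisted_mult_carrier[OF composed_shifts])

lemma path_mult_tensor:
  "\<exists>F. corr_iso (C0 (path_top L)) (tensor (C0 (path_top L)) (path_corr L m) (path_corr L n)) (path_corr L (m + n)) F \<and>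
     (\<forall>x\<in>vcarrier (path_corr L m). \<forall>y\<in>vcarrier (path_corr L n).
        F (elem_tensor (C0 (path_top L)) (path_corr L m) (path_corr L n) x y) = path_mult c m n x y)"
proof -
  interpret composed_local_homeomorphisms "path_top L" "shift 0" "shift m" "shift n" "shift (m + n)"
    "\<lambda>x. c (seg x 0 m) (seg x m (m + n))"
    by (rule composed_shifts)
  show ?thesis
    using corr_iso_tensor by (simp add: path_mult_eq path_corr_eq)
qed

lemma hausdorff_path_graph: "hausdorff_graph (lh_graph (path_top L) (shift 0) (shift n))"
  by (rule hausdorff_graph_lh_graph)
    (simp_all add: Hausdorff_path_top local_homeomorphism_shift shift_0 topspace_path_top)

lemma path_corr_outside: "f \<in> vcarrier (path_corr L n) \<Longrightarrow> x \<notin> inf_paths L \<Longrightarrow> f x = 0"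
  unfolding path_corr_eq graph_corr_carrier_iff lh_graph_sel topspace_path_top by blast

text \<open>At x this is the cocycle identity for the three consecutive segments x(0, m), x(m, m+n),
  x(m+n, m+n+p): a segment of the shifted path is a shifted segment of x. Off the path space f
  vanishes.\<close>

lemma path_mult_assoc:
  assumes "f \<in> vcarrier (path_corr L m)"
  shows "path_mult c (m + n) p (path_mult c m n f g) h = path_mult c m (n + p) f (path_mult c n p g h)"
proof
  fix x
  show "path_mult c (m + n) p (path_mult c m n f g) h x = path_mult c m (n + p) f (path_mult c n p g h) x"
  proof (cases "x \<in> inf_paths L")
    case True
    let ?a = "seg x 0 m" and ?b = "seg x m (m + n)" and ?d = "seg x (m + n) (m + n + p)"
    have le: "m + n \<le> m + n + p" "m \<le> m + n" by simp_all
    have ab: "(?a, ?b) \<in> composable L" "cmp L ?a ?b = seg x 0 (m + n)"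
      using seg_composable[OF True _ le(2)] seg_cmp[OF True _ le(2)] by simp_all
    have bd: "(?b, ?d) \<in> composable L" "cmp L ?b ?d = seg x m (m + n + p)"
      using seg_composable[OF True le(2,1)] seg_cmp[OF True le(2,1)] by simp_all
    have "seg (shift m x) 0 n = ?b" "seg (shift m x) n (n + p) = ?d"
      by (simp_all add: seg_shift add_ac)
    moreover have "shift n (shift m x) = shift (m + n) x"
      by (simp add: shift_shift add.commute)
    moreover have "c (seg x 0 (m + n)) ?d * c ?a ?b = c ?a (seg x m (m + n + p)) * c ?b ?d"
      using cocycle_identity[OF ab(1) bd(1)] ab(2) bd(2) by (simp add: mult.commute)
    ultimately show ?thesis
      by (simp add: path_mult_def add.assoc)
  qed (simp add: path_mult_def path_corr_outside[OF assms])
qed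

lemma path_corr_0:
  "vcarrier (path_corr L 0) = C0_set (path_top L)"
  "f \<in> C0_set (path_top L) \<Longrightarrow> ip (path_corr L 0) f g = (\<lambda>x. cnj (f x) * g x)"
  unfolding path_corr_eq graph_corr_sel
  using lh_graph_identity[of "path_top L" "shift 0" "shift 0"]
  by (simp_all add: Hausdorff_path_top local_homeomorphism_shift shift_0 topspace_path_top)

text \<open>The identification j of the coefficient algebra with the fibre over 0 is the identity
  map. Its compatibility with the two actions is the normalisation of c at the identities x(0, 0)
  and x(n, n).\<close>

lemma product_system_path_corr: "product_system (C0 (path_top L)) (path_corr L) (path_mult c)"
proof -
  \<comment> \<open>Off the path space \<open>shift 0\<close> need not fix x, but there f vanishes
    and both sides are 0.\<close>
  have shift_mult: "a (shift 0 x) * f x = a x * f x" if "f \<in> vcarrier (path_corr L n)" for a f n x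
    using path_corr_outside[OF that] shift_0 by (cases "x \<in> inf_paths L") auto
  have mult_shift: "f x * a (shift 0 x) = f x * a x" if "f \<in> vcarrier (path_corr L n)" for a f n x
    using path_corr_outside[OF that] shift_0 by (cases "x \<in> inf_paths L") auto
  have left: "path_mult c 0 n a f = lact (path_corr L n) a f"
    if a: "a \<in> vcarrier (path_corr L 0)" and f: "f \<in> vcarrier (path_corr L n)" for n a f
  proof
    fix x show "path_mult c 0 n a f x = lact (path_corr L n) a f x"
    proof (cases "x \<in> inf_paths L")
      case True
      have "c (seg x 0 0) (seg x 0 n) = 1"
        using cocycle_ident(2)[of "seg x 0 n"] seg_Mor[OF True, of 0 n] by (simp add: seg_refl[OF True])
      then show ?thesis
        using True by (simp add: path_mult_def path_corr_eq shift_0)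
    qed (simp add: path_mult_def path_corr_eq path_corr_outside[OF a] path_corr_outside[OF f])
  qed
  have right: "path_mult c n 0 f a = ract (path_corr L n) f a" if f: "f \<in> vcarrier (path_corr L n)" for n a f
  proof
    fix x show "path_mult c n 0 f a x = ract (path_corr L n) f a x"
    proof (cases "x \<in> inf_paths L")
      case True
      have "c (seg x 0 n) (seg x n n) = 1"
        using cocycle_ident(1)[of "seg x 0 n"] seg_Mor[OF True, of 0 n] by (simp add: seg_refl[OF True])
      then show ?thesis
        by (simp add: path_mult_def path_corr_eq)
    qed (simp add: path_mult_def path_corr_eq path_corr_outside[OF f])
  qed
  have iso: "corr_iso (C0 (path_top L)) (self_corr (C0 (path_top L))) (path_corr L 0) (\<lambda>a. a)"
  proof -
    have "bij_betw (\<lambda>a. a) (C0_set (path_top L)) (vcarrier (path_corr L 0))"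
      by (simp add: path_corr_0 bij_betw_def)
    moreover have "ract (path_corr L 0) f a = (\<lambda>x. f x * a x)" "lact (path_corr L 0) a f = (\<lambda>x. a x * f x)"
      if "f \<in> C0_set (path_top L)" for f a
      using that shift_mult[of f 0] mult_shift[of f 0] path_corr_0(1) by (auto simp: path_corr_eq)
    moreover have "vadd (path_corr L 0) = (\<lambda>f g x. f x + g x)" "vscale (path_corr L 0) = (\<lambda>z f x. z * f x)"
      by (simp_all add: path_corr_eq)
    ultimately show ?thesis
      by (simp add: corr_iso_def self_corr_def path_corr_0)
  qed
  have corr: "correspondence (C0 (path_top L)) (path_corr L n)" for n
    using hausdorff_graph.correspondence_graph_corr[OF hausdorff_path_graph] by (simp add: path_corr_eq)
  have "\<exists>j. corr_iso (C0 (path_top L)) (self_corr (C0 (path_top L))) (path_corr L 0) j \<and>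
      (\<forall>n. \<forall>a\<in>vcarrier (C0 (path_top L)). \<forall>x\<in>vcarrier (path_corr L n).
         path_mult c 0 n (j a) x = lact (path_corr L n) a x \<and> path_mult c n 0 x (j a) = ract (path_corr L n) x a)"
    using iso left right path_corr_0(1) by (intro exI[of _ "\<lambda>a. a"]) simp
  then show ?thesis
    unfolding product_system_def
    using cstar_algebra_C0 corr path_mult_closed path_mult_assoc path_mult_tensor by blast
qed

end

theorem proposition4p2:
  fixes L :: "('o, 'm, 'k::finite) top_kgraph"
    and c :: "'m \<Rightarrow> 'm \<Rightarrow> complex"
  assumes "topological_kgraph L" and "proper_kgraph L" and "source_free L"
    and "continuous_cocycle L c"
  shows "(\<forall>m n. \<forall>f\<in>vcarrier (path_corr L m). \<forall>g\<in>vcarrier (path_corr L n).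
            path_mult c m n f g \<in> vcarrier (path_corr L (m + n))) \<and>
         product_system (C0 (path_top L)) (path_corr L) (path_mult c)"
proof -
  interpret kgraph_cocycle L c
    by unfold_locales (fact assms)+
  show ?thesis
    using path_mult_closed product_system_path_corr by blast
qed

end
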